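(* For all integers $d_1\ge d_2>0$, the moduli space $\widetilde{Mp}_{0,2}(\mathbb{P}^1\times\mathbb{P}^1,(d_1,d_2))$ is a complete and simplicial toric variety. In particular, it is a compact orbifold.
   Context: Let $d_1\ge d_2>0$ be integers, $n=2d_1+2d_2+1$, $r=(d_1+3)(d_2+3)-6$, so $r-n=(d_1+1)(d_2+1)+1$. Put $I=(\{0,\dots,d_1\}\times\{0,\dots,d_2\})\setminus\{(0,0),(d_1,d_2)\}$. Weight matrix. $W_{(d_1,d_2)}=(w_{(\mu,\rho)})$ is the integer $(r-n)\times r$ matrix with rows labelled by $\mu\in\{z_0,\dots,z_{d_1},w_0,\dots,w_{d_2}\}\cup\{f_{(p,q)}: 1\le p\le d_1,1\le q\le d_2\}$ and columns labelled by $\rho\in\{a_i^1,a_i^2: 0\le i\le d_1\}\cup\{b_j^1,b_j^2:0\le j\le d_2\}\cup\{u_{(i,j)}:(i,j)\in I\}$. Writing $e_\mu$ for the standard basis vectors, columns $a_i^1$ and $a_i^2$ both equal $e_{z_i}$; columns $b_j^1$ and $b_j^2$ both equal $e_{w_j}$; column $u_{(i,j)}$ is the sum of the following three parts: - $z$-part: if $j=0$, it is $-e_{z_{i-1}}+e_{z_i}$ for $1\le i\le d_1-1$ and $-e_{z_{d_1-1}}$ for $i=d_1$; if $j=d_2$, it is $e_{z_i}-e_{z_{i+1}}$ for $1\le i\le d_1-1$ and $-e_{z_1}$ for $i=0$; otherwise $0$. - $w$-part: if $i=0$, it is $-e_{w_{j-1}}+e_{w_j}$ for $1\le j\le d_2-1$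 and $-e_{w_{d_2-1}}$ for $j=d_2$; if $i=d_1$, it is $e_{w_j}-e_{w_{j+1}}$ for $1\le j\le d_2-1$ and $-e_{w_1}$ for $j=0$; otherwise $0$. - $f$-part: the entry in row $f_{(p,q)}$ is $-1$ if $(p,q)\in\{(i,j),(i+1,j+1)\}$, $1$ if $(p,q)\in\{(i+1,j),(i,j+1)\}$, and $0$ otherwise. Moduli space. Coordinates on $\mathbb{C}^r$ are $x_\rho$ indexed by the column labels $\rho$; write $\bm a_i=(a_i^1,a_i^2)\in\mathbb{C}^2$, $\bm b_j=(b_j^1,b_j^2)\in\mathbb{C}^2$, and $u_{(i,j)}\in\mathbb{C}$ for $(i,j)\in I$. Let $U_{(d_1,d_2)}\subset\mathbb{C}^r$ be the set of points such that: $\bm a_0,\bm a_{d_1},\bm b_0,\bm b_{d_2}\ne\bm 0$; $(\bm a_i,\ u_{(i,0)}u_{(i,1)}\cdots u_{(i,d_2)})\ne\bm 0$ for $1\le i\le d_1-1$; $(\bm b_j,\ u_{(0,j)}u_{(1,j)}\cdots u_{(d_1,j)})\ne\bm 0$ for $1\le j\le d_2-1$; and $(u_{(i_1,i_2)},u_{(j_1,j_2)})\ne(0,0)$ whenever $0\le i_1<j_1\le d_1$ and $0\le j_2<i_2\le d_2$. Then $\widetilde{Mp}_{0,2}(\mathbb{P}^1\times\mathbb{P}^1,(d_1,d_2)):=U_{(d_1,d_2)}/(\mathbb{C}^\times)^{r-n}$, where $(\lambda_\mu)_\mu\in(\mathbb{C}^\times)^{r-n}$ acts by $x_\rho\mapsto\bigl(\prod_\mu\lambda_\mu^{w_{(\mu,\rho)}}\bigr)x_\rho$.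 A toric variety is called simplicial (an orbifold) if it is the toric variety of a simplicial fan, i.e. a fan in which every cone is generated by linearly independent vectors. *)

theory Defs
  imports "HOL-Analysis.Analysis"
begin

section \<open>Complex varieties as spaces with functions\<close>

text \<open>A (classical) complex variety is represented by its set of closed points with the Zariski
  topology, together with the sheaf of regular functions: \<open>regular X V f\<close> says that \<open>f\<close>, restricted
  to the open set \<open>V\<close>, is regular. Values of \<open>f\<close> outside \<open>V\<close> are irrelevant.\<close>

record 'a space_with_functions =
  zariski :: "'a topology"
  regular :: "'a set \<Rightarrow> ('a \<Rightarrow> complex) \<Rightarrow> bool"

definition isomorphic_spaces ::
    "'a space_with_functions \<Rightarrow> 'b space_with_functions \<Rightarrow> bool" where
  "isomorphic_spaces X Y \<longleftrightarrow>
     (\<exists>\<phi>. homeomorphic_map (zariski X) (zariski Y) \<phi> \<and>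
          (\<forall>V f. openin (zariski Y) V \<longrightarrow>
             (regular Y V f \<longleftrightarrow>
              regular X {x \<in> topspace (zariski X). \<phi> x \<in> V} (f \<circ> \<phi>))))"

text \<open>The structure induced on a set \<open>P\<close> of points by a ring \<open>R\<close> of functions: the Zariski topology
  is generated by the nonvanishing loci of elements of \<open>R\<close>, and a function is regular if it is
  locally a quotient of elements of \<open>R\<close>. For \<open>P\<close> affine and \<open>R\<close> its coordinate ring this is the
  affine variety; for \<open>P\<close> Zariski open in affine space and \<open>R\<close> the polynomial functions, this is
  the induced structure of an open subvariety.\<close>

definition zariski_topology :: "'a set \<Rightarrow> ('a \<Rightarrow> complex) set \<Rightarrow> 'a topology" where
  "zariski_topology P R = topology_generated_by {{x \<in> P. f x \<noteq> 0} | f. f \<in> R}"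

definition zariski_space :: "'a set \<Rightarrow> ('a \<Rightarrow> complex) set \<Rightarrow> 'a space_with_functions" where
  "zariski_space P R =
     \<lparr> zariski = zariski_topology P R,
       regular = (\<lambda>V f. openin (zariski_topology P R) V \<and>
         (\<forall>x\<in>V. \<exists>V' g h. openin (zariski_topology P R) V' \<and> x \<in> V' \<and> V' \<subseteq> V \<and>
            g \<in> R \<and> h \<in> R \<and> (\<forall>y\<in>V'. h y \<noteq> 0 \<and> f y = g y / h y))) \<rparr>"

text \<open>Final structures, used both for orbit spaces (one map) and for gluing (one map per chart):
  a set is open, and a function on it is regular, iff this holds after pulling back along all the
  maps \<open>q i\<close>.\<close>

definition final_topology :: "'i set \<Rightarrow> ('i \<Rightarrow> 'a topology) \<Rightarrow> ('i \<Rightarrow> 'a \<Rightarrow> 'b) \<Rightarrow> 'b topology" where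
  "final_topology I T q =
     topology (\<lambda>V. V \<subseteq> (\<Union>i\<in>I. q i ` topspace (T i)) \<and>
                   (\<forall>i\<in>I. openin (T i) {x \<in> topspace (T i). q i x \<in> V}))"

lemma openin_final_topology:
  "openin (final_topology I T q) V \<longleftrightarrow>
     V \<subseteq> (\<Union>i\<in>I. q i ` topspace (T i)) \<and>
     (\<forall>i\<in>I. openin (T i) {x \<in> topspace (T i). q i x \<in> V})"
proof -
  have "istopology (\<lambda>V. V \<subseteq> (\<Union>i\<in>I. q i ` topspace (T i)) \<and>
                   (\<forall>i\<in>I. openin (T i) {x \<in> topspace (T i). q i x \<in> V}))"
    unfolding istopology_def
  proof (intro conjI allI impI ballI)
    fix A B i
    assume "A \<subseteq> (\<Union>i\<in>I. q i ` topspace (T i)) \<and>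
              (\<forall>i\<in>I. openin (T i) {x \<in> topspace (T i). q i x \<in> A})"
      and "B \<subseteq> (\<Union>i\<in>I. q i ` topspace (T i)) \<and>
              (\<forall>i\<in>I. openin (T i) {x \<in> topspace (T i). q i x \<in> B})"
      and "i \<in> I"
    then have "openin (T i)
        ({x \<in> topspace (T i). q i x \<in> A} \<inter> {x \<in> topspace (T i). q i x \<in> B})"
      by blast
    moreover have "{x \<in> topspace (T i). q i x \<in> A} \<inter> {x \<in> topspace (T i). q i x \<in> B}
        = {x \<in> topspace (T i). q i x \<in> A \<inter> B}"
      by blast
    ultimately show "openin (T i) {x \<in> topspace (T i). q i x \<in> A \<inter> B}"
      by simp
  next
    fix \<K> i
    assume K: "\<forall>K\<in>\<K>. K \<subseteq> (\<Union>i\<in>I. q i ` topspace (T i)) \<and>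
              (\<forall>i\<in>I. openin (T i) {x \<in> topspace (T i). q i x \<in> K})" and "i \<in> I"
    then have "openin (T i) (\<Union>K\<in>\<K>. {x \<in> topspace (T i). q i x \<in> K})"
      by blast
    moreover have "(\<Union>K\<in>\<K>. {x \<in> topspace (T i). q i x \<in> K})
        = {x \<in> topspace (T i). q i x \<in> \<Union>\<K>}"
      by blast
    ultimately show "openin (T i) {x \<in> topspace (T i). q i x \<in> \<Union>\<K>}"
      by simp
  qed blast+
  then show ?thesis
    unfolding final_topology_def by (simp add: topology_inverse')
qed

definition final_space ::
    "'i set \<Rightarrow> ('i \<Rightarrow> 'a space_with_functions) \<Rightarrow> ('i \<Rightarrow> 'a \<Rightarrow> 'b) \<Rightarrow> 'b space_with_functions" where
  "final_space I X q =
     \<lparr> zariski = final_topology I (\<lambda>i. zariski (X i)) q,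
       regular = (\<lambda>V f. openin (final_topology I (\<lambda>i. zariski (X i)) q) V \<and>
         (\<forall>i\<in>I. regular (X i) {x \<in> topspace (zariski (X i)). q i x \<in> V} (f \<circ> q i))) \<rparr>"


section \<open>Fans\<close>

text \<open>The lattice of one-parameter subgroups is \<open>\<int>\<^sup>n\<close> inside \<open>\<real>\<^sup>n\<close>, its dual is identified with
  \<open>\<int>\<^sup>n\<close> by the inner product.\<close>

definition int_lattice :: "(real ^ 'n) set" where
  "int_lattice = {v. \<forall>i. v $ i \<in> \<int>}"

definition rational_polyhedral_cone :: "(real ^ 'n) set \<Rightarrow> bool" where
  "rational_polyhedral_cone \<sigma> \<longleftrightarrow> (\<exists>S. finite S \<and> S \<subseteq> int_lattice \<and> \<sigma> = convex_cone hull S)"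

definition strongly_convex :: "(real ^ 'n) set \<Rightarrow> bool" where
  "strongly_convex \<sigma> \<longleftrightarrow> \<sigma> \<inter> uminus ` \<sigma> = {0}"

text \<open>The library's \<open>face_of\<close> also counts the empty set as a face.\<close>

definition cone_face :: "(real ^ 'n) set \<Rightarrow> (real ^ 'n) set \<Rightarrow> bool" where
  "cone_face \<tau> \<sigma> \<longleftrightarrow> (\<exists>m. (\<forall>v\<in>\<sigma>. 0 \<le> m \<bullet> v) \<and> \<tau> = {v \<in> \<sigma>. m \<bullet> v = 0})"

definition fan :: "(real ^ 'n) set set \<Rightarrow> bool" where
  "fan \<Delta> \<longleftrightarrow>
     finite \<Delta> \<and>
     (\<forall>\<sigma>\<in>\<Delta>. rational_polyhedral_cone \<sigma> \<and> strongly_convex \<sigma>) \<and>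
     (\<forall>\<sigma>\<in>\<Delta>. \<forall>\<tau>. cone_face \<tau> \<sigma> \<longrightarrow> \<tau> \<in> \<Delta>) \<and>
     (\<forall>\<sigma>\<in>\<Delta>. \<forall>\<tau>\<in>\<Delta>. cone_face (\<sigma> \<inter> \<tau>) \<sigma> \<and> cone_face (\<sigma> \<inter> \<tau>) \<tau>)"

definition simplicial_fan :: "(real ^ 'n) set set \<Rightarrow> bool" where
  "simplicial_fan \<Delta> \<longleftrightarrow>
     fan \<Delta> \<and> (\<forall>\<sigma>\<in>\<Delta>. \<exists>S. independent S \<and> \<sigma> = convex_cone hull S)"

definition complete_fan :: "(real ^ 'n) set set \<Rightarrow> bool" where
  "complete_fan \<Delta> \<longleftrightarrow> fan \<Delta> \<and> \<Union>\<Delta> = UNIV"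


section \<open>The toric variety of a fan\<close>

definition dual_monoid :: "(real ^ 'n) set \<Rightarrow> (real ^ 'n) set" where
  "dual_monoid \<sigma> = {m \<in> int_lattice. \<forall>v\<in>\<sigma>. 0 \<le> m \<bullet> v}"

text \<open>The closed points of \<open>Spec \<complex>[S]\<close>, for \<open>S = dual_monoid \<sigma>\<close>, are the monoid homomorphisms from \<open>S\<close>
  to the multiplicative monoid of \<open>\<complex>\<close>; they are extended by 0 outside \<open>S\<close>. The coordinate ring
  consists of the linear combinations of the evaluations at elements of \<open>S\<close>.\<close>

definition chart_points :: "(real ^ 'n) set \<Rightarrow> (real ^ 'n \<Rightarrow> complex) set" where
  "chart_points \<sigma> =
     {\<gamma>. \<gamma> 0 = 1 \<and>
         (\<forall>m\<in>dual_monoid \<sigma>. \<forall>m'\<in>dual_monoid \<sigma>. \<gamma> (m + m') = \<gamma> m * \<gamma> m') \<and>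
         (\<forall>m. m \<notin> dual_monoid \<sigma> \<longrightarrow> \<gamma> m = 0)}"

definition chart_ring :: "(real ^ 'n) set \<Rightarrow> ((real ^ 'n \<Rightarrow> complex) \<Rightarrow> complex) set" where
  "chart_ring \<sigma> = {\<lambda>\<gamma>. \<Sum>m\<in>A. c m * \<gamma> m | c A. finite A \<and> A \<subseteq> dual_monoid \<sigma>}"

definition affine_toric_variety ::
    "(real ^ 'n) set \<Rightarrow> (real ^ 'n \<Rightarrow> complex) space_with_functions" where
  "affine_toric_variety \<sigma> = zariski_space (chart_points \<sigma>) (chart_ring \<sigma>)"

text \<open>Points of the charts of \<open>\<sigma>\<close> and \<open>\<tau>\<close> are identified iff they come from one point of the chart
  of \<open>\<sigma> \<inter> \<tau>\<close>, whose dual monoid contains those of \<open>\<sigma>\<close> and \<open>\<tau>\<close>. If \<open>\<Delta>\<close> is a fan, this is an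
  equivalence relation.\<close>

definition glue :: "(real ^ 'n) set set \<Rightarrow>
    (((real ^ 'n) set \<times> (real ^ 'n \<Rightarrow> complex)) \<times> ((real ^ 'n) set \<times> (real ^ 'n \<Rightarrow> complex))) set" where
  "glue \<Delta> =
     {((\<sigma>, \<gamma>), (\<tau>, \<delta>)). \<sigma> \<in> \<Delta> \<and> \<tau> \<in> \<Delta> \<and> \<gamma> \<in> chart_points \<sigma> \<and> \<delta> \<in> chart_points \<tau> \<and>
        (\<exists>\<epsilon>\<in>chart_points (\<sigma> \<inter> \<tau>).
           (\<forall>m\<in>dual_monoid \<sigma>. \<gamma> m = \<epsilon> m) \<and> (\<forall>m\<in>dual_monoid \<tau>. \<delta> m = \<epsilon> m))}"

definition toric_variety :: "(real ^ 'n) set set \<Rightarrow>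
    ((real ^ 'n) set \<times> (real ^ 'n \<Rightarrow> complex)) set space_with_functions" where
  "toric_variety \<Delta> = final_space \<Delta> affine_toric_variety (\<lambda>\<sigma> \<gamma>. glue \<Delta> `` {(\<sigma>, \<gamma>)})"


section \<open>The weight matrix\<close>

datatype column = Col_a1 nat | Col_a2 nat | Col_b1 nat | Col_b2 nat | Col_u nat nat

datatype row = Row_z nat | Row_w nat | Row_f nat nat

definition index_set :: "nat \<Rightarrow> nat \<Rightarrow> (nat \<times> nat) set" where
  "index_set d1 d2 = ({0..d1} \<times> {0..d2}) - {(0, 0), (d1, d2)}"

definition column_labels :: "nat \<Rightarrow> nat \<Rightarrow> column set" where
  "column_labels d1 d2 =
     Col_a1 ` {0..d1} \<union> Col_a2 ` {0..d1} \<union> Col_b1 ` {0..d2} \<union> Col_b2 ` {0..d2} \<union>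
     (\<lambda>(i, j). Col_u i j) ` index_set d1 d2"

definition row_labels :: "nat \<Rightarrow> nat \<Rightarrow> row set" where
  "row_labels d1 d2 = Row_z ` {0..d1} \<union> Row_w ` {0..d2} \<union> (\<lambda>(p, q). Row_f p q) ` ({1..d1} \<times> {1..d2})"

definition basis_entry :: "row \<Rightarrow> row \<Rightarrow> int" where
  "basis_entry \<mu> \<nu> = (if \<nu> = \<mu> then 1 else 0)"

definition z_part :: "nat \<Rightarrow> nat \<Rightarrow> nat \<Rightarrow> nat \<Rightarrow> row \<Rightarrow> int" where
  "z_part d1 d2 i j \<mu> =
     (if j = 0 then
        if 1 \<le> i \<and> i \<le> d1 - 1 then - basis_entry (Row_z (i - 1)) \<mu> + basis_entry (Row_z i) \<mu>
        else if i = d1 then - basis_entry (Row_z (d1 - 1)) \<mu>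
        else 0
      else if j = d2 then
        if 1 \<le> i \<and> i \<le> d1 - 1 then basis_entry (Row_z i) \<mu> - basis_entry (Row_z (i + 1)) \<mu>
        else if i = 0 then - basis_entry (Row_z 1) \<mu>
        else 0
      else 0)"

definition w_part :: "nat \<Rightarrow> nat \<Rightarrow> nat \<Rightarrow> nat \<Rightarrow> row \<Rightarrow> int" where
  "w_part d1 d2 i j \<mu> =
     (if i = 0 then
        if 1 \<le> j \<and> j \<le> d2 - 1 then - basis_entry (Row_w (j - 1)) \<mu> + basis_entry (Row_w j) \<mu>
        else if j = d2 then - basis_entry (Row_w (d2 - 1)) \<mu>
        else 0
      else if i = d1 then
        if 1 \<le> j \<and> j \<le> d2 - 1 then basis_entry (Row_w j) \<mu> - basis_entry (Row_w (j + 1)) \<mu>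
        else if j = 0 then - basis_entry (Row_w 1) \<mu>
        else 0
      else 0)"

definition f_part :: "nat \<Rightarrow> nat \<Rightarrow> row \<Rightarrow> int" where
  "f_part i j \<mu> =
     (case \<mu> of
        Row_f p q \<Rightarrow>
          if (p, q) \<in> {(i, j), (i + 1, j + 1)} then - 1
          else if (p, q) \<in> {(i + 1, j), (i, j + 1)} then 1
          else 0
      | _ \<Rightarrow> 0)"

fun weight :: "nat \<Rightarrow> nat \<Rightarrow> row \<Rightarrow> column \<Rightarrow> int" where
  "weight d1 d2 \<mu> (Col_a1 i) = basis_entry (Row_z i) \<mu>"
| "weight d1 d2 \<mu> (Col_a2 i) = basis_entry (Row_z i) \<mu>"
| "weight d1 d2 \<mu> (Col_b1 j) = basis_entry (Row_w j) \<mu>"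
| "weight d1 d2 \<mu> (Col_b2 j) = basis_entry (Row_w j) \<mu>"
| "weight d1 d2 \<mu> (Col_u i j) = z_part d1 d2 i j \<mu> + w_part d1 d2 i j \<mu> + f_part i j \<mu>"


section \<open>The moduli space\<close>

text \<open>\<open>\<complex>\<^sup>r\<close> is the set of functions on labels that vanish outside the column labels.\<close>

definition affine_space :: "nat \<Rightarrow> nat \<Rightarrow> (column \<Rightarrow> complex) set" where
  "affine_space d1 d2 = {x. \<forall>\<rho>. \<rho> \<notin> column_labels d1 d2 \<longrightarrow> x \<rho> = 0}"

definition polynomial_functions :: "nat \<Rightarrow> nat \<Rightarrow> ((column \<Rightarrow> complex) \<Rightarrow> complex) set" where
  "polynomial_functions d1 d2 =
     {\<lambda>x. \<Sum>e\<in>E. c e * (\<Prod>\<rho>\<in>column_labels d1 d2. x \<rho> ^ e \<rho>) | c (E :: (column \<Rightarrow> nat) set). finite E}"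

definition stable_points :: "nat \<Rightarrow> nat \<Rightarrow> (column \<Rightarrow> complex) set" where
  "stable_points d1 d2 = {x \<in> affine_space d1 d2.
     (x (Col_a1 0), x (Col_a2 0)) \<noteq> (0, 0) \<and>
     (x (Col_a1 d1), x (Col_a2 d1)) \<noteq> (0, 0) \<and>
     (x (Col_b1 0), x (Col_b2 0)) \<noteq> (0, 0) \<and>
     (x (Col_b1 d2), x (Col_b2 d2)) \<noteq> (0, 0) \<and>
     (\<forall>i. 1 \<le> i \<and> i \<le> d1 - 1 \<longrightarrow>
        (x (Col_a1 i), x (Col_a2 i), \<Prod>j=0..d2. x (Col_u i j)) \<noteq> (0, 0, 0)) \<and>
     (\<forall>j. 1 \<le> j \<and> j \<le> d2 - 1 \<longrightarrow>
        (x (Col_b1 j), x (Col_b2 j), \<Prod>i=0..d1. x (Col_u i j)) \<noteq> (0, 0, 0)) \<and>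
     (\<forall>i1 i2 j1 j2. i1 < j1 \<and> j1 \<le> d1 \<and> j2 < i2 \<and> i2 \<le> d2 \<longrightarrow>
        (x (Col_u i1 i2), x (Col_u j1 j2)) \<noteq> (0, 0))}"

definition torus :: "nat \<Rightarrow> nat \<Rightarrow> (row \<Rightarrow> complex) set" where
  "torus d1 d2 = {t. \<forall>\<mu>\<in>row_labels d1 d2. t \<mu> \<noteq> 0}"

definition torus_action ::
    "nat \<Rightarrow> nat \<Rightarrow> (row \<Rightarrow> complex) \<Rightarrow> (column \<Rightarrow> complex) \<Rightarrow> column \<Rightarrow> complex" where
  "torus_action d1 d2 t x \<rho> = (\<Prod>\<mu>\<in>row_labels d1 d2. t \<mu> powi weight d1 d2 \<mu> \<rho>) * x \<rho>"

definition torus_orbit ::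
    "nat \<Rightarrow> nat \<Rightarrow> (column \<Rightarrow> complex) \<Rightarrow> (column \<Rightarrow> complex) set" where
  "torus_orbit d1 d2 x = {torus_action d1 d2 t x | t. t \<in> torus d1 d2}"

text \<open>The quotient: its points are the orbits, and regular functions on an open set are the
  invariant regular functions on the preimage.\<close>

definition moduli_space :: "nat \<Rightarrow> nat \<Rightarrow> (column \<Rightarrow> complex) set space_with_functions" where
  "moduli_space d1 d2 =
     final_space {()} (\<lambda>_. zariski_space (stable_points d1 d2) (polynomial_functions d1 d2))
       (\<lambda>_. torus_orbit d1 d2)"

text \<open>The same set of orbits with the quotient of the Euclidean topology.\<close>

definition moduli_space_classical :: "nat \<Rightarrow> nat \<Rightarrow> (column \<Rightarrow> complex) set topology" where
  "moduli_space_classical d1 d2 =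
     final_topology {()} (\<lambda>_. top_of_set (stable_points d1 d2)) (\<lambda>_. torus_orbit d1 d2)"

end

theory Submission
  imports Defs "HOL-Library.Function_Algebras"
begin

text \<open>The one-parameter subgroups and characters of the quotient torus are Gale dual to the weight
  matrix: an integral kernel vector of the matrix has the form \<open>u\<^sub>(\<^sub>i\<^sub>,\<^sub>j\<^sub>) = \<alpha>\<^sub>i + \<beta>\<^sub>j\<close> with
  \<open>a\<^sub>i\<^sup>1 + a\<^sub>i\<^sup>2\<close> and \<open>b\<^sub>j\<^sup>1 + b\<^sub>j\<^sup>2\<close> equal to the discrete Laplacians of \<open>\<alpha>\<close> and \<open>\<beta>\<close>. The cones of the
  fan are spanned by the rays of sets of coordinates that may vanish simultaneously at a point of
  \<open>U\<close>. That the fan is complete and simplicial means that every vector is a nonnegative combination of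
  such a set of rays in exactly one way. The coefficients are found in two steps: along either factor,
  the numbers \<open>min a\<^sub>i\<^sup>1 a\<^sub>i\<^sup>2\<close> and the total multiplicities \<open>\<Sum>\<^sub>j u\<^sub>(\<^sub>i\<^sub>,\<^sub>j\<^sub>)\<close> solve a discrete obstacle problem,
  which has a unique solution; then the \<open>u\<^sub>(\<^sub>i\<^sub>,\<^sub>j\<^sub>)\<close> are the unique coupling of their marginals with support
  in a chain.

  For any such data the orbit space is the toric variety of the fan (Cox's construction). Orbits are
  the fibres of the quotient map on each chart because characters of subgroups of \<open>\<int>\<^sup>I\<close> extend, and
  functions descend because a power of a semi-invariant becomes invariant after division by a monomial
  in the coordinates that do not vanish on the chart. Compactness follows because the points of \<open>U\<close> with
  all coordinates in the closed unit disc, and a suitable set of them on the unit circle, form a compact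
  set that meets every orbit.\<close>

section \<open>Spaces of functions spanned by a set\<close>

text \<open>All fan axioms come from one source, the unique nonnegative representation with
  admissible support. Applied to the positive and negative parts of a relation, uniqueness gives
  independence of the rays of a cone; applied to a common point of two cones, it shows that they
  meet in the cone on their common rays. No list of maximal cones has to be handled.

  The obstacle in the quotient is that the rays of a cone are independent but not known to be part
  of a lattice basis, so an invariant monomial may see a coordinate only through a power of it.
  Hence the factor \<open>k\<close> in \<open>dual_vector\<close>, which recurs wherever a single
  coordinate must be tested or a weight cancelled. Only real linear algebra is at hand for
  independence, and a rational-linear retraction makes its solutions rational.

  Regular functions are local quotients g / h of arbitrary polynomials, neither of which need be
  semi-invariant. Independence of characters turns an identity g = c h along an orbit into the same
  identity for each weight component, so a single pair of components can replace g and h.\<close>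

inductive_set lin_span :: "('a \<Rightarrow> complex) set \<Rightarrow> ('a \<Rightarrow> complex) set" for B where
  zero: "(\<lambda>_. 0) \<in> lin_span B"
| step: "f \<in> lin_span B \<Longrightarrow> b \<in> B \<Longrightarrow> (\<lambda>x. f x + c * b x) \<in> lin_span B"

lemma lin_span_add:
  assumes "f \<in> lin_span B" "g \<in> lin_span B"
  shows "(\<lambda>x. f x + g x) \<in> lin_span B"
  using assms(2)
proof induction
  case zero
  then show ?case using assms(1) by simp
next
  case (step g b c)
  from lin_span.step[OF step.IH step.hyps(2), of c] show ?case
    by (simp add: add.assoc)
qed

lemma lin_span_scale:
  assumes "f \<in> lin_span B"
  shows "(\<lambda>x. c * f x) \<in> lin_span B"
  using assms
proof induction
  case zero
  then show ?case by (simp add: lin_span.zero)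
next
  case (step g b d)
  from lin_span.step[OF step.IH step.hyps(2), of "c * d"] show ?case
    by (simp add: algebra_simps)
qed

lemma lin_span_base: "b \<in> B \<Longrightarrow> b \<in> lin_span B"
  using lin_span.step[OF lin_span.zero, of b B 1] by simp

lemma lin_span_sum:
  assumes "finite I" "\<And>i. i \<in> I \<Longrightarrow> b i \<in> lin_span B"
  shows "(\<lambda>x. \<Sum>i\<in>I. b i x) \<in> lin_span B"
  using assms
proof induction
  case empty
  then show ?case by (simp add: lin_span.zero)
next
  case (insert i I)
  then show ?case by (simp add: lin_span_add)
qed

text \<open>Links the explicit finite sums in the definitions of the coordinate rings with the
  inductive span, on which closure properties become inductions over generators. The index
  \<open>i\<close> is kept apart from \<open>g i\<close>, as different indices may give the same
  function.\<close>

lemma lin_span_eq: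
  "{\<lambda>x. \<Sum>i\<in>A. c i * g i x | c A. finite A \<and> A \<subseteq> J} = lin_span (g ` J)"
proof (intro subset_antisym subsetI)
  fix f assume "f \<in> {\<lambda>x. \<Sum>i\<in>A. c i * g i x | c A. finite A \<and> A \<subseteq> J}"
  then obtain c A where f: "f = (\<lambda>x. \<Sum>i\<in>A. c i * g i x)" and A: "finite A" "A \<subseteq> J"
    by auto
  show "f \<in> lin_span (g ` J)"
    unfolding f using A by (intro lin_span_sum lin_span_scale lin_span_base) auto
next
  fix f assume "f \<in> lin_span (g ` J)"
  then show "f \<in> {\<lambda>x. \<Sum>i\<in>A. c i * g i x | c A. finite A \<and> A \<subseteq> J}"
  proof induction
    case zero
    show ?case by (rule CollectI, rule exI, rule exI[of _ "{}"]) auto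
  next
    case (step f b d)
    from step.IH obtain c A where f: "f = (\<lambda>x. \<Sum>i\<in>A. c i * g i x)"
      and A: "finite A" "A \<subseteq> J" by auto
    from step.hyps obtain j where j: "j \<in> J" "b = g j" by auto
    define c' where "c' = (\<lambda>i. (if i \<in> A then c i else 0) + (if i = j then d else 0))"
    have "f x + d * b x = (\<Sum>i\<in>insert j A. c' i * g i x)" for x
    proof -
      have "(\<Sum>i\<in>insert j A. c' i * g i x)
          = (\<Sum>i\<in>insert j A. (if i \<in> A then c i * g i x else 0))
            + (\<Sum>i\<in>insert j A. (if i = j then d * g i x else 0))"
        unfolding sum.distrib[symmetric] by (rule sum.cong) (auto simp: c'_def algebra_simps)
      also have "(\<Sum>i\<in>insert j A. (if i \<in> A then c i * g i x else 0)) = (\<Sum>i\<in>A. c i * g i x)"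
        using A by (intro sum.mono_neutral_cong_right) auto
      also have "(\<Sum>i\<in>insert j A. (if i = j then d * g i x else 0)) = d * g j x"
        using A by (simp add: sum.delta)
      finally show ?thesis using f j by simp
    qed
    then show ?case using A j by (intro CollectI exI[of _ c'] exI[of _ "insert j A"]) auto
  qed
qed

text \<open>Pullback of functions along \<open>p\<close> need only be checked on generators.
  Agreement is asked on \<open>P\<close> alone because values of ring elements outside the variety
  carry no meaning.\<close>

lemma lin_span_transport:
  assumes "f \<in> lin_span B"
    and "\<And>b. b \<in> B \<Longrightarrow> \<exists>b'\<in>lin_span B'. \<forall>y\<in>P. b (p y) = b' y"
  shows "\<exists>f'\<in>lin_span B'. \<forall>y\<in>P. f (p y) = f' y"
  using assms(1)
proof induction
  case zero
  show ?case by (rule bexI[OF _ lin_span.zero]) auto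
next
  case (step f b c)
  from step.IH obtain f' where "f' \<in> lin_span B'" "\<forall>y\<in>P. f (p y) = f' y" by auto
  moreover from assms(2)[OF step.hyps(2)] obtain b' where "b' \<in> lin_span B'" "\<forall>y\<in>P. b (p y) = b' y"
    by auto
  ultimately show ?case
    by (intro bexI[of _ "\<lambda>x. f' x + c * b' x"] lin_span_add lin_span_scale) auto
qed

text \<open>Products reduce to products of generators by linearity in each factor, hence the two
  nested inductions.\<close>

lemma lin_span_mult:
  assumes "f \<in> lin_span B" "g \<in> lin_span B'"
    and "\<And>b b'. b \<in> B \<Longrightarrow> b' \<in> B' \<Longrightarrow> \<exists>h\<in>lin_span B''. \<forall>x\<in>P. h x = b x * b' x"
  shows "\<exists>h\<in>lin_span B''. \<forall>x\<in>P. h x = f x * g x"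
  using assms(1)
proof induction
  case zero
  show ?case by (rule bexI[OF _ lin_span.zero]) auto
next
  case (step f b c)
  have "\<exists>h\<in>lin_span B''. \<forall>x\<in>P. h x = b x * g x"
    using assms(2)
  proof induction
    case zero
    show ?case by (rule bexI[OF _ lin_span.zero]) auto
  next
    case (step g b' d)
    from step.IH obtain h where "h \<in> lin_span B''" "\<forall>x\<in>P. h x = b x * g x" by auto
    moreover from assms(3)[OF \<open>b \<in> B\<close> step.hyps(2)] obtain k
      where "k \<in> lin_span B''" "\<forall>x\<in>P. k x = b x * b' x" by auto
    ultimately show ?case
      by (intro bexI[of _ "\<lambda>x. h x + d * k x"] lin_span_add lin_span_scale)
        (auto simp: algebra_simps)
  qed
  then obtain k where "k \<in> lin_span B''" "\<forall>x\<in>P. k x = b x * g x" by auto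
  moreover from step.IH obtain h where "h \<in> lin_span B''" "\<forall>x\<in>P. h x = f x * g x" by auto
  ultimately show ?case
    by (intro bexI[of _ "\<lambda>x. h x + c * k x"] lin_span_add lin_span_scale)
      (auto simp: algebra_simps)
qed


section \<open>Zariski structures\<close>

text \<open>Just enough of a ring to make the nonvanishing loci a base that is closed under
  intersection.\<close>

locale function_ring =
  fixes P :: "'a set" and R :: "('a \<Rightarrow> complex) set"
  assumes one: "\<exists>f\<in>R. \<forall>x\<in>P. f x = 1"
    and mult: "f \<in> R \<Longrightarrow> g \<in> R \<Longrightarrow> \<exists>h\<in>R. \<forall>x\<in>P. h x = f x * g x"
begin

text \<open>Products turn finite intersections of nonvanishing loci into nonvanishing loci, so these
  form a base and not merely a subbase.\<close>

lemma openin_iff: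
  "openin (zariski_topology P R) V \<longleftrightarrow>
    V \<subseteq> P \<and> (\<forall>x\<in>V. \<exists>f\<in>R. f x \<noteq> 0 \<and> {y \<in> P. f y \<noteq> 0} \<subseteq> V)" (is "?L \<longleftrightarrow> ?Q V")
proof
  assume ?L
  then have "generate_topology_on {{x \<in> P. f x \<noteq> 0} | f. f \<in> R} V"
    unfolding zariski_topology_def by (rule openin_topology_generated_by)
  then show "?Q V"
  proof induction
    case Empty
    then show ?case by simp
  next
    case (Int a b)
    show ?case
    proof (intro conjI ballI)
      show "a \<inter> b \<subseteq> P" using Int by blast
    next
      fix x assume x: "x \<in> a \<inter> b"
      from Int.IH(1) x obtain f where f: "f \<in> R" "f x \<noteq> 0" "{y \<in> P. f y \<noteq> 0} \<subseteq> a" by blast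
      from Int.IH(2) x obtain g where g: "g \<in> R" "g x \<noteq> 0" "{y \<in> P. g y \<noteq> 0} \<subseteq> b" by blast
      from mult[OF f(1) g(1)] obtain h where h: "h \<in> R" "\<forall>x\<in>P. h x = f x * g x" by blast
      have "x \<in> P" using x Int by blast
      with f g h show "\<exists>f\<in>R. f x \<noteq> 0 \<and> {y \<in> P. f y \<noteq> 0} \<subseteq> a \<inter> b"
        by (intro bexI[of _ h]) auto
    qed
  next
    case (UN K)
    then show ?case by (meson Sup_upper UnionE Union_least subset_trans)
  next
    case (Basis s)
    then show ?case by auto
  qed
next
  assume Q: "?Q V"
  have "V = \<Union>{{x \<in> P. f x \<noteq> 0} | f. f \<in> R \<and> {x \<in> P. f x \<noteq> 0} \<subseteq> V}"
    using Q by blast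
  also have "openin (zariski_topology P R) \<dots>"
    unfolding zariski_topology_def by (rule openin_Union) (auto intro!: topology_generated_by_Basis)
  finally show ?L .
qed

lemma topspace_zariski: "topspace (zariski_topology P R) = P"
proof -
  have "openin (zariski_topology P R) P"
    unfolding openin_iff using one by (metis (no_types, lifting) mem_Collect_eq subset_refl subsetI zero_neq_one)
  then show ?thesis
    by (meson openin_iff openin_subset openin_topspace subset_antisym)
qed

text \<open>A quotient can always be given on the locus of its own denominator: multiplying
  numerator and denominator by a function whose locus lies in the neighbourhood shrinks the domain
  to fit.\<close>

lemma regular_iff:
  "regular (zariski_space P R) V F \<longleftrightarrow>
     V \<subseteq> P \<and> (\<forall>x\<in>V. \<exists>g\<in>R. \<exists>h\<in>R. h x \<noteq> 0 \<and> {y \<in> P. h y \<noteq> 0} \<subseteq> V \<and>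
       (\<forall>y\<in>P. h y \<noteq> 0 \<longrightarrow> F y = g y / h y))" (is "?L \<longleftrightarrow> ?Q")
proof
  assume ?L
  then have V: "openin (zariski_topology P R) V"
    and F: "\<forall>x\<in>V. \<exists>V' g h. openin (zariski_topology P R) V' \<and> x \<in> V' \<and> V' \<subseteq> V \<and>
            g \<in> R \<and> h \<in> R \<and> (\<forall>y\<in>V'. h y \<noteq> 0 \<and> F y = g y / h y)"
    by (auto simp: zariski_space_def)
  show ?Q
  proof (intro conjI ballI)
    show "V \<subseteq> P" using V openin_iff by blast
    fix x assume x: "x \<in> V"
    from bspec[OF F x] obtain V' g h where V': "openin (zariski_topology P R) V'" "x \<in> V'" "V' \<subseteq> V"
      and gh: "g \<in> R" "h \<in> R" "\<forall>y\<in>V'. h y \<noteq> 0 \<and> F y = g y / h y" by blast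
    from V' obtain p where p: "p \<in> R" "p x \<noteq> 0" "{y \<in> P. p y \<noteq> 0} \<subseteq> V'"
      unfolding openin_iff by blast
    from mult[OF gh(1) p(1)] obtain g' where g': "g' \<in> R" "\<forall>x\<in>P. g' x = g x * p x" by blast
    from mult[OF gh(2) p(1)] obtain h' where h': "h' \<in> R" "\<forall>x\<in>P. h' x = h x * p x" by blast
    have xP: "x \<in> P" using x V openin_iff by blast
    show "\<exists>g\<in>R. \<exists>h\<in>R. h x \<noteq> 0 \<and> {y \<in> P. h y \<noteq> 0} \<subseteq> V \<and> (\<forall>y\<in>P. h y \<noteq> 0 \<longrightarrow> F y = g y / h y)"
    proof (rule bexI[OF _ g'(1)], rule bexI[OF _ h'(1)], intro conjI)
      show "h' x \<noteq> 0" using h'(2) gh(3) p(2) xP V'(2) by simp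
      show sub: "{y \<in> P. h' y \<noteq> 0} \<subseteq> V" using h'(2) p(3) V'(3) by auto
      show "\<forall>y\<in>P. h' y \<noteq> 0 \<longrightarrow> F y = g' y / h' y"
      proof (intro ballI impI)
        fix y assume y: "y \<in> P" "h' y \<noteq> 0"
        then have "p y \<noteq> 0" using h'(2) by auto
        then have "y \<in> V'" using p(3) y(1) by blast
        then have "F y = g y / h y" using gh(3) by blast
        then show "F y = g' y / h' y" using g'(2) h'(2) y(1) \<open>p y \<noteq> 0\<close> by simp
      qed
    qed
  qed
next
  assume Q: ?Q
  have V: "openin (zariski_topology P R) V"
    unfolding openin_iff using Q by blast
  have "\<exists>V' g h. openin (zariski_topology P R) V' \<and> x \<in> V' \<and> V' \<subseteq> V \<and>
            g \<in> R \<and> h \<in> R \<and> (\<forall>y\<in>V'. h y \<noteq> 0 \<and> F y = g y / h y)" if "x \<in> V" for x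
  proof -
    from Q that obtain g h where gh: "g \<in> R" "h \<in> R" "h x \<noteq> 0" "{y \<in> P. h y \<noteq> 0} \<subseteq> V"
       "\<forall>y\<in>P. h y \<noteq> 0 \<longrightarrow> F y = g y / h y" by blast
    have "openin (zariski_topology P R) {y \<in> P. h y \<noteq> 0}"
      unfolding openin_iff using gh by blast
    moreover have "x \<in> P" using Q that by blast
    ultimately show ?thesis
      using gh by (intro exI[of _ "{y \<in> P. h y \<noteq> 0}"] exI[of _ g] exI[of _ h]) auto
  qed
  with V show ?L by (simp add: zariski_space_def)
qed

end


section \<open>Characters of finitely generated free abelian groups\<close>

lemma prod_power_int:
  fixes f :: "'i \<Rightarrow> complex"
  shows "(\<Prod>i\<in>I. f i) powi n = (\<Prod>i\<in>I. f i powi n)"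
  by (induction I rule: infinite_finite_induct) (auto simp: power_int_mult_distrib)

text \<open>A homomorphism to \<open>\<complex>\<^sup>\<times>\<close> from a subgroup of \<open>\<int>\<^sup>I\<close> (given as the image of \<open>H\<close> under \<open>E\<close>)
  extends to \<open>\<int>\<^sup>I\<close>, one coordinate at a time, because \<open>\<complex>\<^sup>\<times>\<close> has roots.\<close>

lemma character_extension:
  fixes H :: "'g::ab_group_add set" and E :: "'g \<Rightarrow> 'i \<Rightarrow> int" and ch :: "'g \<Rightarrow> complex"
  assumes "finite I" "0 \<in> H" "\<And>a b. a \<in> H \<Longrightarrow> b \<in> H \<Longrightarrow> a - b \<in> H"
    and "\<And>a b i. a \<in> H \<Longrightarrow> b \<in> H \<Longrightarrow> i \<in> I \<Longrightarrow> E (a - b) i = E a i - E b i"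
    and "\<And>a. a \<in> H \<Longrightarrow> ch a \<noteq> 0"
    and "\<And>a b. a \<in> H \<Longrightarrow> b \<in> H \<Longrightarrow> ch (a - b) = ch a / ch b"
    and "\<And>a. a \<in> H \<Longrightarrow> (\<forall>i\<in>I. E a i = 0) \<Longrightarrow> ch a = 1"
  shows "\<exists>t. (\<forall>i\<in>I. t i \<noteq> 0) \<and> (\<forall>a\<in>H. ch a = (\<Prod>i\<in>I. t i powi E a i))"
  using assms
proof (induction I arbitrary: H rule: finite_induct)
  case empty
  then show ?case by auto
next
  case (insert i I)
  have H0: "0 \<in> H" and Hd: "\<And>a b. a \<in> H \<Longrightarrow> b \<in> H \<Longrightarrow> a - b \<in> H"
    and Ed: "\<And>a b j. a \<in> H \<Longrightarrow> b \<in> H \<Longrightarrow> j \<in> insert i I \<Longrightarrow> E (a - b) j = E a j - E b j"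
    and nz: "\<And>a. a \<in> H \<Longrightarrow> ch a \<noteq> 0"
    and hom: "\<And>a b. a \<in> H \<Longrightarrow> b \<in> H \<Longrightarrow> ch (a - b) = ch a / ch b"
    and triv: "\<And>a. a \<in> H \<Longrightarrow> (\<forall>j\<in>insert i I. E a j = 0) \<Longrightarrow> ch a = 1"
    using insert.prems by blast+
  have E0: "E 0 j = 0" if "j \<in> insert i I" for j
    using Ed[OF H0 H0 that] by simp
  have chi0: "ch 0 = 1" using hom[OF H0 H0] nz[OF H0] by simp
  have neg: "- a \<in> H" "ch (- a) = inverse (ch a)" if "a \<in> H" for a
    using Hd[OF H0 that] hom[OF H0 that] chi0 by (auto simp: divide_inverse)
  have Eneg: "E (- a) j = - E a j" if "a \<in> H" "j \<in> insert i I" for a j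
    using Ed[OF H0 that] E0[OF that(2)] by simp
  have add: "a + b \<in> H" "ch (a + b) = ch a * ch b" if "a \<in> H" "b \<in> H" for a b
    using Hd[OF that(1) neg(1)[OF that(2)]] hom[OF that(1) neg(1)[OF that(2)]] neg(2)[OF that(2)]
    by (auto simp: field_simps)
  have Eadd: "E (a + b) j = E a j + E b j" if "a \<in> H" "b \<in> H" "j \<in> insert i I" for a b j
    using Ed[OF that(1) neg(1)[OF that(2)] that(3)] Eneg[OF that(2,3)] by simp
  have mul: "\<exists>b\<in>H. (\<forall>j\<in>insert i I. E b j = n * E a j) \<and> ch b = ch a powi n" if a: "a \<in> H" for a n
  proof -
    have nat: "\<exists>b\<in>H. (\<forall>j\<in>insert i I. E b j = int k * E a j) \<and> ch b = ch a ^ k" for k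
    proof (induction k)
      case 0
      then show ?case using H0 E0 chi0 by auto
    next
      case (Suc k)
      then obtain b where "b \<in> H" "\<forall>j\<in>insert i I. E b j = int k * E a j" "ch b = ch a ^ k" by blast
      then show ?case using a by (intro bexI[of _ "a + b"]) (auto simp: add Eadd algebra_simps)
    qed
    show ?thesis
    proof (cases "n \<ge> 0")
      case True
      then show ?thesis using nat[of "nat n"] by (simp add: power_int_def)
    next
      case False
      from nat[of "nat (- n)"] obtain b where b: "b \<in> H" "\<forall>j\<in>insert i I. E b j = - n * E a j"
        "ch b = ch a ^ nat (- n)" using False by auto
      then show ?thesis using False
        by (intro bexI[of _ "- b"]) (auto simp: neg Eneg power_int_def power_inverse)
    qed
  qed
  \<comment> \<open>On the elements with vanishing i-th coordinate the induction hypothesis supplies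
    all the other coordinates of the extension.\<close>
  define H' where "H' = {a \<in> H. E a i = 0}"
  have "\<exists>t. (\<forall>j\<in>I. t j \<noteq> 0) \<and> (\<forall>a\<in>H'. ch a = (\<Prod>j\<in>I. t j powi E a j))"
  proof (rule insert.IH)
    show "0 \<in> H'" using H0 E0 by (simp add: H'_def)
  qed (use Hd Ed nz hom triv in \<open>auto simp: H'_def\<close>)
  then obtain t where t: "\<forall>j\<in>I. t j \<noteq> 0" "\<forall>a\<in>H'. ch a = (\<Prod>j\<in>I. t j powi E a j)" by blast
  show ?case
  proof (cases "\<exists>a\<in>H. E a i \<noteq> 0")
    case False
    then have "H' = H" by (auto simp: H'_def)
    then show ?thesis using t insert.hyps False
      by (intro exI[of _ "t(i := 1)"]) (auto intro!: prod.cong)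
  next
    case True
    \<comment> \<open>The i-th coordinates of \<open>H\<close> form a subgroup of the integers;
      \<open>Q\<close> singles out its positive elements, and the least of them generates
      it.\<close>
    define Q where "Q k \<longleftrightarrow> k > 0 \<and> (\<exists>a\<in>H. E a i = int k)" for k
    from True obtain a where a: "a \<in> H" "E a i \<noteq> 0" by blast
    have "Q (nat \<bar>E a i\<bar>)"
    proof (cases "E a i > 0")
      case True
      then show ?thesis using a by (auto simp: Q_def)
    next
      case False
      then show ?thesis using a neg(1)[OF a(1)] Eneg[OF a(1), of i]
        by (auto simp: Q_def intro!: bexI[of _ "- a"])
    qed
    then have Qk: "Q (LEAST k. Q k)" by (rule LeastI)
    define k where "k = (LEAST k. Q k)"
    from Qk obtain a0 where a0: "a0 \<in> H" "E a0 i = int k" and k: "k > 0"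
      unfolding Q_def k_def by blast
    have div: "E a i = E a i div int k * int k" if aH: "a \<in> H" for a
    proof (rule ccontr)
      assume neq: "E a i \<noteq> E a i div int k * int k"
      from mul[OF a0(1), of "E a i div int k"] obtain b where
        b: "b \<in> H" "E b i = E a i div int k * int k" using a0 by auto
      have "E (a - b) i = E a i mod int k"
        using Ed[OF aH b(1), of i] b by (simp add: minus_div_mult_eq_mod)
      moreover have pos: "E a i mod int k > 0"
      proof -
        have "E a i mod int k \<noteq> 0"
          using neq div_mult_mod_eq[of "E a i" "int k"] by linarith
        moreover have "E a i mod int k \<ge> 0" using k by simp
        ultimately show ?thesis by linarith
      qed
      ultimately have "Q (nat (E a i mod int k))"
        using Hd[OF aH b(1)] by (auto simp: Q_def)
      then have "k \<le> nat (E a i mod int k)" unfolding k_def by (rule Least_le)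
      moreover have "E a i mod int k < int k" using k by simp
      ultimately show False using pos by linarith
    qed
    have pnz: "(\<Prod>j\<in>I. t j powi n j) \<noteq> 0" for n
      using t(1) insert.hyps by auto
    \<comment> \<open>The only constraint on the new coordinate is the value at the generator
      \<open>a0\<close>, which prescribes the \<open>k\<close>-th power of \<open>s\<close>;
      \<open>exp\<close> and \<open>Ln\<close> provide a root.\<close>
    define s where "s = exp (Ln (ch a0 / (\<Prod>j\<in>I. t j powi E a0 j)) / of_nat k)"
    have s: "s ^ k = ch a0 / (\<Prod>j\<in>I. t j powi E a0 j)"
      using k pnz nz[OF a0(1)] by (simp add: s_def flip: exp_of_nat_mult)
    have s0: "s \<noteq> 0" by (simp add: s_def)
    have main: "ch a = s powi E a i * (\<Prod>j\<in>I. t j powi E a j)" if aH: "a \<in> H" for a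
    proof -
      \<comment> \<open>Subtracting the multiple \<open>b\<close> of \<open>a0\<close> with the same
        i-th coordinate reduces to \<open>H'\<close>.\<close>
      define q where "q = E a i div int k"
      from mul[OF a0(1), of q] obtain b where
        b: "b \<in> H" "\<forall>j\<in>insert i I. E b j = E a0 j * q" "ch b = ch a0 powi q"
        by (metis mult.commute)
      have "E (a - b) i = 0"
        using Ed[OF aH b(1), of i] b(2) a0(2) div[OF aH] unfolding q_def
        by (metis insertI1 mult.commute diff_self)
      then have ab: "a - b \<in> H'"
        using Hd[OF aH b(1)] by (simp add: H'_def)
      have Eab: "E (a - b) j = E a j - E a0 j * q" if "j \<in> I" for j
        using Ed[OF aH b(1)] b(2) that by simp
      have "ch a = ch (a - b) * ch b" using hom[OF aH b(1)] nz[OF b(1)] by simp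
      also have "ch (a - b) = (\<Prod>j\<in>I. t j powi E (a - b) j)" using t(2) ab by blast
      also have "\<dots> = (\<Prod>j\<in>I. t j powi E a j / (t j powi E a0 j) powi q)"
        using t(1) Eab by (intro prod.cong) (auto simp: power_int_diff power_int_mult)
      also have "\<dots> = (\<Prod>j\<in>I. t j powi E a j) / (\<Prod>j\<in>I. t j powi E a0 j) powi q"
        by (simp add: prod_dividef prod_power_int)
      also have "ch b = (s ^ k * (\<Prod>j\<in>I. t j powi E a0 j)) powi q"
        using b(3) s pnz by simp
      also have "\<dots> = s powi (E a i) * (\<Prod>j\<in>I. t j powi E a0 j) powi q"
      proof -
        have "E a i = int k * q" using div[OF aH] unfolding q_def by (metis mult.commute)
        then show ?thesis by (simp only: power_int_mult_distrib power_int_power)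
      qed
      finally show ?thesis using pnz by (simp add: power_int_not_zero)
    qed
    have upd: "(\<Prod>j\<in>insert i I. (t(i := s)) j powi E a j) = s powi E a i * (\<Prod>j\<in>I. t j powi E a j)" for a
    proof -
      have "(\<Prod>j\<in>I. (t(i := s)) j powi E a j) = (\<Prod>j\<in>I. t j powi E a j)"
        using insert.hyps by (intro prod.cong) auto
      then show ?thesis using insert.hyps by simp
    qed
    have "\<forall>a\<in>H. ch a = (\<Prod>j\<in>insert i I. (t(i := s)) j powi E a j)"
      unfolding upd using main by blast
    moreover have "\<forall>j\<in>insert i I. (t(i := s)) j \<noteq> 0" using t(1) s0 by simp
    ultimately show ?thesis by blast
  qed
qed

text \<open>Artin's argument for the independence of characters.\<close>

lemma characters_independent:
  fixes a :: "('r \<Rightarrow> int) \<Rightarrow> complex"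
  assumes "finite X" "finite R" "X \<subseteq> {ch. \<forall>\<mu>. \<mu> \<notin> R \<longrightarrow> ch \<mu> = 0}"
    and "\<And>t. (\<forall>\<mu>\<in>R. t \<mu> \<noteq> 0) \<Longrightarrow> (\<Sum>ch\<in>X. a ch * (\<Prod>\<mu>\<in>R. t \<mu> powi ch \<mu>)) = 0"
  shows "\<forall>ch\<in>X. a ch = 0"
  using assms(1,3,4)
proof (induction X arbitrary: a rule: finite_induct)
  case empty
  then show ?case by simp
next
  case (insert ch0 X)
  let ?p = "\<lambda>t ch. \<Prod>\<mu>\<in>R. t \<mu> powi ch \<mu> :: complex"
  have "a ch = 0" if X: "ch \<in> X" for ch
  proof -
    have "ch \<noteq> ch0" using X insert.hyps by blast
    then obtain \<nu> where nu: "ch \<nu> \<noteq> ch0 \<nu>" by blast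
    then have nuR: "\<nu> \<in> R" using insert.prems(1) X by (metis (mono_tags, lifting) insert_iff mem_Collect_eq subsetD)
    \<comment> \<open>Translation by \<open>s\<close> multiplies each character by its value at
      \<open>s\<close>, so subtracting \<open>?p s ch0\<close> times the original relation removes
      \<open>ch0\<close>. The coordinate 2 separates characters because its powers with different
      exponents differ.\<close>
    define s :: "'r \<Rightarrow> complex" where "s = (\<lambda>\<mu>. if \<mu> = \<nu> then 2 else 1)"
    have s: "\<forall>\<mu>\<in>R. s \<mu> \<noteq> 0" by (simp add: s_def)
    have ps: "?p s \<psi> = 2 powi \<psi> \<nu>" for \<psi>
    proof -
      have "?p s \<psi> = (\<Prod>\<mu>\<in>R. if \<mu> = \<nu> then 2 powi \<psi> \<mu> else 1)"
        by (rule prod.cong) (auto simp: s_def)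
      then show ?thesis using nuR assms(2) by (simp add: prod.delta)
    qed
    have "\<forall>\<psi>\<in>X. a \<psi> * (?p s \<psi> - ?p s ch0) = 0"
    proof (rule insert.IH)
      show "X \<subseteq> {ch. \<forall>\<mu>. \<mu> \<notin> R \<longrightarrow> ch \<mu> = 0}" using insert.prems by blast
    next
      fix t :: "'r \<Rightarrow> complex" assume t: "\<forall>\<mu>\<in>R. t \<mu> \<noteq> 0"
      have st: "\<forall>\<mu>\<in>R. s \<mu> * t \<mu> \<noteq> 0" using s t by simp
      have pst: "?p (\<lambda>\<mu>. s \<mu> * t \<mu>) \<psi> = ?p s \<psi> * ?p t \<psi>" for \<psi>
        by (simp add: power_int_mult_distrib prod.distrib)
      have 1: "a ch0 * (?p s ch0 * ?p t ch0) + (\<Sum>\<psi>\<in>X. a \<psi> * (?p s \<psi> * ?p t \<psi>)) = 0"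
        using insert.prems(2)[OF st] insert.hyps unfolding pst by simp
      have 2: "a ch0 * ?p t ch0 + (\<Sum>\<psi>\<in>X. a \<psi> * ?p t \<psi>) = 0"
        using insert.prems(2)[OF t] insert.hyps by simp
      have "(\<Sum>\<psi>\<in>X. a \<psi> * (?p s \<psi> - ?p s ch0) * ?p t \<psi>)
          = (\<Sum>\<psi>\<in>X. a \<psi> * (?p s \<psi> * ?p t \<psi>)) - ?p s ch0 * (\<Sum>\<psi>\<in>X. a \<psi> * ?p t \<psi>)"
        by (simp add: sum_distrib_left sum_subtractf algebra_simps)
      also have "\<dots> = 0" using 1 2 by algebra
      finally show "(\<Sum>\<psi>\<in>X. a \<psi> * (?p s \<psi> - ?p s ch0) * ?p t \<psi>) = 0" .
    qed
    then have "a ch * (2 powi ch \<nu> - 2 powi ch0 \<nu>) = 0" using X ps by simp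
    moreover have "(2::complex) powi ch \<nu> \<noteq> 2 powi ch0 \<nu>"
    proof
      assume "(2::complex) powi ch \<nu> = 2 powi ch0 \<nu>"
      then have "of_real (2 powi ch \<nu>) = (of_real (2 powi ch0 \<nu>) :: complex)" by simp
      then have "(2::real) powi ch \<nu> = 2 powi ch0 \<nu>" using of_real_eq_iff by blast
      then show False using nu
        by (metis linorder_neqE_linordered_idom order_less_irrefl one_less_numeral_iff
          power_int_strict_increasing semiring_norm(76))
    qed
    ultimately show ?thesis by simp
  qed
  moreover from this have "a ch0 = 0"
    using insert.prems(2)[of "\<lambda>_. 1"] insert.hyps by simp
  ultimately show ?case by simp
qed

text \<open>A \<open>\<rat>\<close>-linear retraction of \<open>\<real>\<close> onto \<open>\<rat>\<close> turns real solutions of rational linear systems into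
  rational ones.\<close>

lemma rational_retraction:
  obtains p :: "real \<Rightarrow> rat" where "\<And>x y. p (x + y) = p x + p y"
    and "\<And>(k::int) x. p (of_int k * x) = of_int k * p x" and "p 1 = 1"
proof -
  \<comment> \<open>The reals as a rational vector space. Since 1 alone is independent, it can be
    sent to 1 by a linear map to the rationals.\<close>
  interpret V: vector_space_pair "\<lambda>(q::rat) (x::real). of_rat q * x" "(*) :: rat \<Rightarrow> rat \<Rightarrow> rat"
    by unfold_locales (auto simp: algebra_simps of_rat_add of_rat_mult)
  have ind: "V.vs1.independent {1}"
    by (simp add: V.vs1.independent_insert V.vs1.independent_empty V.vs1.span_empty)
  let ?p = "V.construct {1} (\<lambda>_. 1)"
  have lin: "Vector_Spaces.linear (\<lambda>(q::rat) (x::real). of_rat q * x) (*) ?p"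
    by (rule V.linear_construct[OF ind])
  show ?thesis
  proof (rule that[of ?p])
    show "?p (x + y) = ?p x + ?p y" for x y
      using lin by (rule Vector_Spaces.linear.axioms(3)[THEN module_hom.add, OF _ ]) 
    show "?p (of_int k * x) = of_int k * ?p x" for k x
      using V.linear_scale[OF lin, of "of_int k" x] by simp
    show "?p 1 = 1" using V.construct_basis[OF ind, of 1] by simp
  qed
qed

section \<open>The fan\<close>

lemma int_lattice_iff: "x \<in> int_lattice \<longleftrightarrow> (\<forall>i. x $ i \<in> \<int>)"
  by (simp add: int_lattice_def)

lemma int_lattice_add: "x \<in> int_lattice \<Longrightarrow> y \<in> int_lattice \<Longrightarrow> x + y \<in> int_lattice"
  by (simp add: int_lattice_iff)

lemma int_lattice_diff: "x \<in> int_lattice \<Longrightarrow> y \<in> int_lattice \<Longrightarrow> x - y \<in> int_lattice"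
  by (simp add: int_lattice_iff)

lemma int_lattice_scale: "x \<in> int_lattice \<Longrightarrow> k \<in> \<int> \<Longrightarrow> k *\<^sub>R x \<in> int_lattice"
  by (simp add: int_lattice_iff)

lemma int_lattice_0: "0 \<in> int_lattice"
  by (simp add: int_lattice_iff)

lemma inner_int_lattice: "x \<in> int_lattice \<Longrightarrow> y \<in> int_lattice \<Longrightarrow> x \<bullet> y \<in> \<int>"
  unfolding int_lattice_iff inner_vec_def by (auto intro!: Ints_sum)

text \<open>The sets in \<open>A\<close> are the coordinate subsets that may vanish simultaneously at a stable point;
  \<open>v \<rho>\<close> is the ray of the coordinate \<open>\<rho>\<close>. Assumption \<open>kernel\<close> is Gale duality between the rays and
  the weights \<open>w\<close>.\<close>

locale cox_data =
  fixes C :: "'c set" and R :: "'r set" and w :: "'r \<Rightarrow> 'c \<Rightarrow> int"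
    and v :: "'c \<Rightarrow> real ^ 'n" and A :: "'c set set"
  assumes finite_C: "finite C" and finite_R: "finite R"
    and v_int: "\<rho> \<in> C \<Longrightarrow> v \<rho> \<in> int_lattice"
    and kernel: "(\<forall>\<mu>\<in>R. (\<Sum>\<rho>\<in>C. w \<mu> \<rho> * e \<rho>) = 0) \<longleftrightarrow>
                 (\<exists>m\<in>int_lattice. \<forall>\<rho>\<in>C. of_int (e \<rho>) = m \<bullet> v \<rho>)"
    and A_sub: "S \<in> A \<Longrightarrow> S \<subseteq> C" and A_down: "S \<in> A \<Longrightarrow> S' \<subseteq> S \<Longrightarrow> S' \<in> A"
    and cover: "\<exists>c. (\<forall>\<rho>\<in>C. 0 \<le> c \<rho>) \<and> {\<rho> \<in> C. c \<rho> \<noteq> 0} \<in> A \<and> (\<Sum>\<rho>\<in>C. c \<rho> *\<^sub>R v \<rho>) = y"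
    and unique: "\<forall>\<rho>\<in>C. 0 \<le> c \<rho> \<Longrightarrow> {\<rho> \<in> C. c \<rho> \<noteq> 0} \<in> A \<Longrightarrow>
                 \<forall>\<rho>\<in>C. 0 \<le> c' \<rho> \<Longrightarrow> {\<rho> \<in> C. c' \<rho> \<noteq> 0} \<in> A \<Longrightarrow>
                 (\<Sum>\<rho>\<in>C. c \<rho> *\<^sub>R v \<rho>) = (\<Sum>\<rho>\<in>C. c' \<rho> *\<^sub>R v \<rho>) \<Longrightarrow> \<rho> \<in> C \<Longrightarrow> c \<rho> = c' \<rho>"
begin

definition ray_cone :: "'c set \<Rightarrow> (real ^ 'n) set" where
  "ray_cone S = convex_cone hull (v ` S)"

text \<open>Coefficients live on all of \<open>C\<close> and vanish off \<open>S\<close>, so that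
  representations in different cones can be added and compared by \<open>unique\<close> over one
  index set.\<close>

lemma ray_cone_iff:
  assumes "S \<subseteq> C"
  shows "y \<in> ray_cone S \<longleftrightarrow>
    (\<exists>c. (\<forall>\<rho>\<in>C. 0 \<le> c \<rho>) \<and> {\<rho> \<in> C. c \<rho> \<noteq> 0} \<subseteq> S \<and> y = (\<Sum>\<rho>\<in>C. c \<rho> *\<^sub>R v \<rho>))"
proof -
  define K where "K = {y. \<exists>c. (\<forall>\<rho>\<in>C. 0 \<le> c \<rho>) \<and> {\<rho> \<in> C. c \<rho> \<noteq> 0} \<subseteq> S \<and> y = (\<Sum>\<rho>\<in>C. c \<rho> *\<^sub>R v \<rho>)}"
  have "ray_cone S = K"
  proof
    show "ray_cone S \<subseteq> K" unfolding ray_cone_def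
    proof (rule hull_minimal)
      show "v ` S \<subseteq> K"
      proof clarify
        fix \<rho> assume r: "\<rho> \<in> S"
        have "v \<rho> = (\<Sum>\<rho>'\<in>C. (if \<rho>' = \<rho> then 1 else 0) *\<^sub>R v \<rho>')"
          using r assms finite_C by (subst sum.remove[of C \<rho>]) (auto intro!: sum.neutral)
        then show "v \<rho> \<in> K" unfolding K_def using r
          by (intro CollectI exI[of _ "\<lambda>\<rho>'. if \<rho>' = \<rho> then 1 else 0"]) auto
      qed
      show "convex_cone K"
        unfolding convex_cone_iff
      proof (intro conjI ballI allI impI)
        show "0 \<in> K" unfolding K_def by (intro CollectI exI[of _ "\<lambda>_. 0"]) auto
      next
        fix x y assume "x \<in> K" "y \<in> K"
        then obtain c c' where c: "\<forall>\<rho>\<in>C. 0 \<le> c \<rho>" "{\<rho> \<in> C. c \<rho> \<noteq> 0} \<subseteq> S" "x = (\<Sum>\<rho>\<in>C. c \<rho> *\<^sub>R v \<rho>)"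
          and c': "\<forall>\<rho>\<in>C. 0 \<le> c' \<rho>" "{\<rho> \<in> C. c' \<rho> \<noteq> 0} \<subseteq> S" "y = (\<Sum>\<rho>\<in>C. c' \<rho> *\<^sub>R v \<rho>)"
          unfolding K_def by blast
        have "\<forall>\<rho>\<in>C. 0 \<le> c \<rho> + c' \<rho>" using c(1) c'(1) by simp
        moreover have "{\<rho> \<in> C. c \<rho> + c' \<rho> \<noteq> 0} \<subseteq> S" using c(2) c'(2) by fastforce
        moreover have "x + y = (\<Sum>\<rho>\<in>C. (c \<rho> + c' \<rho>) *\<^sub>R v \<rho>)"
          unfolding c(3) c'(3) by (simp add: scaleR_add_left sum.distrib)
        ultimately show "x + y \<in> K"
          unfolding K_def by (intro CollectI exI[of _ "\<lambda>\<rho>. c \<rho> + c' \<rho>"] conjI)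
      next
        fix x :: "real ^ 'n" and k :: real assume "x \<in> K" "0 \<le> k"
        then obtain c where "\<forall>\<rho>\<in>C. 0 \<le> c \<rho>" "{\<rho> \<in> C. c \<rho> \<noteq> 0} \<subseteq> S" "x = (\<Sum>\<rho>\<in>C. c \<rho> *\<^sub>R v \<rho>)"
          unfolding K_def by blast
        then show "k *\<^sub>R x \<in> K" unfolding K_def using \<open>0 \<le> k\<close>
          by (intro CollectI exI[of _ "\<lambda>\<rho>. k * c \<rho>"]) (auto simp: scaleR_sum_right)
      qed
    qed
    show "K \<subseteq> ray_cone S"
    proof
      fix y assume "y \<in> K"
      then obtain c where c: "\<forall>\<rho>\<in>C. 0 \<le> c \<rho>" "{\<rho> \<in> C. c \<rho> \<noteq> 0} \<subseteq> S" and y: "y = (\<Sum>\<rho>\<in>C. c \<rho> *\<^sub>R v \<rho>)"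
        unfolding K_def by blast
      have in_cone: "c \<rho> *\<^sub>R v \<rho> \<in> ray_cone S" if "\<rho> \<in> C" for \<rho>
      proof (cases "c \<rho> = 0")
        case True
        then show ?thesis by (simp add: ray_cone_def convex_cone_hull_contains_0)
      next
        case False
        then have "v \<rho> \<in> v ` S" using c(2) that by blast
        then show ?thesis unfolding ray_cone_def
          using c(1) that by (intro convex_cone_hull_mul hull_inc) auto
      qed
      have "(\<Sum>\<rho>\<in>B. c \<rho> *\<^sub>R v \<rho>) \<in> ray_cone S" if "B \<subseteq> C" for B
        using finite_subset[OF that finite_C] that
      proof (induction B rule: finite_induct)
        case empty
        then show ?case by (simp add: ray_cone_def convex_cone_hull_contains_0)
      next
        case (insert \<rho> B)
        then show ?case using in_cone[of \<rho>]
          by (simp add: ray_cone_def convex_cone_hull_add)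
      qed
      then show "y \<in> ray_cone S" using y by blast
    qed
  qed
  then show ?thesis by (simp add: K_def)
qed

lemma ray_coneE:
  assumes "y \<in> ray_cone S" "S \<subseteq> C"
  obtains c where "\<forall>\<rho>\<in>C. 0 \<le> c \<rho>" "{\<rho> \<in> C. c \<rho> \<noteq> 0} \<subseteq> S" "y = (\<Sum>\<rho>\<in>C. c \<rho> *\<^sub>R v \<rho>)"
  using assms ray_cone_iff by blast

lemma ray_in_ray_cone: "\<rho> \<in> S \<Longrightarrow> v \<rho> \<in> ray_cone S"
  unfolding ray_cone_def by (simp add: hull_inc)

lemma ray_cone_mono: "S \<subseteq> S' \<Longrightarrow> ray_cone S \<subseteq> ray_cone S'"
  unfolding ray_cone_def by (intro hull_mono image_mono)

text \<open>The positive and the negative part of a relation are two nonnegative representations of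
  one vector, both supported in \<open>S\<close>, so \<open>unique\<close> makes them equal; their
  supports are disjoint, hence both vanish.\<close>

lemma rays_independent:
  assumes S: "S \<in> A" and c: "\<forall>\<rho>\<in>C - S. c \<rho> = 0" "(\<Sum>\<rho>\<in>C. c \<rho> *\<^sub>R v \<rho>) = 0" and \<rho>: "\<rho> \<in> C"
  shows "c \<rho> = 0"
proof -
  have "max 0 (c \<rho>) = max 0 (- c \<rho>)"
  proof (rule unique[of "\<lambda>\<rho>. max 0 (c \<rho>)" "\<lambda>\<rho>. max 0 (- c \<rho>)"])
    show "{\<rho> \<in> C. max 0 (c \<rho>) \<noteq> 0} \<in> A" by (rule A_down[OF S]) (use c in force)
    show "{\<rho> \<in> C. max 0 (- c \<rho>) \<noteq> 0} \<in> A" by (rule A_down[OF S]) (use c in force)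
    have "(\<Sum>\<rho>\<in>C. max 0 (c \<rho>) *\<^sub>R v \<rho>) - (\<Sum>\<rho>\<in>C. max 0 (- c \<rho>) *\<^sub>R v \<rho>) = (\<Sum>\<rho>\<in>C. c \<rho> *\<^sub>R v \<rho>)"
      unfolding sum_subtractf[symmetric] scaleR_diff_left[symmetric]
      by (rule sum.cong) (auto simp: max_def)
    then show "(\<Sum>\<rho>\<in>C. max 0 (c \<rho>) *\<^sub>R v \<rho>) = (\<Sum>\<rho>\<in>C. max 0 (- c \<rho>) *\<^sub>R v \<rho>)"
      using c by simp
  qed (use \<rho> in auto)
  then show ?thesis by (auto simp: max_def split: if_splits)
qed

lemma inj_on_rays: "S \<in> A \<Longrightarrow> inj_on v S"
proof (rule inj_onI, rule ccontr)
  fix \<rho> \<rho>' assume S: "S \<in> A" and r: "\<rho> \<in> S" "\<rho>' \<in> S" "v \<rho> = v \<rho>'" "\<rho> \<noteq> \<rho>'"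
  let ?c = "\<lambda>\<nu>. if \<nu> = \<rho> then 1 else if \<nu> = \<rho>' then - 1 else (0::real)"
  have rC: "\<rho> \<in> C" "\<rho>' \<in> C" using r A_sub[OF S] by auto
  have "(\<Sum>\<nu>\<in>C. ?c \<nu> *\<^sub>R v \<nu>) = (\<Sum>\<nu>\<in>{\<rho>, \<rho>'}. ?c \<nu> *\<^sub>R v \<nu>)"
    using rC finite_C by (intro sum.mono_neutral_right) auto
  also have "\<dots> = 0" using r by simp
  finally have "?c \<rho> = 0"
    using r rC by (intro rays_independent[OF S, of ?c]) auto
  then show False by simp
qed

lemma independent_rays:
  assumes S: "S \<in> A"
  shows "independent (v ` S)"
proof -
  have fin: "finite (v ` S)" using A_sub[OF S] finite_C finite_subset by blast
  show ?thesis
    unfolding independent_explicit_finite_subsets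
  proof (intro allI impI ballI)
    fix B u b assume B: "B \<subseteq> v ` S" "finite B" "(\<Sum>x\<in>B. u x *\<^sub>R x) = 0" "b \<in> B"
    let ?c = "\<lambda>\<rho>. if \<rho> \<in> S \<and> v \<rho> \<in> B then u (v \<rho>) else 0"
    define T where "T = {\<rho> \<in> S. v \<rho> \<in> B}"
    have T: "T \<subseteq> C" "inj_on v T" "v ` T = B"
      using A_sub[OF S] inj_on_subset[OF inj_on_rays[OF S], of T] B(1) by (auto simp: T_def)
    have "(\<Sum>\<rho>\<in>C. ?c \<rho> *\<^sub>R v \<rho>) = (\<Sum>\<rho>\<in>T. u (v \<rho>) *\<^sub>R v \<rho>)"
      using T finite_C by (intro sum.mono_neutral_cong_right) (auto simp: T_def)
    also have "\<dots> = 0" using B(3) T by (metis (mono_tags, lifting) sum.reindex_cong)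
    finally have "?c \<rho> = 0" if "\<rho> \<in> C" for \<rho>
      using that by (intro rays_independent[OF S, of ?c]) auto
    moreover obtain \<rho> where "\<rho> \<in> T" "v \<rho> = b" using T B(4) by blast
    ultimately show "u b = 0" using T(1) unfolding T_def by fastforce
  qed
qed

text \<open>Serves as a dual basis of the cone, up to the factor \<open>k\<close>. Independence
  yields a real functional with the prescribed values; the retraction makes its coordinates rational
  without disturbing these values, since rays and values are integral; \<open>k\<close> clears the
  denominators.\<close>

lemma dual_vector:
  fixes e :: "'c \<Rightarrow> int"
  assumes S: "S \<in> A"
  obtains k :: nat and m where "k > 0" "m \<in> int_lattice" "\<And>\<rho>. \<rho> \<in> S \<Longrightarrow> m \<bullet> v \<rho> = of_nat k * of_int (e \<rho>)"
proof -
  from linear_independent_extend[OF independent_rays[OF S], of "\<lambda>x. of_int (e (inv_into S v x)) :: real"]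
  obtain f :: "real ^ 'n \<Rightarrow> real" where f: "linear f" "\<forall>x\<in>v ` S. f x = of_int (e (inv_into S v x))"
    by blast
  \<comment> \<open>\<open>adjoint f 1\<close> is the vector that represents the functional
    \<open>f\<close>.\<close>
  define m1 where "m1 = adjoint f 1"
  have m1: "(\<Sum>i\<in>UNIV. v \<rho> $ i * m1 $ i) = of_int (e \<rho>)" if "\<rho> \<in> S" for \<rho>
  proof -
    have "v \<rho> \<bullet> m1 = f (v \<rho>)" using adjoint_works[OF f(1), of "v \<rho>" 1] by (simp add: m1_def)
    then show ?thesis using f(2) that inj_on_rays[OF S] by (simp add: inner_vec_def)
  qed
  obtain p :: "real \<Rightarrow> rat" where p: "\<And>x y. p (x + y) = p x + p y"
    "\<And>(k::int) x. p (of_int k * x) = of_int k * p x" "p 1 = 1"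
    using rational_retraction by blast
  have p0: "p 0 = 0" using p(1)[of 0 0] by simp
  have psum: "p (\<Sum>i\<in>I. g i) = (\<Sum>i\<in>I. p (g i))" for g and I :: "'n set"
    by (induction I rule: infinite_finite_induct) (auto simp: p p0)
  define den where "den i = snd (quotient_of (p (m1 $ i)))" for i
  have den: "den i > 0" "of_int (den i) * p (m1 $ i) \<in> \<int>" for i
  proof -
    show "den i > 0" unfolding den_def using quotient_of_denom_pos' by blast
    obtain a b where q: "quotient_of (p (m1 $ i)) = (a, b)" by (cases "quotient_of (p (m1 $ i))")
    then have "p (m1 $ i) = of_int a / of_int b" "b > 0"
      using quotient_of_div quotient_of_denom_pos by blast+
    then have "of_int (den i) * p (m1 $ i) = of_int a" using q by (simp add: den_def)
    then show "of_int (den i) * p (m1 $ i) \<in> \<int>" by simp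
  qed
  define k where "k = nat (\<Prod>i\<in>UNIV. den i)"
  have kpos: "k > 0" unfolding k_def using den(1) by (simp add: prod_pos)
  have kden: "of_nat k * p (m1 $ i) \<in> \<int>" for i
  proof -
    have "(of_nat k :: rat) = of_int (\<Prod>i\<in>UNIV. den i)"
      unfolding k_def using den(1) by (simp add: prod_pos order.strict_implies_order)
    also have "(\<Prod>i\<in>UNIV. den i) = (\<Prod>j\<in>UNIV - {i}. den j) * den i"
      by (subst prod.remove[of UNIV i]) (auto simp: mult.commute)
    finally have "of_nat k * p (m1 $ i) = of_int (\<Prod>j\<in>UNIV - {i}. den j) * (of_int (den i) * p (m1 $ i))"
      by simp
    then show ?thesis using den(2)[of i] by (metis Ints_mult Ints_of_int)
  qed
  define m :: "real ^ 'n" where "m = (\<chi> i. of_rat (of_nat k * p (m1 $ i)))"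
  show ?thesis
  proof (rule that[OF kpos])
    show "m \<in> int_lattice"
    proof -
      have "real_of_rat x \<in> \<int>" if "x \<in> \<int>" for x
        using that by (auto elim!: Ints_cases)
      then show ?thesis using kden by (simp add: int_lattice_iff m_def del: of_rat_mult)
    qed
    fix \<rho> assume r: "\<rho> \<in> S"
    then have "v \<rho> \<in> int_lattice" using v_int A_sub[OF S] by blast
    then have vi: "v \<rho> $ i = of_int \<lfloor>v \<rho> $ i\<rfloor>" for i by (simp add: int_lattice_iff)
    have "(\<Sum>i\<in>UNIV. of_int \<lfloor>v \<rho> $ i\<rfloor> * p (m1 $ i)) = p (\<Sum>i\<in>UNIV. v \<rho> $ i * m1 $ i)"
      unfolding psum p(2)[symmetric] vi[symmetric] ..
    also have "\<dots> = p (of_int (e \<rho>) * 1)" using m1[OF r] by simp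
    also have "\<dots> = of_int (e \<rho>)" unfolding p by simp
    finally have 1: "(\<Sum>i\<in>UNIV. of_int \<lfloor>v \<rho> $ i\<rfloor> * p (m1 $ i)) = of_int (e \<rho>)" .
    have "m \<bullet> v \<rho> = (\<Sum>i\<in>UNIV. m $ i * of_int \<lfloor>v \<rho> $ i\<rfloor>)"
      unfolding inner_vec_def vi[symmetric] by simp
    also have "\<dots> = (\<Sum>i\<in>UNIV. of_rat (of_nat k * (of_int \<lfloor>v \<rho> $ i\<rfloor> * p (m1 $ i))))"
      by (rule sum.cong) (auto simp: m_def of_rat_mult)
    also have "\<dots> = of_rat (of_nat k * of_int (e \<rho>))"
      unfolding of_rat_sum[symmetric] sum_distrib_left[symmetric] 1 ..
    also have "\<dots> = of_nat k * of_int (e \<rho>)" by (simp add: of_rat_mult)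
    finally show "m \<bullet> v \<rho> = of_nat k * of_int (e \<rho>)" .
  qed
qed

text \<open>A common point has one representation from each cone; \<open>unique\<close> identifies
  them, so its support lies in both sets.\<close>

lemma ray_cone_Int:
  assumes S: "S \<in> A" "S' \<in> A"
  shows "ray_cone S \<inter> ray_cone S' = ray_cone (S \<inter> S')"
proof
  show "ray_cone S \<inter> ray_cone S' \<subseteq> ray_cone (S \<inter> S')"
  proof
    fix y assume "y \<in> ray_cone S \<inter> ray_cone S'"
    then have y: "y \<in> ray_cone S" "y \<in> ray_cone S'" by auto
    obtain c where c: "\<forall>\<rho>\<in>C. 0 \<le> c \<rho>" "{\<rho> \<in> C. c \<rho> \<noteq> 0} \<subseteq> S" "y = (\<Sum>\<rho>\<in>C. c \<rho> *\<^sub>R v \<rho>)"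
      using ray_coneE[OF y(1) A_sub[OF S(1)]] by blast
    obtain c' where c': "\<forall>\<rho>\<in>C. 0 \<le> c' \<rho>" "{\<rho> \<in> C. c' \<rho> \<noteq> 0} \<subseteq> S'" "y = (\<Sum>\<rho>\<in>C. c' \<rho> *\<^sub>R v \<rho>)"
      using ray_coneE[OF y(2) A_sub[OF S(2)]] by blast
    have "c \<rho> = c' \<rho>" if "\<rho> \<in> C" for \<rho>
      by (rule unique[OF c(1) A_down[OF S(1) c(2)] c'(1) A_down[OF S(2) c'(2)] _ that])
        (simp only: c(3)[symmetric] c'(3)[symmetric])
    then have "{\<rho> \<in> C. c \<rho> \<noteq> 0} \<subseteq> S \<inter> S'" using c(2) c'(2) by auto
    then show "y \<in> ray_cone (S \<inter> S')"
      using c A_sub[OF S(1)] by (subst ray_cone_iff) auto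
  qed
qed (auto intro: subsetD[OF ray_cone_mono])

text \<open>A ray of \<open>S\<close> outside \<open>S'\<close> would be a combination of the rays
  in the intersection, against independence. This matters because points of the glued space remember
  the cone and not its index set.\<close>

lemma ray_cone_inj:
  assumes S: "S \<in> A" "S' \<in> A" and eq: "ray_cone S = ray_cone S'"
  shows "S = S'"
proof -
  have sub: "S \<subseteq> S'" if S: "S \<in> A" "S' \<in> A" and eq: "ray_cone S = ray_cone S'" for S S'
  proof (rule ccontr)
    assume "\<not> S \<subseteq> S'"
    then obtain \<rho> where r: "\<rho> \<in> S" "\<rho> \<notin> S'" by blast
    have "v \<rho> \<in> ray_cone (S \<inter> S')" using ray_in_ray_cone[OF r(1)] ray_cone_Int[OF S] eq by simp
    moreover have "S \<inter> S' \<subseteq> C" using A_sub[OF S(1)] by blast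
    ultimately obtain c where "\<forall>\<rho>\<in>C. 0 \<le> c \<rho>" and c: "{\<rho> \<in> C. c \<rho> \<noteq> 0} \<subseteq> S \<inter> S'" "v \<rho> = (\<Sum>\<rho>\<in>C. c \<rho> *\<^sub>R v \<rho>)"
      by (rule ray_coneE)
    have rC: "\<rho> \<in> C" using r A_sub[OF S(1)] by blast
    let ?c = "\<lambda>\<nu>. c \<nu> - (if \<nu> = \<rho> then 1 else 0)"
    have "(\<Sum>\<nu>\<in>C. (if \<nu> = \<rho> then 1 else 0) *\<^sub>R v \<nu>) = v \<rho>"
      using rC finite_C by (subst sum.remove[of C \<rho>]) (auto intro!: sum.neutral)
    then have "(\<Sum>\<nu>\<in>C. ?c \<nu> *\<^sub>R v \<nu>) = 0"
      using c(2) by (simp add: scaleR_diff_left sum_subtractf)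
    then have "?c \<rho> = 0"
      using c(1) r rC by (intro rays_independent[OF S(1), of ?c]) auto
    then show False using c(1) r rC by auto
  qed
  show ?thesis using sub[OF S eq] sub[OF S(2,1) eq[symmetric]] by blast
qed

text \<open>On the cone, pairing with \<open>m\<close> is a sum of nonnegative terms and vanishes
  only if every ray involved is orthogonal to \<open>m\<close>. Hence every face is spanned by a
  subset of the rays.\<close>

lemma hyperplane_section:
  assumes S: "S \<in> A" and m: "\<And>\<rho>. \<rho> \<in> S \<Longrightarrow> 0 \<le> m \<bullet> v \<rho>"
  shows "\<And>y. y \<in> ray_cone S \<Longrightarrow> 0 \<le> m \<bullet> y"
    and "{y \<in> ray_cone S. m \<bullet> y = 0} = ray_cone {\<rho> \<in> S. m \<bullet> v \<rho> = 0}"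
proof -
  have my: "m \<bullet> (\<Sum>\<rho>\<in>C. c \<rho> *\<^sub>R v \<rho>) = (\<Sum>\<rho>\<in>C. c \<rho> * (m \<bullet> v \<rho>))" for c
    by (simp add: inner_sum_right)
  have nn: "0 \<le> c \<rho> * (m \<bullet> v \<rho>)"
    if "\<forall>\<rho>\<in>C. 0 \<le> c \<rho>" "{\<rho> \<in> C. c \<rho> \<noteq> 0} \<subseteq> S" "\<rho> \<in> C" for c \<rho>
    using that m by (cases "c \<rho> = 0") auto
  show "0 \<le> m \<bullet> y" if y: "y \<in> ray_cone S" for y
  proof -
    obtain c where c: "\<forall>\<rho>\<in>C. 0 \<le> c \<rho>" "{\<rho> \<in> C. c \<rho> \<noteq> 0} \<subseteq> S" "y = (\<Sum>\<rho>\<in>C. c \<rho> *\<^sub>R v \<rho>)"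
      using ray_coneE[OF y A_sub[OF S]] by blast
    show ?thesis unfolding c(3) my using nn[OF c(1,2)] by (intro sum_nonneg) auto
  qed
  show "{y \<in> ray_cone S. m \<bullet> y = 0} = ray_cone {\<rho> \<in> S. m \<bullet> v \<rho> = 0}" (is "_ = ray_cone ?T")
  proof (intro subset_antisym subsetI)
    fix y assume "y \<in> {y \<in> ray_cone S. m \<bullet> y = 0}"
    then have y: "y \<in> ray_cone S" "m \<bullet> y = 0" by auto
    obtain c where c: "\<forall>\<rho>\<in>C. 0 \<le> c \<rho>" "{\<rho> \<in> C. c \<rho> \<noteq> 0} \<subseteq> S" "y = (\<Sum>\<rho>\<in>C. c \<rho> *\<^sub>R v \<rho>)"
      using ray_coneE[OF y(1) A_sub[OF S]] by blast
    with y(2) have "\<forall>\<rho>\<in>C. c \<rho> * (m \<bullet> v \<rho>) = 0"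
      using nn[OF c(1,2)] my[of c] sum_nonneg_eq_0_iff[OF finite_C, of "\<lambda>\<rho>. c \<rho> * (m \<bullet> v \<rho>)"] by simp
    then have "{\<rho> \<in> C. c \<rho> \<noteq> 0} \<subseteq> ?T" using c(2) by auto
    then show "y \<in> ray_cone ?T" using c A_sub[OF S] by (subst ray_cone_iff) auto
  next
    fix y assume y: "y \<in> ray_cone ?T"
    moreover have "?T \<subseteq> C" using A_sub[OF S] by blast
    ultimately obtain c where "\<forall>\<rho>\<in>C. 0 \<le> c \<rho>" and c: "{\<rho> \<in> C. c \<rho> \<noteq> 0} \<subseteq> ?T" "y = (\<Sum>\<rho>\<in>C. c \<rho> *\<^sub>R v \<rho>)"
      by (rule ray_coneE)
    have "m \<bullet> y = 0" unfolding c(2) my using c(1) by (intro sum.neutral) auto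
    moreover have "y \<in> ray_cone S" using y ray_cone_mono[of ?T S] by auto
    ultimately show "y \<in> {y \<in> ray_cone S. m \<bullet> y = 0}" by simp
  qed
qed

lemma fan_cones: "fan (ray_cone ` A)"
  unfolding fan_def
proof (intro conjI ballI allI impI)
  have "A \<subseteq> Pow C" using A_sub by blast
  then show "finite (ray_cone ` A)" using finite_C by (meson finite_Pow_iff finite_imageI finite_subset)
next
  fix \<sigma> assume "\<sigma> \<in> ray_cone ` A"
  then obtain S where S: "S \<in> A" "\<sigma> = ray_cone S" by blast
  show "rational_polyhedral_cone \<sigma>"
    unfolding rational_polyhedral_cone_def S(2) ray_cone_def
    using v_int A_sub[OF S(1)] finite_C finite_subset by (intro exI[of _ "v ` S"]) blast
  show "strongly_convex \<sigma>"
    unfolding strongly_convex_def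
  proof (intro subset_antisym subsetI)
    fix y assume "y \<in> \<sigma> \<inter> uminus ` \<sigma>"
    then have y: "y \<in> ray_cone S" "- y \<in> ray_cone S" using S by auto
    obtain c where c: "\<forall>\<rho>\<in>C. 0 \<le> c \<rho>" "{\<rho> \<in> C. c \<rho> \<noteq> 0} \<subseteq> S" "y = (\<Sum>\<rho>\<in>C. c \<rho> *\<^sub>R v \<rho>)"
      using ray_coneE[OF y(1) A_sub[OF S(1)]] by blast
    obtain c' where c': "\<forall>\<rho>\<in>C. 0 \<le> c' \<rho>" "{\<rho> \<in> C. c' \<rho> \<noteq> 0} \<subseteq> S" "- y = (\<Sum>\<rho>\<in>C. c' \<rho> *\<^sub>R v \<rho>)"
      using ray_coneE[OF y(2) A_sub[OF S(1)]] by blast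
    \<comment> \<open>Adding the representations of \<open>y\<close> and \<open>- y\<close> gives a
      relation with nonnegative coefficients, which must be trivial.\<close>
    have "(\<Sum>\<rho>\<in>C. (c \<rho> + c' \<rho>) *\<^sub>R v \<rho>) = 0"
      unfolding scaleR_add_left sum.distrib c(3)[symmetric] c'(3)[symmetric] by simp
    moreover have "\<forall>\<rho>\<in>C - S. c \<rho> + c' \<rho> = 0" using c(2) c'(2) by fastforce
    ultimately have "c \<rho> + c' \<rho> = 0" if "\<rho> \<in> C" for \<rho>
      using that by (intro rays_independent[OF S(1), of "\<lambda>\<rho>. c \<rho> + c' \<rho>"])
    then have "c \<rho> = 0" if "\<rho> \<in> C" for \<rho>
      using c(1) c'(1) that by (metis add_nonneg_eq_0_iff)
    then show "y \<in> {0}" using c(3) by simp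
  next
    fix y :: "real ^ 'n" assume "y \<in> {0}"
    then show "y \<in> \<sigma> \<inter> uminus ` \<sigma>"
      using convex_cone_hull_contains_0[of "v ` S"] unfolding S(2) ray_cone_def by force
  qed
next
  fix \<sigma> \<tau> assume "\<sigma> \<in> ray_cone ` A" "cone_face \<tau> \<sigma>"
  then obtain S m where S: "S \<in> A" "\<sigma> = ray_cone S"
    and m: "\<forall>v\<in>\<sigma>. 0 \<le> m \<bullet> v" "\<tau> = {v \<in> \<sigma>. m \<bullet> v = 0}"
    unfolding cone_face_def by blast
  have "0 \<le> m \<bullet> v \<rho>" if "\<rho> \<in> S" for \<rho>
    using bspec[OF m(1)] ray_in_ray_cone[OF that] unfolding S(2) by blast
  then have "\<tau> = ray_cone {\<rho> \<in> S. m \<bullet> v \<rho> = 0}"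
    unfolding m(2) S(2) by (rule hyperplane_section(2)[OF S(1)])
  then show "\<tau> \<in> ray_cone ` A" using A_down[OF S(1)] by auto
next
  have face: "cone_face (ray_cone S \<inter> ray_cone S') (ray_cone S)" if S: "S \<in> A" "S' \<in> A" for S S'
  proof -
    \<comment> \<open>A functional that vanishes on the rays of \<open>S\<close> shared with
      \<open>S'\<close> and is positive on the others cuts out the intersection as a face.\<close>
    obtain k m where k: "k > 0" "m \<in> int_lattice"
      and m: "\<And>\<rho>. \<rho> \<in> S \<Longrightarrow> m \<bullet> v \<rho> = of_nat k * of_int (if \<rho> \<in> S' then 0 else 1)"
      using dual_vector[OF S(1), of "\<lambda>\<rho>. if \<rho> \<in> S' then 0 else 1"] by blast
    have nn: "0 \<le> m \<bullet> v \<rho>" if "\<rho> \<in> S" for \<rho> using m[OF that] by simp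
    have "{\<rho> \<in> S. m \<bullet> v \<rho> = 0} = S \<inter> S'" using m k(1) by (auto split: if_splits)
    then have "ray_cone S \<inter> ray_cone S' = {y \<in> ray_cone S. m \<bullet> y = 0}"
      using hyperplane_section(2)[OF S(1) nn] ray_cone_Int[OF S] by simp
    moreover have "\<forall>y\<in>ray_cone S. 0 \<le> m \<bullet> y" using hyperplane_section(1)[OF S(1) nn] by blast
    ultimately show ?thesis unfolding cone_face_def by blast
  qed
  fix \<sigma> \<tau> assume "\<sigma> \<in> ray_cone ` A" "\<tau> \<in> ray_cone ` A"
  then show "cone_face (\<sigma> \<inter> \<tau>) \<sigma>" "cone_face (\<sigma> \<inter> \<tau>) \<tau>"
    using face by (auto simp: Int_commute) (metis Int_commute)
qed

lemma complete_fan_cones: "complete_fan (ray_cone ` A)"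
proof -
  have "y \<in> \<Union> (ray_cone ` A)" for y
  proof -
    obtain c where c: "\<forall>\<rho>\<in>C. 0 \<le> c \<rho>" "{\<rho> \<in> C. c \<rho> \<noteq> 0} \<in> A" "(\<Sum>\<rho>\<in>C. c \<rho> *\<^sub>R v \<rho>) = y"
      using cover[of y] by blast
    then have "y \<in> ray_cone {\<rho> \<in> C. c \<rho> \<noteq> 0}" by (subst ray_cone_iff) auto
    then show ?thesis using c(2) by blast
  qed
  then show ?thesis unfolding complete_fan_def using fan_cones by blast
qed

lemma simplicial_fan_cones: "simplicial_fan (ray_cone ` A)"
  unfolding simplicial_fan_def
proof (intro conjI fan_cones ballI)
  fix \<sigma> assume "\<sigma> \<in> ray_cone ` A"
  then obtain S where "S \<in> A" "\<sigma> = ray_cone S" by blast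
  then show "\<exists>S. independent S \<and> \<sigma> = convex_cone hull S"
    by (intro exI[of _ "v ` S"]) (simp add: ray_cone_def independent_rays)
qed

end

section \<open>Torus orbits\<close>

lemma power_int_sum:
  fixes x :: complex
  assumes "x \<noteq> 0"
  shows "x powi (\<Sum>i\<in>I. f i) = (\<Prod>i\<in>I. x powi f i)"
  using assms by (induction I rule: infinite_finite_induct) (auto simp: power_int_add)

context cox_data
begin

definition act :: "('r \<Rightarrow> complex) \<Rightarrow> ('c \<Rightarrow> complex) \<Rightarrow> 'c \<Rightarrow> complex" where
  "act t x \<rho> = (\<Prod>\<mu>\<in>R. t \<mu> powi w \<mu> \<rho>) * x \<rho>"

definition tor :: "('r \<Rightarrow> complex) set" where
  "tor = {t. \<forall>\<mu>\<in>R. t \<mu> \<noteq> 0}"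

definition orbit :: "('c \<Rightarrow> complex) \<Rightarrow> ('c \<Rightarrow> complex) set" where
  "orbit x = {act t x | t. t \<in> tor}"

definition aff :: "('c \<Rightarrow> complex) set" where
  "aff = {x. \<forall>\<rho>. \<rho> \<notin> C \<longrightarrow> x \<rho> = 0}"

definition zeros :: "('c \<Rightarrow> complex) \<Rightarrow> 'c set" where
  "zeros x = {\<rho> \<in> C. x \<rho> = 0}"

definition stable :: "('c \<Rightarrow> complex) set" where
  "stable = {x \<in> aff. zeros x \<in> A}"

text \<open>The preimage of the affine chart of the cone on \<open>S\<close>: coordinates outside
  \<open>S\<close> are invertible.\<close>

definition chart_cover :: "'c set \<Rightarrow> ('c \<Rightarrow> complex) set" where
  "chart_cover S = {x \<in> aff. zeros x \<subseteq> S}"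

definition mon :: "('c \<Rightarrow> int) \<Rightarrow> ('c \<Rightarrow> complex) \<Rightarrow> complex" where
  "mon e x = (\<Prod>\<rho>\<in>C. x \<rho> powi e \<rho>)"

text \<open>For lattice vectors \<open>m\<close> the rounding is a mere change of type, see
  \<open>of_int_expo\<close>.\<close>

definition expo :: "real ^ 'n \<Rightarrow> 'c \<Rightarrow> int" where
  "expo m \<rho> = \<lfloor>m \<bullet> v \<rho>\<rfloor>"

text \<open>Cox's quotient map on one chart: a point goes to the monoid homomorphism that evaluates
  invariant monomials at it. The value 0 off the dual monoid matches the convention of
  \<open>chart_points\<close>.\<close>

definition quot :: "(real ^ 'n) set \<Rightarrow> ('c \<Rightarrow> complex) \<Rightarrow> real ^ 'n \<Rightarrow> complex" where
  "quot \<sigma> x m = (if m \<in> dual_monoid \<sigma> then mon (expo m) x else 0)"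

section \<open>Laurent monomials and their weights\<close>

lemma of_int_expo: "m \<in> int_lattice \<Longrightarrow> \<rho> \<in> C \<Longrightarrow> of_int (expo m \<rho>) = m \<bullet> v \<rho>"
  using inner_int_lattice[OF _ v_int, of m \<rho>] by (simp add: expo_def)

lemma expo_add:
  "m \<in> int_lattice \<Longrightarrow> m' \<in> int_lattice \<Longrightarrow> \<rho> \<in> C \<Longrightarrow> expo (m + m') \<rho> = expo m \<rho> + expo m' \<rho>"
  using of_int_expo[of m \<rho>] of_int_expo[of m' \<rho>] of_int_expo[OF int_lattice_add, of m m' \<rho>]
  by (metis inner_add_left of_int_add of_int_eq_iff)

lemma expo_diff:
  "m \<in> int_lattice \<Longrightarrow> m' \<in> int_lattice \<Longrightarrow> \<rho> \<in> C \<Longrightarrow> expo (m - m') \<rho> = expo m \<rho> - expo m' \<rho>"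
  using of_int_expo[of m \<rho>] of_int_expo[of m' \<rho>] of_int_expo[OF int_lattice_diff, of m m' \<rho>]
  by (metis inner_diff_left of_int_diff of_int_eq_iff)

text \<open>One half of Gale duality: exponents that come from lattice vectors have weight zero, so
  their monomials are torus invariant.\<close>

lemma weight_expo:
  assumes "m \<in> int_lattice" "\<mu> \<in> R"
  shows "(\<Sum>\<rho>\<in>C. w \<mu> \<rho> * expo m \<rho>) = 0"
  using kernel[of "expo m"] of_int_expo[OF assms(1)] assms by blast

lemma mon_0 [simp]: "mon (\<lambda>_. 0) x = 1"
  by (simp add: mon_def)

lemma mon_cong: "(\<And>\<rho>. \<rho> \<in> C \<Longrightarrow> e \<rho> = e' \<rho>) \<Longrightarrow> mon e x = mon e' x"
  unfolding mon_def by (rule prod.cong) auto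

text \<open>Valid for exponents of either sign because a negative power of 0 is 0 by convention,
  while its zeroth power is 1.\<close>

lemma mon_eq_0_iff: "mon e x = 0 \<longleftrightarrow> (\<exists>\<rho>\<in>C. x \<rho> = 0 \<and> e \<rho> \<noteq> 0)"
  unfolding mon_def using finite_C by simp

text \<open>At a vanishing coordinate, exponents of opposite sign could add up to 0 although the
  factors vanish; hence the sign condition there.\<close>

lemma mon_add:
  assumes "\<And>\<rho>. \<rho> \<in> zeros x \<Longrightarrow> 0 \<le> e \<rho> \<and> 0 \<le> e' \<rho>"
  shows "mon (\<lambda>\<rho>. e \<rho> + e' \<rho>) x = mon e x * mon e' x"
  unfolding mon_def prod.distrib[symmetric]
proof (rule prod.cong)
  fix \<rho> assume r: "\<rho> \<in> C"
  show "x \<rho> powi (e \<rho> + e' \<rho>) = x \<rho> powi e \<rho> * x \<rho> powi e' \<rho>"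
  proof (cases "x \<rho> = 0")
    case True
    then have "0 \<le> e \<rho>" "0 \<le> e' \<rho>" using assms r by (auto simp: zeros_def)
    then show ?thesis using True by (simp add: power_int_0_left_if)
  next
    case False
    then show ?thesis by (simp add: power_int_add)
  qed
qed simp

lemma mon_act:
  assumes t: "t \<in> tor"
  shows "mon e (act t x) = (\<Prod>\<mu>\<in>R. t \<mu> powi (\<Sum>\<rho>\<in>C. w \<mu> \<rho> * e \<rho>)) * mon e x"
proof -
  have "mon e (act t x) = (\<Prod>\<rho>\<in>C. \<Prod>\<mu>\<in>R. t \<mu> powi (w \<mu> \<rho> * e \<rho>)) * mon e x"
    unfolding mon_def act_def
    by (simp add: power_int_mult_distrib prod_power_int power_int_mult prod.distrib)
  also have "(\<Prod>\<rho>\<in>C. \<Prod>\<mu>\<in>R. t \<mu> powi (w \<mu> \<rho> * e \<rho>)) = (\<Prod>\<mu>\<in>R. t \<mu> powi (\<Sum>\<rho>\<in>C. w \<mu> \<rho> * e \<rho>))"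
    unfolding prod.swap[of _ R C] using t
    by (intro prod.cong) (auto simp: power_int_sum tor_def)
  finally show ?thesis .
qed

section \<open>The torus action and its orbits\<close>

lemma factor_nonzero: "t \<in> tor \<Longrightarrow> (\<Prod>\<mu>\<in>R. t \<mu> powi k \<mu>) \<noteq> (0 :: complex)"
  using finite_R by (auto simp: tor_def)

lemma zeros_act: "t \<in> tor \<Longrightarrow> zeros (act t x) = zeros x"
  using factor_nonzero by (auto simp: zeros_def act_def)

lemma act_aff: "x \<in> aff \<Longrightarrow> act t x \<in> aff"
  by (auto simp: aff_def act_def)

lemma one_tor: "(\<lambda>_. 1) \<in> tor"
  by (simp add: tor_def)

lemma act_one: "act (\<lambda>_. 1) x = x"
  by (rule ext) (simp add: act_def)

lemma act_act: "act s (act t x) = act (\<lambda>\<mu>. s \<mu> * t \<mu>) x"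
  by (rule ext) (simp add: act_def power_int_mult_distrib prod.distrib)

lemma orbit_refl: "x \<in> orbit x"
  unfolding orbit_def using act_one[of x] one_tor by force

lemma orbit_eq:
  assumes "y \<in> orbit x"
  shows "orbit y = orbit x"
proof -
  have sub: "orbit y \<subseteq> orbit x" if "y \<in> orbit x" for x y
  proof
    fix z assume "z \<in> orbit y"
    with that obtain s t where "s \<in> tor" "t \<in> tor" "y = act t x" "z = act s y" by (auto simp: orbit_def)
    then show "z \<in> orbit x" unfolding orbit_def
      by (auto intro!: exI[of _ "\<lambda>\<mu>. s \<mu> * t \<mu>"] simp: act_act tor_def)
  qed
  from assms obtain t where t: "t \<in> tor" "y = act t x" by (auto simp: orbit_def)
  have "act (\<lambda>\<mu>. inverse (t \<mu>)) y = x"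
  proof
    fix \<rho>
    have "(\<Prod>\<mu>\<in>R. (inverse (t \<mu>) * t \<mu>) powi w \<mu> \<rho>) = (\<Prod>\<mu>\<in>R. 1)"
      using t by (intro prod.cong) (auto simp: tor_def)
    then show "act (\<lambda>\<mu>. inverse (t \<mu>)) y \<rho> = x \<rho>"
      unfolding t(2) act_act by (simp add: act_def)
  qed
  then have "x \<in> orbit y" using t unfolding orbit_def
    by (intro CollectI exI[of _ "\<lambda>\<mu>. inverse (t \<mu>)"]) (auto simp: tor_def)
  then show ?thesis using sub assms by blast
qed

lemma zeros_orbit: "y \<in> orbit x \<Longrightarrow> zeros y = zeros x"
  using zeros_act by (auto simp: orbit_def)

lemma aff_orbit: "y \<in> orbit x \<Longrightarrow> x \<in> aff \<Longrightarrow> y \<in> aff"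
  using act_aff by (auto simp: orbit_def)

lemma chart_cover_orbit: "y \<in> orbit x \<Longrightarrow> x \<in> chart_cover S \<Longrightarrow> y \<in> chart_cover S"
  using zeros_orbit aff_orbit by (auto simp: chart_cover_def)

lemma chart_cover_stable: "S \<in> A \<Longrightarrow> chart_cover S \<subseteq> stable"
  using A_down by (auto simp: chart_cover_def stable_def)

lemma stable_chart_cover: "x \<in> stable \<Longrightarrow> zeros x \<in> A \<and> x \<in> chart_cover (zeros x)"
  by (auto simp: chart_cover_def stable_def)

section \<open>The quotient map on a chart\<close>

lemma dual_monoid_iff:
  assumes S: "S \<in> A"
  shows "m \<in> dual_monoid (ray_cone S) \<longleftrightarrow> m \<in> int_lattice \<and> (\<forall>\<rho>\<in>S. 0 \<le> m \<bullet> v \<rho>)"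
  using hyperplane_section(1)[OF S, of m] ray_in_ray_cone[of _ S] by (auto simp: dual_monoid_def)

lemma expo_nonneg:
  assumes S: "S \<in> A" and "m \<in> dual_monoid (ray_cone S)" "\<rho> \<in> S"
  shows "0 \<le> expo m \<rho>"
  using assms dual_monoid_iff[OF S] by (simp add: expo_def)

lemma quot_orbit:
  assumes "y \<in> orbit x"
  shows "quot \<sigma> y = quot \<sigma> x"
proof
  fix m
  from assms obtain t where t: "t \<in> tor" "y = act t x" by (auto simp: orbit_def)
  show "quot \<sigma> y m = quot \<sigma> x m"
  proof (cases "m \<in> dual_monoid \<sigma>")
    case True
    then have "m \<in> int_lattice" by (simp add: dual_monoid_def)
    then have "(\<Prod>\<mu>\<in>R. t \<mu> powi (\<Sum>\<rho>\<in>C. w \<mu> \<rho> * expo m \<rho>)) = 1"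
      using weight_expo by (intro prod.neutral) auto
    then show ?thesis using True by (simp add: quot_def t mon_act)
  qed (simp add: quot_def)
qed

lemma quot_chart_points:
  assumes S: "S \<in> A" and x: "x \<in> chart_cover S"
  shows "quot (ray_cone S) x \<in> chart_points (ray_cone S)"
  unfolding chart_points_def
proof (intro CollectI conjI ballI allI impI)
  let ?D = "dual_monoid (ray_cone S)"
  have "0 \<in> ?D" using dual_monoid_iff[OF S] int_lattice_0 by simp
  moreover have "mon (expo 0) x = 1"
    by (simp add: mon_def expo_def)
  ultimately show "quot (ray_cone S) x 0 = 1" by (simp add: quot_def)
next
  let ?D = "dual_monoid (ray_cone S)"
  fix m m' assume m: "m \<in> ?D" "m' \<in> ?D"
  have L: "m \<in> int_lattice" "m' \<in> int_lattice" using m by (auto simp: dual_monoid_def)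
  have "m + m' \<in> ?D" using m dual_monoid_iff[OF S] by (auto simp: int_lattice_add inner_add_left)
  moreover have "mon (expo (m + m')) x = mon (\<lambda>\<rho>. expo m \<rho> + expo m' \<rho>) x"
    using expo_add[OF L] by (rule mon_cong)
  moreover have "\<dots> = mon (expo m) x * mon (expo m') x"
    using x expo_nonneg[OF S] m by (intro mon_add) (auto simp: chart_cover_def)
  ultimately show "quot (ray_cone S) x (m + m') = quot (ray_cone S) x m * quot (ray_cone S) x m'"
    using m by (simp add: quot_def)
qed (simp add: quot_def)

text \<open>The characters of the torus are pinned down on the span of the weights of the nonvanishing
  coordinates; the rest is extension of characters.\<close>

lemma orbit_eqI:
  assumes x: "x \<in> aff" "x' \<in> aff" and Z: "zeros x' = zeros x"
    and eq: "\<And>m. m \<in> int_lattice \<Longrightarrow> (\<And>\<rho>. \<rho> \<in> zeros x \<Longrightarrow> m \<bullet> v \<rho> = 0) \<Longrightarrow>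
      mon (expo m) x = mon (expo m) x'"
  shows "x' \<in> orbit x"
proof -
  let ?Z = "zeros x"
  \<comment> \<open>The coordinate ratios of the two points define a character \<open>ch\<close> on
    the exponents supported at nonvanishing coordinates; a torus element realises it once it factors
    through the weights \<open>E\<close>.\<close>
  define H :: "('c \<Rightarrow> int) set" where "H = {n. \<forall>\<rho>. \<rho> \<notin> C - ?Z \<longrightarrow> n \<rho> = 0}"
  define E :: "('c \<Rightarrow> int) \<Rightarrow> 'r \<Rightarrow> int" where "E n \<mu> = (\<Sum>\<rho>\<in>C. w \<mu> \<rho> * n \<rho>)" for n \<mu>
  define ch :: "('c \<Rightarrow> int) \<Rightarrow> complex" where "ch n = (\<Prod>\<rho>\<in>C - ?Z. (x' \<rho> / x \<rho>) powi n \<rho>)" for n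
  have nz: "x \<rho> \<noteq> 0" "x' \<rho> \<noteq> 0" if "\<rho> \<in> C - ?Z" for \<rho>
    using that Z by (auto simp: zeros_def)
  have "\<exists>t. (\<forall>\<mu>\<in>R. t \<mu> \<noteq> 0) \<and> (\<forall>n\<in>H. ch n = (\<Prod>\<mu>\<in>R. t \<mu> powi E n \<mu>))"
  proof (rule character_extension[OF finite_R])
    show "0 \<in> H" by (simp add: H_def)
    show "n - n' \<in> H" if "n \<in> H" "n' \<in> H" for n n' using that by (simp add: H_def)
    show "E (n - n') \<mu> = E n \<mu> - E n' \<mu>" for n n' \<mu>
      by (simp add: E_def algebra_simps sum_subtractf)
    show "ch n \<noteq> 0" for n using nz finite_C by (simp add: ch_def)
    show "ch (n - n') = ch n / ch n'" for n n'
      unfolding ch_def prod_dividef[symmetric] using nz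
      by (intro prod.cong) (auto simp: power_int_diff)
    \<comment> \<open>An exponent of weight zero comes from a lattice vector by Gale duality, and
      this vector is orthogonal to the rays of vanishing coordinates, so the hypothesis on invariant
      monomials applies.\<close>
    show "ch n = 1" if n: "n \<in> H" "\<forall>\<mu>\<in>R. E n \<mu> = 0" for n
    proof -
      from n(2) obtain m where m: "m \<in> int_lattice" "\<forall>\<rho>\<in>C. of_int (n \<rho>) = m \<bullet> v \<rho>"
        using kernel[of n] by (auto simp: E_def)
      have en: "expo m \<rho> = n \<rho>" if "\<rho> \<in> C" for \<rho>
        using bspec[OF m(2) that] by (simp add: expo_def flip: bspec[OF m(2) that])
      have mz: "m \<bullet> v \<rho> = 0" if "\<rho> \<in> ?Z" for \<rho>
      proof -
        have "\<rho> \<in> C" "n \<rho> = 0" using that n(1) by (auto simp: H_def zeros_def)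
        then show ?thesis using m(2) by force
      qed
      have mm: "mon (expo m) y = (\<Prod>\<rho>\<in>C - ?Z. y \<rho> powi n \<rho>)" for y
      proof -
        have "mon (expo m) y = (\<Prod>\<rho>\<in>C. y \<rho> powi n \<rho>)"
          unfolding mon_def by (rule prod.cong) (auto simp: en)
        also have "\<dots> = (\<Prod>\<rho>\<in>C - ?Z. y \<rho> powi n \<rho>)"
          using n(1) finite_C by (intro prod.mono_neutral_right) (auto simp: H_def)
        finally show ?thesis .
      qed
      have "ch n = mon (expo m) x' / mon (expo m) x"
        unfolding ch_def mm prod_dividef[symmetric] by (simp add: power_int_divide_distrib)
      moreover have "mon (expo m) x \<noteq> 0" unfolding mm using nz finite_C by simp
      ultimately show ?thesis using eq[OF m(1) mz] by simp
    qed
  qed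
  then obtain t where t: "\<forall>\<mu>\<in>R. t \<mu> \<noteq> 0" "\<forall>n\<in>H. ch n = (\<Prod>\<mu>\<in>R. t \<mu> powi E n \<mu>)" by blast
  have "x' = act t x"
  proof
    fix \<rho>
    show "x' \<rho> = act t x \<rho>"
    proof (cases "\<rho> \<in> C - ?Z")
      case False
      then have "x \<rho> = 0" "x' \<rho> = 0" using x Z by (auto simp: aff_def zeros_def)
      then show ?thesis by (simp add: act_def)
    next
      case True
      \<comment> \<open>The unit exponent at \<open>\<rho>\<close> recovers the ratio of the two
        coordinates there.\<close>
      define n where "n = (\<lambda>\<nu>. if \<nu> = \<rho> then 1 else (0::int))"
      have "n \<in> H" using True by (auto simp: H_def n_def)
      then have "ch n = (\<Prod>\<mu>\<in>R. t \<mu> powi E n \<mu>)" using t(2) by blast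
      moreover have "E n \<mu> = w \<mu> \<rho>" for \<mu>
      proof -
        have "E n \<mu> = (\<Sum>\<nu>\<in>C. if \<nu> = \<rho> then w \<mu> \<nu> else 0)"
          unfolding E_def by (rule sum.cong) (auto simp: n_def)
        then show ?thesis using True finite_C by simp
      qed
      moreover have "ch n = x' \<rho> / x \<rho>"
      proof -
        have "ch n = (\<Prod>\<nu>\<in>C - ?Z. if \<nu> = \<rho> then x' \<nu> / x \<nu> else 1)"
          unfolding ch_def by (rule prod.cong) (auto simp: n_def)
        also have "\<dots> = x' \<rho> / x \<rho>" using True finite_C by (subst prod.delta) auto
        finally show ?thesis .
      qed
      ultimately show ?thesis using nz(1)[OF True] by (simp add: act_def field_simps)
    qed
  qed
  then show ?thesis using t(1) unfolding orbit_def tor_def by blast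
qed

text \<open>A dual vector that is \<open>k\<close> at \<open>\<rho>\<close> and 0 at the other rays
  of \<open>S\<close> gives an invariant monomial whose factors from \<open>S\<close> reduce to a
  power of \<open>x \<rho>\<close>, and the coordinates outside \<open>S\<close> are nonzero. So the
  zero set can be read off from the image point.\<close>

lemma zeros_eq_of_quot:
  assumes S: "S \<in> A" and x: "x \<in> chart_cover S"
  shows "zeros x = {\<rho> \<in> S. \<exists>m\<in>dual_monoid (ray_cone S).
    (\<forall>\<rho>'\<in>S - {\<rho>}. m \<bullet> v \<rho>' = 0) \<and> quot (ray_cone S) x m = 0}"
proof (intro subset_antisym subsetI)
  fix \<rho> assume r: "\<rho> \<in> zeros x"
  then have rS: "\<rho> \<in> S" "\<rho> \<in> C" using x by (auto simp: chart_cover_def zeros_def)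
  obtain k m where k: "k > 0" "m \<in> int_lattice"
    and m: "\<And>\<rho>'. \<rho>' \<in> S \<Longrightarrow> m \<bullet> v \<rho>' = of_nat k * of_int (if \<rho>' = \<rho> then 1 else 0)"
    using dual_vector[OF S, of "\<lambda>\<rho>'. if \<rho>' = \<rho> then 1 else 0"] by blast
  have D: "m \<in> dual_monoid (ray_cone S)" using k m by (simp add: dual_monoid_iff[OF S])
  have "expo m \<rho> \<noteq> 0" using of_int_expo[OF k(2) rS(2)] m[OF rS(1)] k(1) by auto
  then have "mon (expo m) x = 0" unfolding mon_eq_0_iff using r by (auto simp: zeros_def)
  then show "\<rho> \<in> {\<rho> \<in> S. \<exists>m\<in>dual_monoid (ray_cone S).
    (\<forall>\<rho>'\<in>S - {\<rho>}. m \<bullet> v \<rho>' = 0) \<and> quot (ray_cone S) x m = 0}"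
    using rS D m by (auto simp: quot_def intro!: bexI[of _ m] split: if_splits)
next
  fix \<rho> assume "\<rho> \<in> {\<rho> \<in> S. \<exists>m\<in>dual_monoid (ray_cone S).
    (\<forall>\<rho>'\<in>S - {\<rho>}. m \<bullet> v \<rho>' = 0) \<and> quot (ray_cone S) x m = 0}"
  then obtain m where m: "\<rho> \<in> S" "m \<in> dual_monoid (ray_cone S)" "\<forall>\<rho>'\<in>S - {\<rho>}. m \<bullet> v \<rho>' = 0"
     "mon (expo m) x = 0" by (auto simp: quot_def)
  then obtain \<rho>' where r': "\<rho>' \<in> C" "x \<rho>' = 0" "expo m \<rho>' \<noteq> 0" unfolding mon_eq_0_iff by blast
  then have "\<rho>' \<in> S" using x by (auto simp: chart_cover_def zeros_def)
  then have "\<rho>' = \<rho>" using m(3) r'(3) by (cases "\<rho>' = \<rho>") (auto simp: expo_def)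
  then show "\<rho> \<in> zeros x" using r' by (simp add: zeros_def)
qed

text \<open>A lattice vector \<open>m\<close> orthogonal to the rays of vanishing coordinates is a
  difference of the dual monoid elements \<open>m + m0\<close> and \<open>m0\<close>, where the
  monomial of \<open>m0\<close> is nonzero at both points; so equality on the dual monoid passes to
  \<open>m\<close>.\<close>

lemma quot_eq_imp_orbit:
  assumes S: "S \<in> A" and x: "x \<in> chart_cover S" "x' \<in> chart_cover S"
    and eq: "quot (ray_cone S) x = quot (ray_cone S) x'"
  shows "x' \<in> orbit x"
proof (rule orbit_eqI)
  show "x \<in> aff" "x' \<in> aff" using x by (auto simp: chart_cover_def)
  show Z: "zeros x' = zeros x"
    unfolding zeros_eq_of_quot[OF S x(1)] zeros_eq_of_quot[OF S x(2)] eq ..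
  fix m assume m: "m \<in> int_lattice" "\<And>\<rho>. \<rho> \<in> zeros x \<Longrightarrow> m \<bullet> v \<rho> = 0"
  \<comment> \<open>The absolute values make \<open>m0\<close> dominate \<open>m\<close> at the
    nonvanishing rays of \<open>S\<close>; the 0 elsewhere keeps the monomial of \<open>m0\<close>
    invertible at both points.\<close>
  let ?e = "\<lambda>\<rho>. if \<rho> \<in> zeros x then 0 else \<bar>expo m \<rho>\<bar>"
  obtain k m0 where k: "k > 0" "m0 \<in> int_lattice"
    and m0: "\<And>\<rho>. \<rho> \<in> S \<Longrightarrow> m0 \<bullet> v \<rho> = of_nat k * of_int (?e \<rho>)"
    using dual_vector[OF S, of ?e] by blast
  have D0: "m0 \<in> dual_monoid (ray_cone S)" unfolding dual_monoid_iff[OF S] using k m0 by auto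
  have "0 \<le> (m + m0) \<bullet> v \<rho>" if r: "\<rho> \<in> S" for \<rho>
  proof (cases "\<rho> \<in> zeros x")
    case True
    then show ?thesis using m m0[OF r] by (simp add: inner_add_left)
  next
    case False
    have "m \<bullet> v \<rho> = of_int (expo m \<rho>)" using of_int_expo[OF m(1)] r A_sub[OF S] by auto
    moreover have "1 * \<bar>of_int (expo m \<rho>) :: real\<bar> \<le> of_nat k * \<bar>of_int (expo m \<rho>)\<bar>"
      using k(1) by (intro mult_right_mono) auto
    ultimately show ?thesis using m0[OF r] False by (simp add: inner_add_left)
  qed
  then have D1: "m + m0 \<in> dual_monoid (ray_cone S)"
    unfolding dual_monoid_iff[OF S] using int_lattice_add[OF m(1) k(2)] by blast
  have split: "mon (expo (m + m0)) y = mon (expo m) y * mon (expo m0) y"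
    and nz: "mon (expo m0) y \<noteq> 0" if y: "zeros y = zeros x" for y
  proof -
    have z: "expo m \<rho> = 0" "expo m0 \<rho> = 0" if "\<rho> \<in> zeros y" for \<rho>
    proof -
      have "\<rho> \<in> S" using that y x by (auto simp: chart_cover_def)
      then show "expo m \<rho> = 0" "expo m0 \<rho> = 0" using that m(2) m0 y by (auto simp: expo_def)
    qed
    have "mon (expo (m + m0)) y = mon (\<lambda>\<rho>. expo m \<rho> + expo m0 \<rho>) y"
      by (rule mon_cong) (rule expo_add[OF m(1) k(2)])
    also have "\<dots> = mon (expo m) y * mon (expo m0) y" using z by (intro mon_add) auto
    finally show "mon (expo (m + m0)) y = mon (expo m) y * mon (expo m0) y" .
    show "mon (expo m0) y \<noteq> 0" unfolding mon_eq_0_iff using z by (auto simp: zeros_def)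
  qed
  have q: "mon (expo m') x = mon (expo m') x'" if "m' \<in> dual_monoid (ray_cone S)" for m'
    using fun_cong[OF eq, of m'] that by (simp add: quot_def)
  show "mon (expo m) x = mon (expo m) x'"
    using q[OF D1] q[OF D0] split[OF refl] split[OF Z] nz[OF refl] by simp
qed

text \<open>The monomials not killed by \<open>\<gamma>\<close> form a face of the dual monoid; \<open>\<gamma>\<close> is a character on the
  group they generate, and an extension of it to \<open>\<int>\<^sup>C\<close> gives the nonzero coordinates of a preimage.\<close>

lemma quot_surj:
  assumes S: "S \<in> A" and g: "\<gamma> \<in> chart_points (ray_cone S)"
  obtains x where "x \<in> chart_cover S" "quot (ray_cone S) x = \<gamma>"
proof -
  let ?D = "dual_monoid (ray_cone S)"
  note D = dual_monoid_iff[OF S]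
  have finS: "finite S" using A_sub[OF S] finite_C finite_subset by blast
  have g0: "\<gamma> 0 = 1" and gadd: "\<And>m m'. m \<in> ?D \<Longrightarrow> m' \<in> ?D \<Longrightarrow> \<gamma> (m + m') = \<gamma> m * \<gamma> m'"
    and gout: "\<And>m. m \<notin> ?D \<Longrightarrow> \<gamma> m = 0"
    using g unfolding chart_points_def by blast+
  have Dadd: "m + m' \<in> ?D" if "m \<in> ?D" "m' \<in> ?D" for m m'
    using that unfolding D by (auto simp: int_lattice_add inner_add_left)
  have D0: "0 \<in> ?D" unfolding D by (simp add: int_lattice_0)
  \<comment> \<open>The rays whose coordinates will be set to 0 in the preimage.\<close>
  define S1 where "S1 = {\<rho> \<in> S. \<forall>m\<in>?D. \<gamma> m \<noteq> 0 \<longrightarrow> m \<bullet> v \<rho> = 0}"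
  have "\<exists>m0\<in>?D. \<gamma> m0 \<noteq> 0 \<and> (\<forall>\<rho>\<in>T. 0 < m0 \<bullet> v \<rho>)" if "finite T" "T \<subseteq> S - S1" for T
    using that
  proof (induction T rule: finite_induct)
    case empty
    then show ?case using D0 g0 by (intro bexI[of _ 0]) auto
  next
    case (insert \<rho> T)
    then obtain m0 where m0: "m0 \<in> ?D" "\<gamma> m0 \<noteq> 0" "\<forall>\<rho>\<in>T. 0 < m0 \<bullet> v \<rho>" by blast
    from insert.prems obtain m where m: "m \<in> ?D" "\<gamma> m \<noteq> 0" "m \<bullet> v \<rho> \<noteq> 0" by (auto simp: S1_def)
    have nn: "0 \<le> m \<bullet> v \<nu>" "0 \<le> m0 \<bullet> v \<nu>" if "\<nu> \<in> S" for \<nu> using m m0 that unfolding D by auto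
    have "0 < (m + m0) \<bullet> v \<nu>" if "\<nu> \<in> insert \<rho> T" for \<nu>
    proof (cases "\<nu> = \<rho>")
      case True
      then show ?thesis using nn[of \<rho>] m(3) insert.prems by (auto simp: inner_add_left)
    next
      case False
      then have "0 < m0 \<bullet> v \<nu>" "\<nu> \<in> S" using that m0(3) insert.prems by auto
      then show ?thesis using nn[of \<nu>] by (simp add: inner_add_left)
    qed
    then show ?case using Dadd[OF m(1) m0(1)] gadd[OF m(1) m0(1)] m(2) m0(2)
      by (intro bexI[of _ "m + m0"]) auto
  qed
  \<comment> \<open>One monomial not killed by \<open>\<gamma>\<close> that is positive on all
    remaining rays, a sum of one witness per ray; large multiples of it move the vectors of
    \<open>H\<close> below into the dual monoid.\<close>
  from this[of "S - S1"] obtain m0 where m0: "m0 \<in> ?D" "\<gamma> m0 \<noteq> 0" and m0pos: "\<forall>\<rho>\<in>S - S1. 0 < m0 \<bullet> v \<rho>"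
    using finS by blast
  have m0z: "m0 \<bullet> v \<rho> = 0" if "\<rho> \<in> S1" for \<rho> using that m0 by (auto simp: S1_def)
  have kD: "real k *\<^sub>R m0 \<in> ?D \<and> \<gamma> (real k *\<^sub>R m0) \<noteq> 0" for k
  proof (induction k)
    case 0
    then show ?case using D0 g0 by simp
  next
    case (Suc k)
    have "real (Suc k) *\<^sub>R m0 = real k *\<^sub>R m0 + m0" by (simp add: scaleR_add_left)
    then show ?case using Suc m0 Dadd gadd by simp
  qed
  have large: "\<exists>k. \<forall>\<rho>\<in>S - S1. \<bar>m \<bullet> v \<rho>\<bar> \<le> real k * (m0 \<bullet> v \<rho>)" for m
  proof -
    have "\<forall>\<rho>\<in>S - S1. \<exists>k. \<bar>m \<bullet> v \<rho>\<bar> \<le> real k * (m0 \<bullet> v \<rho>)"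
      using m0pos reals_Archimedean3 order_less_imp_le by blast
    then obtain kk where kk: "\<forall>\<rho>\<in>S - S1. \<bar>m \<bullet> v \<rho>\<bar> \<le> real (kk \<rho>) * (m0 \<bullet> v \<rho>)" by metis
    have "\<bar>m \<bullet> v \<rho>\<bar> \<le> real (\<Sum>\<rho>\<in>S - S1. kk \<rho>) * (m0 \<bullet> v \<rho>)" if r: "\<rho> \<in> S - S1" for \<rho>
    proof -
      have "kk \<rho> \<le> (\<Sum>\<rho>\<in>S - S1. kk \<rho>)" using r finS by (intro member_le_sum) auto
      then have "real (kk \<rho>) * (m0 \<bullet> v \<rho>) \<le> real (\<Sum>\<rho>\<in>S - S1. kk \<rho>) * (m0 \<bullet> v \<rho>)"
        using m0pos r by (intro mult_right_mono) (auto simp: order_less_imp_le simp del: of_nat_sum)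
      then show ?thesis using kk r by force
    qed
    then show ?thesis by blast
  qed
  define F where "F = {m \<in> ?D. \<forall>\<rho>\<in>S1. m \<bullet> v \<rho> = 0}"
  define H where "H = {m \<in> int_lattice. \<forall>\<rho>\<in>S1. m \<bullet> v \<rho> = 0}"
  have Fadd: "p + q \<in> F" if "p \<in> F" "q \<in> F" for p q
    using that Dadd by (auto simp: F_def inner_add_left)
  have F0: "0 \<in> F" using D0 by (simp add: F_def)
  have shift: "\<exists>k. m + real k *\<^sub>R m0 \<in> F" if "m \<in> H" for m
  proof -
    obtain k where k: "\<forall>\<rho>\<in>S - S1. \<bar>m \<bullet> v \<rho>\<bar> \<le> real k * (m0 \<bullet> v \<rho>)" using large by blast
    have "0 \<le> (m + real k *\<^sub>R m0) \<bullet> v \<rho>" if "\<rho> \<in> S" for \<rho>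
    proof (cases "\<rho> \<in> S1")
      case True
      then show ?thesis using \<open>m \<in> H\<close> m0z by (simp add: H_def inner_add_left)
    next
      case False
      then have "\<bar>m \<bullet> v \<rho>\<bar> \<le> real k * (m0 \<bullet> v \<rho>)" using k that by blast
      then show ?thesis by (simp add: inner_add_left)
    qed
    moreover have "m + real k *\<^sub>R m0 \<in> int_lattice"
      using that m0(1) by (auto simp: H_def D intro!: int_lattice_add int_lattice_scale)
    moreover have "(m + real k *\<^sub>R m0) \<bullet> v \<rho> = 0" if "\<rho> \<in> S1" for \<rho>
      using that \<open>m \<in> H\<close> m0z by (simp add: H_def inner_add_left)
    ultimately show ?thesis unfolding F_def D by blast
  qed
  have gF: "\<gamma> m \<noteq> 0" if m: "m \<in> F" for m
  proof -
    \<comment> \<open>\<open>m\<close> and its complement in a multiple of \<open>m0\<close> add up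
      to a monomial that \<open>\<gamma>\<close> does not kill.\<close>
    have "- m \<in> H" using m by (auto simp: F_def H_def D int_lattice_iff)
    then obtain k where "- m + real k *\<^sub>R m0 \<in> F" using shift by blast
    then have "m + (- m + real k *\<^sub>R m0) = real k *\<^sub>R m0" "- m + real k *\<^sub>R m0 \<in> ?D" by (auto simp: F_def)
    moreover have "m \<in> ?D" using m by (simp add: F_def)
    ultimately have "\<gamma> (real k *\<^sub>R m0) = \<gamma> m * \<gamma> (- m + real k *\<^sub>R m0)" using gadd by metis
    then show ?thesis using kD[of k] by auto
  qed
  \<comment> \<open>The value on a difference does not depend on the decomposition, so any choice
    will do.\<close>
  define ch where "ch a = (SOME c. \<exists>p\<in>F. \<exists>q\<in>F. a = p - q \<and> c = \<gamma> p / \<gamma> q)" for a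
  have ch: "ch (p - q) = \<gamma> p / \<gamma> q" if pq: "p \<in> F" "q \<in> F" for p q
  proof -
    have "\<exists>p'\<in>F. \<exists>q'\<in>F. p - q = p' - q' \<and> ch (p - q) = \<gamma> p' / \<gamma> q'"
      unfolding ch_def by (rule someI[of _ "\<gamma> p / \<gamma> q"]) (use pq in blast)
    then obtain p' q' where p': "p' \<in> F" "q' \<in> F" "p - q = p' - q'" "ch (p - q) = \<gamma> p' / \<gamma> q'" by blast
    have "p + q' = p' + q" using p'(3) by (simp add: algebra_simps)
    then have "\<gamma> p * \<gamma> q' = \<gamma> p' * \<gamma> q"
      using gadd[of p q'] gadd[of p' q] pq p' by (simp add: F_def)
    then have "\<gamma> p / \<gamma> q = \<gamma> p' / \<gamma> q'"
      using gF[OF pq(2)] gF[OF p'(2)] by (simp add: frac_eq_eq)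
    then show ?thesis using p'(4) by simp
  qed
  have dec: "\<exists>p\<in>F. \<exists>q\<in>F. a = p - q" if a: "a \<in> H" for a
  proof -
    obtain k where k: "a + real k *\<^sub>R m0 \<in> F" using shift[OF a] by blast
    have "real k *\<^sub>R m0 \<in> F" using kD[of k] m0z by (simp add: F_def)
    then show ?thesis using k by (metis add_diff_cancel_right')
  qed
  have HL: "a \<in> int_lattice" if "a \<in> H" for a using that by (simp add: H_def)
  have "\<exists>t. (\<forall>\<rho>\<in>C. t \<rho> \<noteq> 0) \<and> (\<forall>a\<in>H. ch a = (\<Prod>\<rho>\<in>C. t \<rho> powi expo a \<rho>))"
  proof (rule character_extension[OF finite_C])
    show "0 \<in> H" by (simp add: H_def int_lattice_0)
    show "a - b \<in> H" if "a \<in> H" "b \<in> H" for a b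
      using that by (auto simp: H_def int_lattice_diff inner_diff_left)
    show "expo (a - b) \<rho> = expo a \<rho> - expo b \<rho>" if "a \<in> H" "b \<in> H" "\<rho> \<in> C" for a b \<rho>
      using expo_diff[OF HL HL] that by blast
    show "ch a \<noteq> 0" if "a \<in> H" for a
    proof -
      from dec[OF that] obtain p q where "p \<in> F" "q \<in> F" "a = p - q" by blast
      then show ?thesis using ch gF by simp
    qed
    show "ch (a - b) = ch a / ch b" if ab: "a \<in> H" "b \<in> H" for a b
    proof -
      from dec[OF ab(1)] obtain p q where a: "p \<in> F" "q \<in> F" "a = p - q" by blast
      from dec[OF ab(2)] obtain p' q' where b: "p' \<in> F" "q' \<in> F" "b = p' - q'" by blast
      have "a - b = (p + q') - (q + p')" using a b by (simp add: algebra_simps)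
      then have "ch (a - b) = \<gamma> (p + q') / \<gamma> (q + p')"
        using ch[OF Fadd[OF a(1) b(2)] Fadd[OF a(2) b(1)]] by simp
      also have "\<dots> = \<gamma> p * \<gamma> q' / (\<gamma> q * \<gamma> p')"
        using gadd a b by (simp add: F_def)
      also have "\<dots> = ch a / ch b" using ch a b by simp
      finally show ?thesis .
    qed
    \<comment> \<open>The rays span the space by \<open>cover\<close>, so a vector orthogonal to all
      of them is 0.\<close>
    show "ch a = 1" if a: "a \<in> H" "\<forall>\<rho>\<in>C. expo a \<rho> = 0" for a
    proof -
      have "a \<bullet> v \<rho> = 0" if "\<rho> \<in> C" for \<rho> using of_int_expo[OF HL[OF a(1)] that] a(2) that by simp
      moreover obtain c where "(\<Sum>\<rho>\<in>C. c \<rho> *\<^sub>R v \<rho>) = a" using cover by blast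
      ultimately have "a \<bullet> a = 0" by (metis (no_types, lifting) inner_scaleR_right inner_sum_right mult_zero_right sum.neutral)
      then have "a = 0 - 0" by simp
      then show ?thesis using ch[OF F0 F0] g0 by simp
    qed
  qed
  then obtain t where t: "\<forall>\<rho>\<in>C. t \<rho> \<noteq> 0" "\<forall>a\<in>H. ch a = (\<Prod>\<rho>\<in>C. t \<rho> powi expo a \<rho>)" by blast
  define x where "x = (\<lambda>\<rho>. if \<rho> \<in> C - S1 then t \<rho> else 0)"
  have S1S: "S1 \<subseteq> S" "S1 \<subseteq> C" using A_sub[OF S] by (auto simp: S1_def)
  show ?thesis
  proof (rule that)
    show "x \<in> chart_cover S" using t(1) S1S by (auto simp: chart_cover_def aff_def zeros_def x_def)
    show "quot (ray_cone S) x = \<gamma>"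
    proof
      fix m
      consider "m \<notin> ?D" | "m \<in> F" | "m \<in> ?D" "m \<notin> F" by blast
      then show "quot (ray_cone S) x m = \<gamma> m"
      proof cases
        case 1
        then show ?thesis using gout by (simp add: quot_def)
      next
        case 2
        then have "m \<in> H" by (simp add: F_def H_def D)
        have "mon (expo m) x = (\<Prod>\<rho>\<in>C. t \<rho> powi expo m \<rho>)"
          unfolding mon_def using 2 by (intro prod.cong) (auto simp: x_def F_def expo_def)
        also have "\<dots> = ch (m - 0)" using t(2) \<open>m \<in> H\<close> by simp
        also have "\<dots> = \<gamma> m" using ch[OF 2 F0] g0 by simp
        finally show ?thesis using 2 by (simp add: quot_def F_def)
      next
        case 3
        then obtain \<rho> where r: "\<rho> \<in> S1" "m \<bullet> v \<rho> \<noteq> 0" by (auto simp: F_def)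
        then have "\<gamma> m = 0" using 3(1) by (auto simp: S1_def)
        moreover have "expo m \<rho> \<noteq> 0"
          using of_int_expo[of m \<rho>] 3(1) r S1S by (auto simp: D)
        then have "mon (expo m) x = 0"
          unfolding mon_eq_0_iff using r S1S by (auto simp: x_def)
        ultimately show ?thesis by (simp add: quot_def)
      qed
    qed
  qed
qed

end

section \<open>Descent of functions along the quotient map\<close>

context cox_data
begin

text \<open>Set to 0 off \<open>R\<close> so that weights that agree on \<open>R\<close> are equal
  as functions.\<close>

definition weight_of :: "('c \<Rightarrow> int) \<Rightarrow> 'r \<Rightarrow> int" where
  "weight_of e \<mu> = (if \<mu> \<in> R then \<Sum>\<rho>\<in>C. w \<mu> \<rho> * e \<rho> else 0)"

text \<open>Semi-invariants of weight \<open>\<psi>\<close> that are regular on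
  \<open>chart_cover S\<close>: negative exponents occur only at coordinates invertible
  there.\<close>

definition laurent :: "'c set \<Rightarrow> ('r \<Rightarrow> int) \<Rightarrow> (('c \<Rightarrow> complex) \<Rightarrow> complex) set" where
  "laurent S \<psi> = lin_span (mon ` {e. (\<forall>\<rho>\<in>S. 0 \<le> e \<rho>) \<and> weight_of e = \<psi>})"

definition polys :: "(('c \<Rightarrow> complex) \<Rightarrow> complex) set" where
  "polys = {\<lambda>x. \<Sum>e\<in>E. c e * (\<Prod>\<rho>\<in>C. x \<rho> ^ e \<rho>) | c (E :: ('c \<Rightarrow> nat) set). finite E}"

lemma polys_eq: "polys = lin_span (range (\<lambda>e x. \<Prod>\<rho>\<in>C. x \<rho> ^ e \<rho>))"
  unfolding polys_def lin_span_eq[symmetric] by simp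

lemma polys_monomial: "(\<lambda>x. \<Prod>\<rho>\<in>C. x \<rho> ^ e \<rho>) \<in> polys"
  unfolding polys_eq by (rule lin_span_base) blast

lemma polys_mult: "f \<in> polys \<Longrightarrow> g \<in> polys \<Longrightarrow> (\<lambda>x. f x * g x) \<in> polys"
proof -
  assume "f \<in> polys" "g \<in> polys"
  then have "\<exists>h\<in>polys. \<forall>x\<in>UNIV. h x = f x * g x"
    unfolding polys_eq
  proof (rule lin_span_mult)
    fix b b' :: "('c \<Rightarrow> complex) \<Rightarrow> complex"
    assume "b \<in> range (\<lambda>e x. \<Prod>\<rho>\<in>C. x \<rho> ^ e \<rho>)" "b' \<in> range (\<lambda>e x. \<Prod>\<rho>\<in>C. x \<rho> ^ e \<rho>)"
    then obtain e e' where "b = (\<lambda>x. \<Prod>\<rho>\<in>C. x \<rho> ^ e \<rho>)" "b' = (\<lambda>x. \<Prod>\<rho>\<in>C. x \<rho> ^ e' \<rho>)" by blast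
    then show "\<exists>h\<in>lin_span (range (\<lambda>e x. \<Prod>\<rho>\<in>C. x \<rho> ^ e \<rho>)). \<forall>x\<in>UNIV. h x = b x * b' x"
      by (intro bexI[of _ "\<lambda>x. \<Prod>\<rho>\<in>C. x \<rho> ^ (e \<rho> + e' \<rho>)"])
        (auto simp: power_add prod.distrib intro!: lin_span_base rangeI[of "\<lambda>e x. \<Prod>\<rho>\<in>C. x \<rho> ^ e \<rho>" "\<lambda>\<rho>. e \<rho> + e' \<rho>", unfolded power_add prod.distrib])
  qed
  then obtain h where "h \<in> polys" "\<forall>x\<in>UNIV. h x = f x * g x" by blast
  then show ?thesis by (metis (no_types, lifting) UNIV_I ext)
qed

lemma polys_one: "(\<lambda>_. 1) \<in> polys"
  using polys_monomial[of "\<lambda>_. 0"] by simp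

lemma polys_power: "f \<in> polys \<Longrightarrow> (\<lambda>x. f x ^ k) \<in> polys"
  by (induction k) (auto simp: polys_one intro: polys_mult)

lemma polys_add: "f \<in> polys \<Longrightarrow> g \<in> polys \<Longrightarrow> (\<lambda>x. f x + g x) \<in> polys"
  unfolding polys_eq by (rule lin_span_add)

lemma polys_scale: "f \<in> polys \<Longrightarrow> (\<lambda>x. c * f x) \<in> polys"
  unfolding polys_eq by (rule lin_span_scale)

sublocale poly_ring: function_ring stable polys
proof
  show "\<exists>f\<in>polys. \<forall>x\<in>stable. f x = 1" by (rule bexI[OF _ polys_one]) simp
  show "\<exists>h\<in>polys. \<forall>x\<in>stable. h x = f x * g x" if "f \<in> polys" "g \<in> polys" for f g
    by (rule bexI[OF _ polys_mult[OF that]]) simp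
qed

lemma chart_ring_eq: "chart_ring \<sigma> = lin_span ((\<lambda>m \<gamma>. \<gamma> m) ` dual_monoid \<sigma>)"
  unfolding chart_ring_def lin_span_eq[symmetric] by auto

lemma chart_function_ring:
  assumes S: "S \<in> A"
  shows "function_ring (chart_points (ray_cone S)) (chart_ring (ray_cone S))"
proof
  let ?D = "dual_monoid (ray_cone S)"
  have "0 \<in> ?D" unfolding dual_monoid_iff[OF S] by (simp add: int_lattice_0)
  then have "(\<lambda>\<gamma>. \<gamma> 0) \<in> chart_ring (ray_cone S)" unfolding chart_ring_eq
    by (intro lin_span_base) auto
  then show "\<exists>f\<in>chart_ring (ray_cone S). \<forall>\<gamma>\<in>chart_points (ray_cone S). f \<gamma> = 1"
    by (rule bexI[rotated]) (auto simp: chart_points_def)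
  fix f g assume "f \<in> chart_ring (ray_cone S)" "g \<in> chart_ring (ray_cone S)"
  then show "\<exists>h\<in>chart_ring (ray_cone S). \<forall>\<gamma>\<in>chart_points (ray_cone S). h \<gamma> = f \<gamma> * g \<gamma>"
    unfolding chart_ring_eq
  proof (rule lin_span_mult)
    fix b b' :: "(real ^ 'n \<Rightarrow> complex) \<Rightarrow> complex"
    assume "b \<in> (\<lambda>m \<gamma>. \<gamma> m) ` ?D" "b' \<in> (\<lambda>m \<gamma>. \<gamma> m) ` ?D"
    then obtain m m' where m: "b = (\<lambda>\<gamma>. \<gamma> m)" "b' = (\<lambda>\<gamma>. \<gamma> m')" "m \<in> ?D" "m' \<in> ?D" by blast
    have "m + m' \<in> ?D" using m(3,4) unfolding dual_monoid_iff[OF S]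
      by (auto simp: int_lattice_add inner_add_left)
    then show "\<exists>h\<in>lin_span ((\<lambda>m \<gamma>. \<gamma> m) ` ?D). \<forall>\<gamma>\<in>chart_points (ray_cone S). h \<gamma> = b \<gamma> * b' \<gamma>"
      using m by (intro bexI[of _ "\<lambda>\<gamma>. \<gamma> (m + m')"])
        (auto simp: chart_points_def intro!: lin_span_base)
  qed
qed

lemma laurent_of_chart_ring:
  assumes S: "S \<in> A" and f: "f \<in> chart_ring (ray_cone S)"
  shows "\<exists>F\<in>laurent S (\<lambda>_. 0). \<forall>y\<in>chart_cover S. f (quot (ray_cone S) y) = F y"
  unfolding laurent_def
proof (rule lin_span_transport[where f = f and p = "quot (ray_cone S)"
      and B = "(\<lambda>m \<gamma>. \<gamma> m) ` dual_monoid (ray_cone S)"])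
  show "f \<in> lin_span ((\<lambda>m \<gamma>. \<gamma> m) ` dual_monoid (ray_cone S))" using f chart_ring_eq by blast
  fix b :: "(real ^ 'n \<Rightarrow> complex) \<Rightarrow> complex"
  assume "b \<in> (\<lambda>m \<gamma>. \<gamma> m) ` dual_monoid (ray_cone S)"
  then obtain m where m: "b = (\<lambda>\<gamma>. \<gamma> m)" "m \<in> dual_monoid (ray_cone S)" by blast
  have "weight_of (expo m) = (\<lambda>_. 0)"
    using weight_expo[of m] m(2) by (auto simp: weight_of_def dual_monoid_def)
  then have "mon (expo m) \<in> lin_span (mon ` {e. (\<forall>\<rho>\<in>S. 0 \<le> e \<rho>) \<and> weight_of e = (\<lambda>_. 0)})"
    using expo_nonneg[OF S m(2)] by (intro lin_span_base imageI) auto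
  then show "\<exists>b'\<in>lin_span (mon ` {e. (\<forall>\<rho>\<in>S. 0 \<le> e \<rho>) \<and> weight_of e = (\<lambda>_. 0)}).
      \<forall>y\<in>chart_cover S. b (quot (ray_cone S) y) = b' y"
    using m by (intro bexI[of _ "mon (expo m)"]) (auto simp: quot_def)
qed

text \<open>The other half of Gale duality: an exponent vector of weight zero is
  \<open>expo m\<close> on \<open>C\<close> for a lattice vector \<open>m\<close>, and nonnegativity
  on \<open>S\<close> places \<open>m\<close> in the dual monoid.\<close>

lemma chart_ring_of_laurent:
  assumes S: "S \<in> A" and F: "F \<in> laurent S (\<lambda>_. 0)"
  shows "\<exists>f\<in>chart_ring (ray_cone S). \<forall>y\<in>chart_cover S. F y = f (quot (ray_cone S) y)"
  using F unfolding laurent_def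
proof induction
  case zero
  show ?case unfolding chart_ring_eq by (rule bexI[OF _ lin_span.zero]) auto
next
  case (step F b c)
  from step.IH obtain f where f: "f \<in> chart_ring (ray_cone S)"
    "\<forall>y\<in>chart_cover S. F y = f (quot (ray_cone S) y)" by blast
  from step.hyps obtain e where e: "b = mon e" "\<forall>\<rho>\<in>S. 0 \<le> e \<rho>" "weight_of e = (\<lambda>_. 0)" by blast
  have "(\<Sum>\<rho>\<in>C. w \<mu> \<rho> * e \<rho>) = 0" if "\<mu> \<in> R" for \<mu>
    using fun_cong[OF e(3), of \<mu>] that by (simp add: weight_of_def)
  then obtain m where m: "m \<in> int_lattice" "\<forall>\<rho>\<in>C. of_int (e \<rho>) = m \<bullet> v \<rho>" using kernel[of e] by blast
  have D: "m \<in> dual_monoid (ray_cone S)"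
    unfolding dual_monoid_iff[OF S] using m e(2) A_sub[OF S] by (metis of_int_0_le_iff subsetD)
  have "mon (expo m) y = mon e y" for y
    using m(2) by (intro mon_cong) (simp add: expo_def flip: m(2))
  then have "b y = quot (ray_cone S) y m" for y using D e(1) by (simp add: quot_def)
  moreover have "(\<lambda>\<gamma>. f \<gamma> + c * \<gamma> m) \<in> chart_ring (ray_cone S)"
    using f(1) D unfolding chart_ring_eq by (intro lin_span.step) auto
  ultimately show ?case using f(2) by (intro bexI[of _ "\<lambda>\<gamma>. f \<gamma> + c * \<gamma> m"]) auto
qed

text \<open>A polynomial whose nonvanishing locus in \<open>aff\<close> is
  \<open>chart_cover S\<close>; its powers clear the denominators of Laurent polynomials regular
  there.\<close>

definition denom :: "'c set \<Rightarrow> ('c \<Rightarrow> complex) \<Rightarrow> complex" where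
  "denom S y = (\<Prod>\<rho>\<in>C - S. y \<rho>)"

lemma polys_denom: "denom S \<in> polys"
proof -
  have "denom S = (\<lambda>x. \<Prod>\<rho>\<in>C. x \<rho> ^ (if \<rho> \<in> S then 0 else 1))"
  proof
    fix x :: "'c \<Rightarrow> complex"
    have "(\<Prod>\<rho>\<in>C. x \<rho> ^ (if \<rho> \<in> S then 0 else 1)) = (\<Prod>\<rho>\<in>C - S. x \<rho>)"
      using finite_C by (intro prod.mono_neutral_cong_right) auto
    then show "denom S x = (\<Prod>\<rho>\<in>C. x \<rho> ^ (if \<rho> \<in> S then 0 else 1))" by (simp add: denom_def)
  qed
  then show ?thesis using polys_monomial by simp
qed

lemma denom_nonzero_iff: "y \<in> aff \<Longrightarrow> denom S y \<noteq> 0 \<longleftrightarrow> y \<in> chart_cover S"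
  using finite_C by (auto simp: denom_def chart_cover_def zeros_def)

lemma laurent_clear_denominators:
  assumes F: "F \<in> laurent S \<psi>"
  shows "\<exists>N. \<exists>p\<in>polys. \<forall>y\<in>chart_cover S. p y = F y * denom S y ^ N"
  using F unfolding laurent_def
proof induction
  case zero
  have "(\<lambda>_. 0) \<in> polys" unfolding polys_eq by (rule lin_span.zero)
  then show ?case by (intro exI[of _ 0] bexI[of _ "\<lambda>_. 0"]) auto
next
  case (step F b c)
  from step.IH obtain N p where p: "p \<in> polys" "\<forall>y\<in>chart_cover S. p y = F y * denom S y ^ N" by blast
  from step.hyps obtain e where e: "b = mon e" "\<forall>\<rho>\<in>S. 0 \<le> e \<rho>" by blast
  \<comment> \<open>A bound for the absolute value of every exponent, so that multiplication by
    \<open>denom S y ^ M\<close> leaves none negative.\<close>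
  define M where "M = nat (\<Sum>\<rho>\<in>C. \<bar>e \<rho>\<bar>)"
  have M: "0 \<le> e \<rho> + int M" if "\<rho> \<in> C" for \<rho>
  proof -
    have "\<bar>e \<rho>\<bar> \<le> (\<Sum>\<rho>\<in>C. \<bar>e \<rho>\<bar>)" using that finite_C by (intro member_le_sum) auto
    then show ?thesis by (simp add: M_def sum_nonneg)
  qed
  define e' where "e' \<rho> = nat (if \<rho> \<in> S then e \<rho> else e \<rho> + int M)" for \<rho>
  have b: "b y * denom S y ^ M = (\<Prod>\<rho>\<in>C. y \<rho> ^ e' \<rho>)" if y: "y \<in> chart_cover S" for y
  proof -
    have d: "denom S y ^ M = (\<Prod>\<rho>\<in>C. if \<rho> \<in> S then 1 else y \<rho> powi int M)"
      unfolding denom_def prod_power_distrib using finite_C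
      by (intro prod.mono_neutral_cong_left) auto
    show ?thesis unfolding e(1) mon_def d prod.distrib[symmetric]
    proof (rule prod.cong)
      fix \<rho> assume r: "\<rho> \<in> C"
      show "y \<rho> powi e \<rho> * (if \<rho> \<in> S then 1 else y \<rho> powi int M) = y \<rho> ^ e' \<rho>"
      proof (cases "\<rho> \<in> S")
        case True
        then show ?thesis using e(2) by (simp add: e'_def power_int_nonneg_exp)
      next
        case False
        then have "y \<rho> \<noteq> 0" using y r by (auto simp: chart_cover_def zeros_def)
        then have "y \<rho> powi e \<rho> * y \<rho> powi int M = y \<rho> powi (e \<rho> + int M)" by (simp add: power_int_add)
        then show ?thesis using False M[OF r] by (simp add: e'_def power_int_nonneg_exp)
      qed
    qed simp
  qed
  define p' where "p' = (\<lambda>y. p y * denom S y ^ M + c * ((\<Prod>\<rho>\<in>C. y \<rho> ^ e' \<rho>) * denom S y ^ N))"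
  have "p' \<in> polys" unfolding p'_def
    by (intro polys_add polys_mult polys_scale polys_power polys_denom p(1) polys_monomial)
  moreover have "p' y = (F y + c * b y) * denom S y ^ (N + M)" if "y \<in> chart_cover S" for y
    unfolding p'_def b[OF that, symmetric] using p(2) that by (simp add: power_add algebra_simps)
  ultimately show ?case by (intro exI[of _ "N + M"] bexI[of _ p']) auto
qed

lemma laurent_mono: "S \<subseteq> S' \<Longrightarrow> F \<in> laurent S' \<psi> \<Longrightarrow> F \<in> laurent S \<psi>"
proof -
  assume S: "S \<subseteq> S'" and F: "F \<in> laurent S' \<psi>"
  from F show ?thesis unfolding laurent_def
  proof induction
    case (step f b c)
    moreover have "b \<in> mon ` {e. (\<forall>\<rho>\<in>S. 0 \<le> e \<rho>) \<and> weight_of e = \<psi>}" using step.hyps(2) S by blast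
    ultimately show ?case by (intro lin_span.step)
  qed (rule lin_span.zero)
qed

lemma laurent_mult:
  assumes "F \<in> laurent S \<psi>" "G \<in> laurent S \<psi>'"
  shows "\<exists>H\<in>laurent S (\<lambda>\<mu>. \<psi> \<mu> + \<psi>' \<mu>). \<forall>y\<in>chart_cover S. H y = F y * G y"
  using assms unfolding laurent_def
proof (rule lin_span_mult)
  fix b b' :: "('c \<Rightarrow> complex) \<Rightarrow> complex"
  assume "b \<in> mon ` {e. (\<forall>\<rho>\<in>S. 0 \<le> e \<rho>) \<and> weight_of e = \<psi>}" "b' \<in> mon ` {e. (\<forall>\<rho>\<in>S. 0 \<le> e \<rho>) \<and> weight_of e = \<psi>'}"
  then obtain e e' where e: "b = mon e" "\<forall>\<rho>\<in>S. 0 \<le> e \<rho>" "weight_of e = \<psi>"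
    "b' = mon e'" "\<forall>\<rho>\<in>S. 0 \<le> e' \<rho>" "weight_of e' = \<psi>'" by blast
  have "weight_of (\<lambda>\<rho>. e \<rho> + e' \<rho>) = (\<lambda>\<mu>. \<psi> \<mu> + \<psi>' \<mu>)"
    unfolding e(3,6)[symmetric] by (rule ext) (simp add: weight_of_def sum.distrib algebra_simps)
  moreover have "mon (\<lambda>\<rho>. e \<rho> + e' \<rho>) y = b y * b' y" if "y \<in> chart_cover S" for y
    unfolding e(1,4) using e(2,5) that by (intro mon_add) (auto simp: chart_cover_def)
  ultimately show "\<exists>h\<in>lin_span (mon ` {e. (\<forall>\<rho>\<in>S. 0 \<le> e \<rho>) \<and> weight_of e = (\<lambda>\<mu>. \<psi> \<mu> + \<psi>' \<mu>)}).
      \<forall>y\<in>chart_cover S. h y = b y * b' y"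
    using e by (intro bexI[of _ "mon (\<lambda>\<rho>. e \<rho> + e' \<rho>)"] lin_span_base) auto
qed

lemma laurent_power:
  assumes "F \<in> laurent S \<psi>"
  shows "\<exists>H\<in>laurent S (\<lambda>\<mu>. int k * \<psi> \<mu>). \<forall>y\<in>chart_cover S. H y = F y ^ k"
proof (induction k)
  case 0
  have "weight_of (\<lambda>_. 0) = (\<lambda>_. 0)" by (auto simp: weight_of_def)
  then have "mon (\<lambda>_. 0) \<in> laurent S (\<lambda>_. 0)" unfolding laurent_def by (intro lin_span_base) auto
  then show ?case by (intro bexI[of _ "mon (\<lambda>_. 0)"]) auto
next
  case (Suc k)
  then obtain H where H: "H \<in> laurent S (\<lambda>\<mu>. int k * \<psi> \<mu>)" "\<forall>y\<in>chart_cover S. H y = F y ^ k" by blast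
  from laurent_mult[OF H(1) assms] obtain K where
    "K \<in> laurent S (\<lambda>\<mu>. int k * \<psi> \<mu> + \<psi> \<mu>)" "\<forall>y\<in>chart_cover S. K y = H y * F y" by blast
  moreover have "(\<lambda>\<mu>. int k * \<psi> \<mu> + \<psi> \<mu>) = (\<lambda>\<mu>. int (Suc k) * \<psi> \<mu>)" by (auto simp: algebra_simps)
  ultimately show ?case using H(2) by (intro bexI[of _ K]) (auto simp: mult.commute)
qed

text \<open>Monomials are grouped by weight. The components exist for all weights and vanish off
  \<open>X\<close>, so that two polynomials can be expanded over a common set of weights.\<close>

lemma poly_weight_decomposition:
  assumes h: "h \<in> polys"
  obtains X hh where "finite X" "X \<subseteq> {\<psi>. \<forall>\<mu>. \<mu> \<notin> R \<longrightarrow> \<psi> \<mu> = 0}"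
    "\<And>\<psi>. hh \<psi> \<in> laurent C \<psi>" "\<And>\<psi>. \<psi> \<notin> X \<Longrightarrow> hh \<psi> = (\<lambda>_. 0)"
    "\<And>y t. t \<in> tor \<Longrightarrow> h (act t y) = (\<Sum>\<psi>\<in>X. hh \<psi> y * (\<Prod>\<mu>\<in>R. t \<mu> powi \<psi> \<mu>))"
proof -
  from h obtain c and E :: "('c \<Rightarrow> nat) set" where E: "finite E"
    and h: "h = (\<lambda>x. \<Sum>e\<in>E. c e * (\<Prod>\<rho>\<in>C. x \<rho> ^ e \<rho>))" unfolding polys_def by blast
  define wt :: "('c \<Rightarrow> nat) \<Rightarrow> 'r \<Rightarrow> int" where "wt e = weight_of (\<lambda>\<rho>. int (e \<rho>))" for e
  define hh where "hh \<psi> y = (\<Sum>e\<in>{e \<in> E. wt e = \<psi>}. c e * mon (\<lambda>\<rho>. int (e \<rho>)) y)" for \<psi> y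
  show ?thesis
  proof (rule that[of "wt ` E" hh])
    show "finite (wt ` E)" using E by simp
    show "wt ` E \<subseteq> {\<psi>. \<forall>\<mu>. \<mu> \<notin> R \<longrightarrow> \<psi> \<mu> = 0}" by (auto simp: wt_def weight_of_def)
    show "hh \<psi> \<in> laurent C \<psi>" for \<psi>
      unfolding hh_def laurent_def
    proof (intro lin_span_sum lin_span_scale lin_span_base)
      fix e assume "e \<in> {e \<in> E. wt e = \<psi>}"
      then show "mon (\<lambda>\<rho>. int (e \<rho>)) \<in> mon ` {e. (\<forall>\<rho>\<in>C. 0 \<le> e \<rho>) \<and> weight_of e = \<psi>}"
        by (intro imageI) (auto simp: wt_def)
    qed (use E in auto)
    show "hh \<psi> = (\<lambda>_. 0)" if "\<psi> \<notin> wt ` E" for \<psi>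
    proof -
      have "{e \<in> E. wt e = \<psi>} = {}" using that by blast
      then show ?thesis by (auto simp: hh_def fun_eq_iff simp del: Collect_empty_eq empty_Collect_eq)
    qed
    fix y t assume t: "t \<in> tor"
    have "h (act t y) = (\<Sum>e\<in>E. c e * mon (\<lambda>\<rho>. int (e \<rho>)) (act t y))"
      by (simp add: h mon_def)
    also have "\<dots> = (\<Sum>e\<in>E. c e * mon (\<lambda>\<rho>. int (e \<rho>)) y * (\<Prod>\<mu>\<in>R. t \<mu> powi wt e \<mu>))"
      by (rule sum.cong) (auto simp: mon_act[OF t] wt_def weight_of_def)
    also have "\<dots> = (\<Sum>\<psi>\<in>wt ` E. \<Sum>e\<in>{e \<in> E. wt e = \<psi>}. c e * mon (\<lambda>\<rho>. int (e \<rho>)) y * (\<Prod>\<mu>\<in>R. t \<mu> powi wt e \<mu>))"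
      using E by (rule sum.image_gen)
    also have "\<dots> = (\<Sum>\<psi>\<in>wt ` E. hh \<psi> y * (\<Prod>\<mu>\<in>R. t \<mu> powi \<psi> \<mu>))"
      unfolding hh_def sum_distrib_right by (intro sum.cong) auto
    finally show "h (act t y) = (\<Sum>\<psi>\<in>wt ` E. hh \<psi> y * (\<Prod>\<mu>\<in>R. t \<mu> powi \<psi> \<mu>))" .
  qed
qed

text \<open>A weight component \<open>h\<^sub>\<psi>\<close> of \<open>h\<close> not vanishing at \<open>x0\<close> becomes invariant after raising it to a
  power and dividing by a monomial in the coordinates outside \<open>S\<close>; this uses that the rays in \<open>S\<close> are
  linearly independent.\<close>

lemma descend:
  assumes S: "S \<in> A" and gh: "g \<in> polys" "h \<in> polys" and x0: "x0 \<in> chart_cover S" "h x0 \<noteq> 0"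
  obtains f1 f2 where "f1 \<in> chart_ring (ray_cone S)" "f2 \<in> chart_ring (ray_cone S)"
    "f2 (quot (ray_cone S) x0) \<noteq> 0"
    "\<forall>y\<in>chart_cover S. (\<forall>t\<in>tor. h (act t y) = 0) \<longrightarrow> f2 (quot (ray_cone S) y) = 0"
    "\<forall>y\<in>chart_cover S. \<forall>c. (\<forall>t\<in>tor. g (act t y) = c * h (act t y)) \<longrightarrow>
       f1 (quot (ray_cone S) y) = c * f2 (quot (ray_cone S) y)"
proof -
  obtain X hh where X: "finite X" "X \<subseteq> {\<psi>. \<forall>\<mu>. \<mu> \<notin> R \<longrightarrow> \<psi> \<mu> = 0}"
    and hh: "\<And>\<psi>. hh \<psi> \<in> laurent C \<psi>" "\<And>\<psi>. \<psi> \<notin> X \<Longrightarrow> hh \<psi> = (\<lambda>_. 0)"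
    and h: "\<And>y t. t \<in> tor \<Longrightarrow> h (act t y) = (\<Sum>\<psi>\<in>X. hh \<psi> y * (\<Prod>\<mu>\<in>R. t \<mu> powi \<psi> \<mu>))"
    using poly_weight_decomposition[OF gh(2)] by blast
  obtain X' gg where X': "finite X'" "X' \<subseteq> {\<psi>. \<forall>\<mu>. \<mu> \<notin> R \<longrightarrow> \<psi> \<mu> = 0}"
    and gg: "\<And>\<psi>. gg \<psi> \<in> laurent C \<psi>" "\<And>\<psi>. \<psi> \<notin> X' \<Longrightarrow> gg \<psi> = (\<lambda>_. 0)"
    and g: "\<And>y t. t \<in> tor \<Longrightarrow> g (act t y) = (\<Sum>\<psi>\<in>X'. gg \<psi> y * (\<Prod>\<mu>\<in>R. t \<mu> powi \<psi> \<mu>))"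
    using poly_weight_decomposition[OF gh(1)] by blast
  let ?Y = "X \<union> X'"
  have Y: "finite ?Y" "?Y \<subseteq> {\<psi>. \<forall>\<mu>. \<mu> \<notin> R \<longrightarrow> \<psi> \<mu> = 0}" using X X' by auto
  have hY: "h (act t y) = (\<Sum>\<psi>\<in>?Y. hh \<psi> y * (\<Prod>\<mu>\<in>R. t \<mu> powi \<psi> \<mu>))" if "t \<in> tor" for t y
    unfolding h[OF that] using Y(1) hh(2) by (intro sum.mono_neutral_left) auto
  have gY: "g (act t y) = (\<Sum>\<psi>\<in>?Y. gg \<psi> y * (\<Prod>\<mu>\<in>R. t \<mu> powi \<psi> \<mu>))" if "t \<in> tor" for t y
    unfolding g[OF that] using Y(1) gg(2) by (intro sum.mono_neutral_left) auto
  have "\<exists>\<psi>\<in>?Y. hh \<psi> x0 \<noteq> 0"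
  proof (rule ccontr)
    assume "\<not> ?thesis"
    then have "h (act (\<lambda>_. 1) x0) = 0" unfolding hY[OF one_tor] by (intro sum.neutral) auto
    then show False using x0(2) act_one by simp
  qed
  then obtain \<psi> where psi: "\<psi> \<in> ?Y" "hh \<psi> x0 \<noteq> 0" by blast
  \<comment> \<open>A nonzero component contains a genuine monomial, whose exponent
    \<open>e0\<close> represents the weight \<open>\<psi>\<close>.\<close>
  have "{e. (\<forall>\<rho>\<in>C. 0 \<le> e \<rho>) \<and> weight_of e = \<psi>} \<noteq> {}"
  proof
    assume empty: "{e. (\<forall>\<rho>\<in>C. 0 \<le> e \<rho>) \<and> weight_of e = \<psi>} = {}"
    have "hh \<psi> \<in> lin_span {}" using hh(1)[of \<psi>] unfolding laurent_def empty by simp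
    then have "hh \<psi> = (\<lambda>_. 0)" by cases auto
    then show False using psi(2) by simp
  qed
  then obtain e0 where e0: "\<forall>\<rho>\<in>C. 0 \<le> e0 \<rho>" "weight_of e0 = \<psi>" by blast
  obtain k m where k: "k > 0" "m \<in> int_lattice"
    and m: "\<And>\<rho>. \<rho> \<in> S \<Longrightarrow> m \<bullet> v \<rho> = of_nat k * of_int (e0 \<rho>)" using dual_vector[OF S] by metis
  \<comment> \<open>On \<open>S\<close> the lattice vector agrees with \<open>k\<close> times
    \<open>e0\<close>, so \<open>e1\<close> involves only coordinates invertible on the chart;
    lattice vectors have weight zero, which leaves \<open>- k\<close> times
    \<open>\<psi>\<close>.\<close>
  define e1 where "e1 \<rho> = expo m \<rho> - int k * e0 \<rho>" for \<rho>
  have e1S: "e1 \<rho> = 0" if "\<rho> \<in> S" for \<rho>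
  proof -
    have "real_of_int (expo m \<rho>) = real_of_int (int k * e0 \<rho>)"
      using of_int_expo[OF k(2)] m[OF that] A_sub[OF S] that by auto
    then have "expo m \<rho> = int k * e0 \<rho>" unfolding of_int_eq_iff .
    then show ?thesis unfolding e1_def by simp
  qed
  have "weight_of e1 \<mu> = - (int k * \<psi> \<mu>)" for \<mu>
  proof (cases "\<mu> \<in> R")
    case True
    have "weight_of e1 \<mu> = (\<Sum>\<rho>\<in>C. w \<mu> \<rho> * expo m \<rho>) - int k * (\<Sum>\<rho>\<in>C. w \<mu> \<rho> * e0 \<rho>)"
      using True by (simp add: weight_of_def e1_def algebra_simps sum_subtractf sum_distrib_left)
    then show ?thesis using weight_expo[OF k(2) True] True unfolding e0(2)[symmetric]
      by (simp add: weight_of_def)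
  next
    case False
    then show ?thesis unfolding e0(2)[symmetric] by (simp add: weight_of_def)
  qed
  then have m1: "mon e1 \<in> laurent S (\<lambda>\<mu>. - (int k * \<psi> \<mu>))"
    unfolding laurent_def using e1S by (intro lin_span_base imageI) auto
  have CS: "S \<subseteq> C" by (rule A_sub[OF S])
  \<comment> \<open>The weights of the three factors are \<open>\<psi>\<close>, \<open>k - 1\<close>
    times \<open>\<psi>\<close> and \<open>- k\<close> times \<open>\<psi>\<close>. Taking for
    \<open>G\<close> the components of \<open>g\<close> and \<open>h\<close> gives \<open>f1\<close>
    and \<open>f2\<close> with common remaining factors, so they keep the ratio of the
    components.\<close>
  have inv: "\<exists>f\<in>chart_ring (ray_cone S). \<forall>y\<in>chart_cover S.
      f (quot (ray_cone S) y) = G y * hh \<psi> y ^ (k - 1) * mon e1 y" if G: "G \<in> laurent C \<psi>" for G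
  proof -
    from laurent_power[OF laurent_mono[OF CS hh(1)[of \<psi>]], of "k - 1"] obtain P where
      P: "P \<in> laurent S (\<lambda>\<mu>. int (k - 1) * \<psi> \<mu>)" "\<forall>y\<in>chart_cover S. P y = hh \<psi> y ^ (k - 1)" by blast
    from laurent_mult[OF laurent_mono[OF CS G] P(1)] obtain Q where
      Q: "Q \<in> laurent S (\<lambda>\<mu>. \<psi> \<mu> + int (k - 1) * \<psi> \<mu>)" "\<forall>y\<in>chart_cover S. Q y = G y * P y" by blast
    from laurent_mult[OF Q(1) m1] obtain T where
      T: "T \<in> laurent S (\<lambda>\<mu>. (\<psi> \<mu> + int (k - 1) * \<psi> \<mu>) + - (int k * \<psi> \<mu>))"
        "\<forall>y\<in>chart_cover S. T y = Q y * mon e1 y" by blast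
    have "(\<lambda>\<mu>. (\<psi> \<mu> + int (k - 1) * \<psi> \<mu>) + - (int k * \<psi> \<mu>)) = (\<lambda>_. 0)"
      using k(1) by (auto simp: of_nat_diff algebra_simps)
    then obtain f where "f \<in> chart_ring (ray_cone S)" "\<forall>y\<in>chart_cover S. T y = f (quot (ray_cone S) y)"
      using chart_ring_of_laurent[OF S, of T] T(1) by auto
    then show ?thesis using T(2) Q(2) P(2) by (intro bexI[of _ f]) auto
  qed
  from inv[OF gg(1)] obtain f1 where f1: "f1 \<in> chart_ring (ray_cone S)"
    "\<forall>y\<in>chart_cover S. f1 (quot (ray_cone S) y) = gg \<psi> y * hh \<psi> y ^ (k - 1) * mon e1 y" by blast
  from inv[OF hh(1)] obtain f2 where f2: "f2 \<in> chart_ring (ray_cone S)"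
    "\<forall>y\<in>chart_cover S. f2 (quot (ray_cone S) y) = hh \<psi> y * hh \<psi> y ^ (k - 1) * mon e1 y" by blast
  show ?thesis
  proof (rule that[OF f1(1) f2(1)])
    have "mon e1 x0 \<noteq> 0" unfolding mon_eq_0_iff using e1S x0(1) by (auto simp: chart_cover_def zeros_def)
    then show "f2 (quot (ray_cone S) x0) \<noteq> 0" using f2(2) x0(1) psi(2) by simp
  next
    show "\<forall>y\<in>chart_cover S. \<forall>c. (\<forall>t\<in>tor. g (act t y) = c * h (act t y)) \<longrightarrow>
       f1 (quot (ray_cone S) y) = c * f2 (quot (ray_cone S) y)"
    proof (intro ballI allI impI)
      fix y c assume y: "y \<in> chart_cover S" and eq: "\<forall>t\<in>tor. g (act t y) = c * h (act t y)"
      \<comment> \<open>The relation holds on the whole orbit, so independence of characters splits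
        it into one relation per weight.\<close>
      have "\<forall>\<phi>\<in>?Y. gg \<phi> y - c * hh \<phi> y = 0"
      proof (rule characters_independent[OF Y(1) finite_R Y(2)])
        fix t :: "'r \<Rightarrow> complex" assume "\<forall>\<mu>\<in>R. t \<mu> \<noteq> 0"
        then have t: "t \<in> tor" by (simp add: tor_def)
        show "(\<Sum>\<phi>\<in>?Y. (gg \<phi> y - c * hh \<phi> y) * (\<Prod>\<mu>\<in>R. t \<mu> powi \<phi> \<mu>)) = 0"
          using bspec[OF eq t] unfolding gY[OF t] hY[OF t]
          by (simp add: left_diff_distrib sum_subtractf sum_distrib_left mult.assoc)
    qed
    then have "gg \<psi> y = c * hh \<psi> y" using psi(1) by auto
    then show "f1 (quot (ray_cone S) y) = c * f2 (quot (ray_cone S) y)"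
      using f1(2) f2(2) y by simp
    qed
  next
    show "\<forall>y\<in>chart_cover S. (\<forall>t\<in>tor. h (act t y) = 0) \<longrightarrow> f2 (quot (ray_cone S) y) = 0"
    proof (intro ballI impI)
      fix y assume y: "y \<in> chart_cover S" and eq: "\<forall>t\<in>tor. h (act t y) = 0"
      have "\<forall>\<phi>\<in>?Y. hh \<phi> y = 0"
      proof (rule characters_independent[OF Y(1) finite_R Y(2)])
        fix t :: "'r \<Rightarrow> complex" assume "\<forall>\<mu>\<in>R. t \<mu> \<noteq> 0"
        then have t: "t \<in> tor" by (simp add: tor_def)
        show "(\<Sum>\<phi>\<in>?Y. hh \<phi> y * (\<Prod>\<mu>\<in>R. t \<mu> powi \<phi> \<mu>)) = 0" using bspec[OF eq t] unfolding hY[OF t] .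
    qed
    then show "f2 (quot (ray_cone S) y) = 0" using psi(1) f2(2) y by auto
    qed
  qed
qed

section \<open>Open sets and regular functions on a chart\<close>

lemma chart_point_lift:
  assumes S: "S \<in> A" and B: "B \<subseteq> chart_points (ray_cone S)"
  shows "B = quot (ray_cone S) ` {x \<in> chart_cover S. quot (ray_cone S) x \<in> B}"
proof (intro subset_antisym subsetI)
  fix \<gamma> assume g: "\<gamma> \<in> B"
  then obtain x where "x \<in> chart_cover S" "quot (ray_cone S) x = \<gamma>" using quot_surj[OF S] B by blast
  then show "\<gamma> \<in> quot (ray_cone S) ` {x \<in> chart_cover S. quot (ray_cone S) x \<in> B}" using g by blast
qed auto

text \<open>Where \<open>f2\<close> is nonzero, \<open>h\<close> is nonzero somewhere on the orbit
  above. That point lies over \<open>B\<close>, and the quotient map is constant on orbits.\<close>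

lemma descend_neighbourhood:
  assumes S: "S \<in> A" and B: "B \<subseteq> chart_points (ray_cone S)"
    and gh: "g \<in> polys" "h \<in> polys" and x0: "x0 \<in> chart_cover S" "h x0 \<noteq> 0"
    and sub: "{y \<in> stable. h y \<noteq> 0} \<subseteq> {x \<in> chart_cover S. quot (ray_cone S) x \<in> B}"
  obtains f1 f2 where "f1 \<in> chart_ring (ray_cone S)" "f2 \<in> chart_ring (ray_cone S)"
    "f2 (quot (ray_cone S) x0) \<noteq> 0" "{\<gamma> \<in> chart_points (ray_cone S). f2 \<gamma> \<noteq> 0} \<subseteq> B"
    "\<forall>y\<in>chart_cover S. \<forall>c. (\<forall>t\<in>tor. g (act t y) = c * h (act t y)) \<longrightarrow>
       f1 (quot (ray_cone S) y) = c * f2 (quot (ray_cone S) y)"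
proof -
  obtain f1 f2 where f: "f1 \<in> chart_ring (ray_cone S)" "f2 \<in> chart_ring (ray_cone S)"
    "f2 (quot (ray_cone S) x0) \<noteq> 0"
    and f2: "\<forall>y\<in>chart_cover S. (\<forall>t\<in>tor. h (act t y) = 0) \<longrightarrow> f2 (quot (ray_cone S) y) = 0"
    and f1: "\<forall>y\<in>chart_cover S. \<forall>c. (\<forall>t\<in>tor. g (act t y) = c * h (act t y)) \<longrightarrow>
       f1 (quot (ray_cone S) y) = c * f2 (quot (ray_cone S) y)"
    by (rule descend[OF S gh x0])
  have "\<gamma> \<in> B" if g: "\<gamma> \<in> chart_points (ray_cone S)" "f2 \<gamma> \<noteq> 0" for \<gamma>
  proof (rule ccontr)
    assume nB: "\<gamma> \<notin> B"
    obtain y where y: "y \<in> chart_cover S" "quot (ray_cone S) y = \<gamma>" using quot_surj[OF S g(1)] .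
    have "h (act t y) = 0" if t: "t \<in> tor" for t
    proof (rule ccontr)
      assume nz: "h (act t y) \<noteq> 0"
      have o: "act t y \<in> orbit y" using t by (auto simp: orbit_def)
      then have "act t y \<in> stable" using chart_cover_orbit y(1) chart_cover_stable[OF S] by blast
      then have "quot (ray_cone S) (act t y) \<in> B" using sub nz by blast
      then show False using nB quot_orbit[OF o, of "ray_cone S"] y(2) by simp
    qed
    then show False using f2 y g(2) by blast
  qed
  then have "{\<gamma> \<in> chart_points (ray_cone S). f2 \<gamma> \<noteq> 0} \<subseteq> B" by blast
  from that[OF f this f1] show ?thesis .
qed

text \<open>The chart carries the quotient topology: pulling back a neighbourhood clears
  denominators, and pushing one down is \<open>descend_neighbourhood\<close>.\<close>

lemma openin_chart_iff:
  assumes S: "S \<in> A" and B: "B \<subseteq> chart_points (ray_cone S)"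
  shows "openin (zariski_topology (chart_points (ray_cone S)) (chart_ring (ray_cone S))) B \<longleftrightarrow>
    openin (zariski_topology stable polys) {x \<in> chart_cover S. quot (ray_cone S) x \<in> B}"
    (is "?L \<longleftrightarrow> openin _ ?W")
proof
  interpret chart: function_ring "chart_points (ray_cone S)" "chart_ring (ray_cone S)"
    by (rule chart_function_ring[OF S])
  {
    assume ?L
    show "openin (zariski_topology stable polys) ?W"
      unfolding poly_ring.openin_iff
    proof (intro conjI ballI)
      show "?W \<subseteq> stable" using chart_cover_stable[OF S] by blast
      fix x assume x: "x \<in> ?W"
      with \<open>?L\<close> obtain f where f: "f \<in> chart_ring (ray_cone S)" "f (quot (ray_cone S) x) \<noteq> 0"
        "{\<gamma> \<in> chart_points (ray_cone S). f \<gamma> \<noteq> 0} \<subseteq> B" unfolding chart.openin_iff by blast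
      from laurent_of_chart_ring[OF S f(1)] obtain F where
        F: "F \<in> laurent S (\<lambda>_. 0)" "\<forall>y\<in>chart_cover S. f (quot (ray_cone S) y) = F y" by blast
      from laurent_clear_denominators[OF F(1)] obtain N p where
        p: "p \<in> polys" "\<forall>y\<in>chart_cover S. p y = F y * denom S y ^ N" by blast
      have xS: "x \<in> chart_cover S" "x \<in> aff" using x by (auto simp: chart_cover_def)
      \<comment> \<open>The extra factor \<open>denom S\<close> confines the nonvanishing locus to
        \<open>chart_cover S\<close>, the only place where \<open>p\<close> is controlled.\<close>
      have "p x * denom S x \<noteq> 0"
        using xS f(2) F(2) p(2) denom_nonzero_iff[of x S] by simp
      moreover have "{y \<in> stable. p y * denom S y \<noteq> 0} \<subseteq> ?W"
      proof
        fix y assume "y \<in> {y \<in> stable. p y * denom S y \<noteq> 0}"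
        then have y: "y \<in> aff" "p y \<noteq> 0" "denom S y \<noteq> 0" by (auto simp: stable_def)
        then have yS: "y \<in> chart_cover S" using denom_nonzero_iff by blast
        then have "f (quot (ray_cone S) y) \<noteq> 0" using y(2) p(2) F(2) by auto
        then show "y \<in> ?W" using f(3) quot_chart_points[OF S yS] yS by blast
      qed
      ultimately show "\<exists>f\<in>polys. f x \<noteq> 0 \<and> {y \<in> stable. f y \<noteq> 0} \<subseteq> ?W"
        using polys_mult[OF p(1) polys_denom] by (intro bexI[of _ "\<lambda>y. p y * denom S y"] conjI)
    qed
  }
  assume W: "openin (zariski_topology stable polys) ?W"
  show ?L unfolding chart.openin_iff
  proof (intro conjI B ballI)
    fix \<gamma> assume "\<gamma> \<in> B"
    then obtain x0 where x0: "x0 \<in> ?W" "\<gamma> = quot (ray_cone S) x0" using chart_point_lift[OF S B] by blast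
    with W obtain h where h: "h \<in> polys" "h x0 \<noteq> 0" "{y \<in> stable. h y \<noteq> 0} \<subseteq> ?W"
      unfolding poly_ring.openin_iff by blast
    from x0(1) have xS: "x0 \<in> chart_cover S" by blast
    obtain f where "f \<in> chart_ring (ray_cone S)" "f (quot (ray_cone S) x0) \<noteq> 0"
        "{y \<in> chart_points (ray_cone S). f y \<noteq> 0} \<subseteq> B"
      by (rule descend_neighbourhood[OF S B h(1,1) xS h(2,3)])
    then show "\<exists>f\<in>chart_ring (ray_cone S). f \<gamma> \<noteq> 0 \<and> {y \<in> chart_points (ray_cone S). f y \<noteq> 0} \<subseteq> B"
      unfolding x0(2) by blast
  qed
qed

lemma regular_chart_iff:
  assumes S: "S \<in> A" and B: "B \<subseteq> chart_points (ray_cone S)"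
  shows "regular (affine_toric_variety (ray_cone S)) B F \<longleftrightarrow>
    regular (zariski_space stable polys) {x \<in> chart_cover S. quot (ray_cone S) x \<in> B}
      (F \<circ> quot (ray_cone S))" (is "?L \<longleftrightarrow> regular _ ?W _")
proof
  interpret chart: function_ring "chart_points (ray_cone S)" "chart_ring (ray_cone S)"
    by (rule chart_function_ring[OF S])
  let ?q = "quot (ray_cone S)"
  {
    assume ?L
    show "regular (zariski_space stable polys) ?W (F \<circ> ?q)"
      unfolding poly_ring.regular_iff
    proof (intro conjI ballI)
      show "?W \<subseteq> stable" using chart_cover_stable[OF S] by blast
      fix x assume x: "x \<in> ?W"
      with \<open>?L\<close> obtain g h where gh: "g \<in> chart_ring (ray_cone S)" "h \<in> chart_ring (ray_cone S)"
        "h (?q x) \<noteq> 0" "{\<gamma> \<in> chart_points (ray_cone S). h \<gamma> \<noteq> 0} \<subseteq> B"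
        "\<forall>\<gamma>\<in>chart_points (ray_cone S). h \<gamma> \<noteq> 0 \<longrightarrow> F \<gamma> = g \<gamma> / h \<gamma>"
        unfolding affine_toric_variety_def chart.regular_iff by blast
      have clear: "\<exists>N. \<exists>p\<in>polys. \<forall>y\<in>chart_cover S. p y = f (?q y) * denom S y ^ N"
        if "f \<in> chart_ring (ray_cone S)" for f
      proof -
        from laurent_of_chart_ring[OF S that] obtain F where
          F: "F \<in> laurent S (\<lambda>_. 0)" "\<forall>y\<in>chart_cover S. f (?q y) = F y" by blast
        from laurent_clear_denominators[OF F(1)] show ?thesis using F(2) by auto
      qed
      from clear[OF gh(1)] obtain N p where p: "p \<in> polys" "\<forall>y\<in>chart_cover S. p y = g (?q y) * denom S y ^ N"
        by blast
      from clear[OF gh(2)] obtain M s where s: "s \<in> polys" "\<forall>y\<in>chart_cover S. s y = h (?q y) * denom S y ^ M"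
        by blast
      \<comment> \<open>Crosswise powers of \<open>denom S\<close> balance the exponents
        \<open>N\<close> and \<open>M\<close>; one more factor confines the locus to the
        chart.\<close>
      define P where "P = (\<lambda>y. (p y * denom S y ^ M) * denom S y)"
      define Q where "Q = (\<lambda>y. (s y * denom S y ^ N) * denom S y)"
      have PQ: "P \<in> polys" "Q \<in> polys" unfolding P_def Q_def
        by (intro polys_mult polys_power polys_denom p(1) s(1))+
      have xS: "x \<in> chart_cover S" "x \<in> aff" using x by (auto simp: chart_cover_def)
      have Qx: "Q x \<noteq> 0" unfolding Q_def
        using xS gh(3) s(2) denom_nonzero_iff[of x S] by simp
      have yS: "y \<in> chart_cover S \<and> h (?q y) \<noteq> 0 \<and> denom S y \<noteq> 0" if "y \<in> stable" "Q y \<noteq> 0" for y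
      proof -
        have "y \<in> aff" "denom S y \<noteq> 0" "s y \<noteq> 0" using that by (auto simp: stable_def Q_def)
        moreover from this have "y \<in> chart_cover S" using denom_nonzero_iff by blast
        ultimately show ?thesis using s(2) by auto
      qed
      have sub: "{y \<in> stable. Q y \<noteq> 0} \<subseteq> ?W"
        using yS gh(4) quot_chart_points[OF S] by blast
      have val: "(F \<circ> ?q) y = P y / Q y" if "y \<in> stable" "Q y \<noteq> 0" for y
      proof -
        have y: "y \<in> chart_cover S" "h (?q y) \<noteq> 0" "denom S y \<noteq> 0" using yS[OF that] by auto
        have "F (?q y) = g (?q y) / h (?q y)" using gh(5) quot_chart_points[OF S y(1)] y(2) by blast
        then show ?thesis using p(2) s(2) y by (simp add: P_def Q_def)
      qed
      show "\<exists>g\<in>polys. \<exists>h\<in>polys. h x \<noteq> 0 \<and> {y \<in> stable. h y \<noteq> 0} \<subseteq> ?W \<and>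
          (\<forall>y\<in>stable. h y \<noteq> 0 \<longrightarrow> (F \<circ> ?q) y = g y / h y)"
        by (rule bexI[OF _ PQ(1)], rule bexI[OF _ PQ(2)]) (use Qx sub val in blast)
    qed
  }
  assume W: "regular (zariski_space stable polys) ?W (F \<circ> ?q)"
  show ?L unfolding affine_toric_variety_def chart.regular_iff
  proof (intro conjI B ballI)
    fix \<gamma> assume "\<gamma> \<in> B"
    then obtain x0 where x0: "x0 \<in> ?W" "\<gamma> = ?q x0" using chart_point_lift[OF S B] by blast
    with W obtain g h where gh: "g \<in> polys" "h \<in> polys" "h x0 \<noteq> 0" "{y \<in> stable. h y \<noteq> 0} \<subseteq> ?W"
      and F: "\<forall>y\<in>stable. h y \<noteq> 0 \<longrightarrow> (F \<circ> ?q) y = g y / h y"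
      unfolding poly_ring.regular_iff by blast
    from x0(1) have xS: "x0 \<in> chart_cover S" by blast
    \<comment> \<open>With \<open>g h\<close> over \<open>h h\<close>, the relation that the
      numerator is a constant times the denominator holds along the whole orbit, also where
      \<open>h\<close> vanishes and \<open>g\<close> is not controlled.\<close>
    have gh': "(\<lambda>y. g y * h y) \<in> polys" "(\<lambda>y. h y * h y) \<in> polys" "h x0 * h x0 \<noteq> 0"
      "{y \<in> stable. h y * h y \<noteq> 0} \<subseteq> ?W"
      using gh by (auto intro: polys_mult)
    obtain f1 f2 where f: "f1 \<in> chart_ring (ray_cone S)" "f2 \<in> chart_ring (ray_cone S)" "f2 (?q x0) \<noteq> 0"
      "{\<gamma> \<in> chart_points (ray_cone S). f2 \<gamma> \<noteq> 0} \<subseteq> B"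
      and f12: "\<forall>y\<in>chart_cover S. \<forall>c.
        (\<forall>t\<in>tor. g (act t y) * h (act t y) = c * (h (act t y) * h (act t y))) \<longrightarrow>
        f1 (?q y) = c * f2 (?q y)"
      by (rule descend_neighbourhood[OF S B gh'(1,2) xS gh'(3,4)])
    have val: "F \<delta> = f1 \<delta> / f2 \<delta>" if d: "\<delta> \<in> chart_points (ray_cone S)" "f2 \<delta> \<noteq> 0" for \<delta>
    proof -
      obtain y where y: "y \<in> chart_cover S" "?q y = \<delta>" using quot_surj[OF S d(1)] .
      have "g (act t y) * h (act t y) = F \<delta> * (h (act t y) * h (act t y))" if t: "t \<in> tor" for t
      proof (cases "h (act t y) = 0")
        case False
        have o: "act t y \<in> orbit y" using t by (auto simp: orbit_def)
        then have "act t y \<in> stable" using chart_cover_orbit y(1) chart_cover_stable[OF S] by blast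
        then have "F (?q (act t y)) = g (act t y) / h (act t y)" using F False by simp
        then show ?thesis using False quot_orbit[OF o, of "ray_cone S"] y(2) by simp
      qed simp
      then have "f1 \<delta> = F \<delta> * f2 \<delta>" using f12 y by blast
      then show ?thesis using d(2) by simp
    qed
    show "\<exists>g\<in>chart_ring (ray_cone S). \<exists>h\<in>chart_ring (ray_cone S). h \<gamma> \<noteq> 0 \<and>
        {y \<in> chart_points (ray_cone S). h y \<noteq> 0} \<subseteq> B \<and>
        (\<forall>y\<in>chart_points (ray_cone S). h y \<noteq> 0 \<longrightarrow> F y = g y / h y)"
      unfolding x0(2) by (rule bexI[OF _ f(1)], rule bexI[OF _ f(2)]) (use f(3,4) val in blast)
  qed
qed

end

section \<open>The quotient is the toric variety\<close>

lemma topspace_final_topology: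
  "topspace (final_topology I T q) = (\<Union>i\<in>I. q i ` topspace (T i))" (is "_ = ?U")
proof
  show "topspace (final_topology I T q) \<subseteq> ?U"
    using openin_topspace[of "final_topology I T q"] unfolding openin_final_topology by blast
  have "{x \<in> topspace (T i). q i x \<in> ?U} = topspace (T i)" if "i \<in> I" for i
    using that by blast
  then have "openin (final_topology I T q) ?U" unfolding openin_final_topology by simp
  then show "?U \<subseteq> topspace (final_topology I T q)" by (rule openin_subset)
qed

lemma regular_cong:
  assumes "\<And>x. x \<in> V \<Longrightarrow> F x = F' x"
  shows "regular (zariski_space P R) V F \<longleftrightarrow> regular (zariski_space P R) V F'"
proof -
  have "regular (zariski_space P R) V F'"
    if eq: "\<And>x. x \<in> V \<Longrightarrow> F x = F' x" and reg: "regular (zariski_space P R) V F" for F F'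
    unfolding zariski_space_def select_convs
  proof (intro conjI ballI)
    show "openin (zariski_topology P R) V" using reg by (simp add: zariski_space_def)
    fix x assume "x \<in> V"
    then obtain V' g h where "openin (zariski_topology P R) V'" "x \<in> V'" "V' \<subseteq> V"
      "g \<in> R" "h \<in> R" and val: "\<forall>y\<in>V'. h y \<noteq> 0 \<and> F y = g y / h y"
      using reg unfolding zariski_space_def select_convs by blast
    moreover have "\<forall>y\<in>V'. h y \<noteq> 0 \<and> F' y = g y / h y"
      using val eq \<open>V' \<subseteq> V\<close> by (metis subsetD)
    ultimately show "\<exists>V' g h. openin (zariski_topology P R) V' \<and> x \<in> V' \<and> V' \<subseteq> V \<and>
            g \<in> R \<and> h \<in> R \<and> (\<forall>y\<in>V'. h y \<noteq> 0 \<and> F' y = g y / h y)" by blast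
  qed
  from this[of F F'] this[of F' F] show ?thesis using assms by metis
qed

context cox_data
begin

text \<open>The glued point of an orbit, listed as all its images in charts;
  \<open>glue_class\<close> identifies it with a class of the gluing relation.\<close>

definition orbit_point :: "('c \<Rightarrow> complex) set \<Rightarrow> ((real ^ 'n) set \<times> (real ^ 'n \<Rightarrow> complex)) set" where
  "orbit_point O' = {(ray_cone S, quot (ray_cone S) y) | S y. S \<in> A \<and> y \<in> O' \<and> y \<in> chart_cover S}"

lemma chart_cover_Int:
  "x \<in> chart_cover S \<Longrightarrow> x \<in> chart_cover S' \<Longrightarrow> x \<in> chart_cover (S \<inter> S')"
  by (auto simp: chart_cover_def)

lemma quot_restrict:
  assumes "S' \<subseteq> S" "m \<in> dual_monoid (ray_cone S)"
  shows "quot (ray_cone S') x m = quot (ray_cone S) x m"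
  using ray_cone_mono[OF assms(1)] assms(2) by (auto simp: quot_def dual_monoid_def)

text \<open>Both inclusions pass through the chart of \<open>S \<inter> S'\<close>: a compatible
  point \<open>\<epsilon>\<close> there lifts to some \<open>z\<close>, which lies in the orbit of
  \<open>x\<close> because fibres over the chart of \<open>S\<close> are orbits; conversely the
  image of a representative in both covers is the witness.\<close>

lemma glue_class:
  assumes S: "S \<in> A" and x: "x \<in> chart_cover S"
  shows "glue (ray_cone ` A) `` {(ray_cone S, quot (ray_cone S) x)} = orbit_point (orbit x)"
proof (intro subset_antisym subsetI)
  fix p assume "p \<in> glue (ray_cone ` A) `` {(ray_cone S, quot (ray_cone S) x)}"
  then obtain S' \<delta> \<epsilon> where S': "S' \<in> A" "p = (ray_cone S', \<delta>)"
    and d: "\<delta> \<in> chart_points (ray_cone S')" "\<epsilon> \<in> chart_points (ray_cone S \<inter> ray_cone S')"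
    and e: "\<forall>m\<in>dual_monoid (ray_cone S). quot (ray_cone S) x m = \<epsilon> m"
      "\<forall>m\<in>dual_monoid (ray_cone S'). \<delta> m = \<epsilon> m"
    unfolding glue_def by blast
  have SS: "S \<inter> S' \<in> A" using A_down[OF S] by blast
  obtain z where z: "z \<in> chart_cover (S \<inter> S')" "quot (ray_cone (S \<inter> S')) z = \<epsilon>"
    using quot_surj[OF SS, of \<epsilon>] d(2) unfolding ray_cone_Int[OF S S'(1)] by blast
  have zS: "z \<in> chart_cover S" "z \<in> chart_cover S'" using z(1) by (auto simp: chart_cover_def)
  have "quot (ray_cone S) x = quot (ray_cone S) z"
  proof
    fix m
    show "quot (ray_cone S) x m = quot (ray_cone S) z m"
    proof (cases "m \<in> dual_monoid (ray_cone S)")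
      case True
      then show ?thesis using e(1) quot_restrict[of "S \<inter> S'" S m z] z(2) by simp
    qed (simp add: quot_def)
  qed
  then have "z \<in> orbit x" by (rule quot_eq_imp_orbit[OF S x zS(1)])
  moreover have "\<delta> = quot (ray_cone S') z"
  proof
    fix m
    show "\<delta> m = quot (ray_cone S') z m"
    proof (cases "m \<in> dual_monoid (ray_cone S')")
      case True
      then show ?thesis using e(2) quot_restrict[of "S \<inter> S'" S' m z] z(2) by simp
    next
      case False
      then show ?thesis using d(1) by (simp add: quot_def chart_points_def)
    qed
  qed
  ultimately show "p \<in> orbit_point (orbit x)" unfolding orbit_point_def using S' zS(2) by blast
next
  fix p assume "p \<in> orbit_point (orbit x)"
  then obtain S' y where S': "S' \<in> A" "y \<in> orbit x" "y \<in> chart_cover S'"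
    and p: "p = (ray_cone S', quot (ray_cone S') y)" unfolding orbit_point_def by blast
  have SS: "S \<inter> S' \<in> A" using A_down[OF S] by blast
  have yS: "y \<in> chart_cover (S \<inter> S')"
    using chart_cover_Int chart_cover_orbit[OF S'(2) x] S'(3) by blast
  have "quot (ray_cone (S \<inter> S')) y \<in> chart_points (ray_cone S \<inter> ray_cone S')"
    unfolding ray_cone_Int[OF S S'(1)] by (rule quot_chart_points[OF SS yS])
  moreover have "\<forall>m\<in>dual_monoid (ray_cone S). quot (ray_cone S) x m = quot (ray_cone (S \<inter> S')) y m"
    using quot_restrict[of "S \<inter> S'" S _ y] quot_orbit[OF S'(2), of "ray_cone S"] by simp
  moreover have "\<forall>m\<in>dual_monoid (ray_cone S'). quot (ray_cone S') y m = quot (ray_cone (S \<inter> S')) y m"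
    using quot_restrict[of "S \<inter> S'" S' _ y] by simp
  ultimately have "((ray_cone S, quot (ray_cone S) x), (ray_cone S', quot (ray_cone S') y)) \<in> glue (ray_cone ` A)"
    unfolding glue_def using S S' quot_chart_points[OF S x] quot_chart_points[OF S'(1,3)] by blast
  then show "p \<in> glue (ray_cone ` A) `` {(ray_cone S, quot (ray_cone S) x)}" using p by blast
qed

text \<open>Both orbits are compared in the chart of the zero set of \<open>x\<close>, the index set
  being recovered from the cone by \<open>ray_cone_inj\<close>.\<close>

lemma inj_on_orbit_point: "inj_on orbit_point (orbit ` stable)"
proof (rule inj_onI, clarify)
  fix x x' assume x: "x \<in> stable" "x' \<in> stable" and eq: "orbit_point (orbit x) = orbit_point (orbit x')"
  let ?Z = "zeros x"
  have Z: "?Z \<in> A" "x \<in> chart_cover ?Z" using stable_chart_cover[OF x(1)] by auto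
  then have "(ray_cone ?Z, quot (ray_cone ?Z) x) \<in> orbit_point (orbit x)"
    unfolding orbit_point_def using orbit_refl by blast
  then obtain S y where y: "S \<in> A" "y \<in> orbit x'" "y \<in> chart_cover S"
    "ray_cone ?Z = ray_cone S" "quot (ray_cone ?Z) x = quot (ray_cone S) y"
    unfolding eq unfolding orbit_point_def by blast
  have SZ: "S = ?Z" by (rule ray_cone_inj[OF y(1) Z(1) y(4)[symmetric]])
  have "y \<in> orbit x" by (rule quot_eq_imp_orbit[OF Z(1,2) y(3,5)[unfolded SZ]])
  then show "orbit x = orbit x'" using orbit_eq y(2) by metis
qed

lemma openin_chart_cover:
  assumes "S \<in> A"
  shows "openin (zariski_topology stable polys) (chart_cover S)"
proof -
  have "chart_cover S = {y \<in> stable. denom S y \<noteq> 0}"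
    using chart_cover_stable[OF assms] denom_nonzero_iff by (auto simp: stable_def)
  then show ?thesis
    unfolding poly_ring.openin_iff using polys_denom[of S] by auto
qed

lemma stable_eq: "stable = (\<Union>S\<in>A. chart_cover S)"
  using chart_cover_stable stable_chart_cover by blast

lemma openin_stable_iff:
  assumes "U \<subseteq> stable"
  shows "openin (zariski_topology stable polys) U \<longleftrightarrow>
    (\<forall>S\<in>A. openin (zariski_topology stable polys) (U \<inter> chart_cover S))"
proof
  assume "\<forall>S\<in>A. openin (zariski_topology stable polys) (U \<inter> chart_cover S)"
  then have "openin (zariski_topology stable polys) (\<Union>S\<in>A. U \<inter> chart_cover S)" by blast
  moreover have "(\<Union>S\<in>A. U \<inter> chart_cover S) = U" using assms stable_eq by blast
  ultimately show "openin (zariski_topology stable polys) U" by simp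
qed (use openin_chart_cover openin_Int in blast)

lemma regular_stable_iff:
  assumes U: "U \<subseteq> stable"
  shows "regular (zariski_space stable polys) U F \<longleftrightarrow>
    (\<forall>S\<in>A. regular (zariski_space stable polys) (U \<inter> chart_cover S) F)"
    (is "?L \<longleftrightarrow> ?R")
proof
  let ?T = "zariski_topology stable polys"
  note reg = zariski_space_def select_convs
  {
    assume L: ?L
    show ?R
    proof
      fix S assume S: "S \<in> A"
      show "regular (zariski_space stable polys) (U \<inter> chart_cover S) F"
        unfolding reg
      proof (intro conjI ballI)
        show "openin ?T (U \<inter> chart_cover S)"
          using L openin_chart_cover[OF S] openin_Int unfolding reg by blast
        fix x assume x: "x \<in> U \<inter> chart_cover S"
        then obtain V g h where V: "openin ?T V" "x \<in> V" "V \<subseteq> U" "g \<in> polys" "h \<in> polys"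
          "\<forall>y\<in>V. h y \<noteq> 0 \<and> F y = g y / h y" using L unfolding reg by blast
        have "openin ?T (V \<inter> chart_cover S)" using V(1) openin_chart_cover[OF S] by (rule openin_Int)
        moreover have "x \<in> V \<inter> chart_cover S" using V(2) x by blast
        moreover have "V \<inter> chart_cover S \<subseteq> U \<inter> chart_cover S" using V(3) by blast
        moreover have "\<forall>y\<in>V \<inter> chart_cover S. h y \<noteq> 0 \<and> F y = g y / h y" using V(6) by blast
        ultimately show "\<exists>V' g h. openin ?T V' \<and> x \<in> V' \<and> V' \<subseteq> U \<inter> chart_cover S \<and>
          g \<in> polys \<and> h \<in> polys \<and> (\<forall>y\<in>V'. h y \<noteq> 0 \<and> F y = g y / h y)"
          using V(4,5) by (intro exI[of _ "V \<inter> chart_cover S"] exI[of _ g] exI[of _ h] conjI)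
      qed
    qed
  }
  assume R: ?R
  show ?L
    unfolding reg
  proof (intro conjI ballI)
    show "openin ?T U" unfolding openin_stable_iff[OF U] using R unfolding reg by blast
    fix x assume x: "x \<in> U"
    then obtain S where S: "S \<in> A" "x \<in> chart_cover S" using U stable_eq by blast
    from bspec[OF R S(1)] obtain V g h where V: "openin ?T V" "x \<in> V" "V \<subseteq> U \<inter> chart_cover S"
      "g \<in> polys" "h \<in> polys" "\<forall>y\<in>V. h y \<noteq> 0 \<and> F y = g y / h y" using x S(2) unfolding reg by blast
    moreover have "V \<subseteq> U" using V(3) by blast
    ultimately show "\<exists>V' g h. openin ?T V' \<and> x \<in> V' \<and> V' \<subseteq> U \<and>
          g \<in> polys \<and> h \<in> polys \<and> (\<forall>y\<in>V'. h y \<noteq> 0 \<and> F y = g y / h y)" by blast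
  qed
qed

definition orbit_space :: "('c \<Rightarrow> complex) set space_with_functions" where
  "orbit_space = final_space {()} (\<lambda>_. zariski_space stable polys) (\<lambda>_. orbit)"

text \<open>Both sides carry final structures, so openness and regularity are tested on
  \<open>stable\<close> in either case: for the toric variety this happens chart by chart, and the
  covers of the charts are open in \<open>stable\<close> and exhaust it.\<close>

theorem orbit_space_isomorphic: "isomorphic_spaces orbit_space (toric_variety (ray_cone ` A))"
proof -
  let ?\<Delta> = "ray_cone ` A"
  let ?Y = "toric_variety ?\<Delta>"
  let ?T = "zariski_topology stable polys"
  let ?cls = "\<lambda>\<sigma> \<gamma>. glue ?\<Delta> `` {(\<sigma>, \<gamma>)}"
  let ?pre = "\<lambda>V. {x \<in> stable. orbit_point (orbit x) \<in> V}"
  let ?chart = "\<lambda>S V. {\<gamma> \<in> chart_points (ray_cone S). ?cls (ray_cone S) \<gamma> \<in> V}"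
  have topX: "topspace (zariski orbit_space) = orbit ` stable"
    by (simp add: orbit_space_def final_space_def zariski_space_def topspace_final_topology
        poly_ring.topspace_zariski)
  have openX: "openin (zariski orbit_space) V \<longleftrightarrow> V \<subseteq> orbit ` stable \<and> openin ?T {x \<in> stable. orbit x \<in> V}" for V
    by (simp add: orbit_space_def final_space_def zariski_space_def openin_final_topology
        poly_ring.topspace_zariski)
  have regX: "regular orbit_space V f \<longleftrightarrow> openin (zariski orbit_space) V \<and>
      regular (zariski_space stable polys) {x \<in> stable. orbit x \<in> V} (f \<circ> orbit)" for V f
    by (simp add: orbit_space_def final_space_def zariski_space_def poly_ring.topspace_zariski)
  have topchart: "topspace (zariski (affine_toric_variety (ray_cone S))) = chart_points (ray_cone S)"
    if "S \<in> A" for S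
    using function_ring.topspace_zariski[OF chart_function_ring[OF that]]
    by (simp add: affine_toric_variety_def zariski_space_def)
  have cls: "?cls (ray_cone S) (quot (ray_cone S) x) = orbit_point (orbit x)"
    if "S \<in> A" "x \<in> chart_cover S" for S x using glue_class[OF that] .
  have chart: "{x \<in> chart_cover S. quot (ray_cone S) x \<in> ?chart S V} = ?pre V \<inter> chart_cover S"
    if S: "S \<in> A" for S V
    using cls[OF S] quot_chart_points[OF S] chart_cover_stable[OF S] by auto
  have image: "?cls (ray_cone S) ` chart_points (ray_cone S) = (\<lambda>x. orbit_point (orbit x)) ` chart_cover S"
    if S: "S \<in> A" for S
  proof -
    have "chart_points (ray_cone S) = quot (ray_cone S) ` chart_cover S"
      using quot_surj[OF S] quot_chart_points[OF S] by blast
    then show ?thesis using cls[OF S] by (auto simp: image_image)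
  qed
  have topY: "topspace (zariski ?Y) = (\<lambda>x. orbit_point (orbit x)) ` stable"
  proof -
    have "topspace (zariski ?Y) = (\<Union>S\<in>A. ?cls (ray_cone S) ` chart_points (ray_cone S))"
      by (simp add: toric_variety_def final_space_def topspace_final_topology topchart)
    also have "\<dots> = (\<Union>S\<in>A. (\<lambda>x. orbit_point (orbit x)) ` chart_cover S)" using image by simp
    also have "\<dots> = (\<lambda>x. orbit_point (orbit x)) ` stable" unfolding stable_eq by blast
    finally show ?thesis .
  qed
  have openY: "openin (zariski ?Y) V \<longleftrightarrow> V \<subseteq> topspace (zariski ?Y) \<and> openin ?T (?pre V)" for V
  proof -
    have "openin (zariski ?Y) V \<longleftrightarrow> V \<subseteq> topspace (zariski ?Y) \<and>
      (\<forall>S\<in>A. openin (zariski (affine_toric_variety (ray_cone S))) (?chart S V))"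
      by (simp add: toric_variety_def final_space_def topspace_final_topology openin_final_topology topchart)
    also have "\<dots> \<longleftrightarrow> V \<subseteq> topspace (zariski ?Y) \<and> (\<forall>S\<in>A. openin ?T (?pre V \<inter> chart_cover S))"
    proof -
      have "openin (zariski (affine_toric_variety (ray_cone S))) (?chart S V) \<longleftrightarrow>
        openin ?T (?pre V \<inter> chart_cover S)" if S: "S \<in> A" for S
        unfolding chart[OF S, symmetric]
        using openin_chart_iff[OF S, of "?chart S V"] by (simp add: affine_toric_variety_def zariski_space_def)
      then show ?thesis by simp
    qed
    also have "\<dots> \<longleftrightarrow> V \<subseteq> topspace (zariski ?Y) \<and> openin ?T (?pre V)"
      using openin_stable_iff[of "?pre V"] by simp
    finally show ?thesis .
  qed
  have regY: "regular ?Y V f \<longleftrightarrow> openin (zariski ?Y) V \<and>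
      regular (zariski_space stable polys) (?pre V) (f \<circ> orbit_point \<circ> orbit)" for V f
  proof -
    have "regular ?Y V f \<longleftrightarrow> openin (zariski ?Y) V \<and>
      (\<forall>S\<in>A. regular (affine_toric_variety (ray_cone S)) (?chart S V) (f \<circ> ?cls (ray_cone S)))"
      by (simp add: toric_variety_def final_space_def topchart)
    also have "\<dots> \<longleftrightarrow> openin (zariski ?Y) V \<and> (\<forall>S\<in>A. regular (zariski_space stable polys)
        (?pre V \<inter> chart_cover S) (f \<circ> orbit_point \<circ> orbit))"
    proof -
      have "regular (affine_toric_variety (ray_cone S)) (?chart S V) (f \<circ> ?cls (ray_cone S)) \<longleftrightarrow>
        regular (zariski_space stable polys) (?pre V \<inter> chart_cover S) (f \<circ> orbit_point \<circ> orbit)"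
        if S: "S \<in> A" for S
      proof -
        have "regular (affine_toric_variety (ray_cone S)) (?chart S V) (f \<circ> ?cls (ray_cone S)) \<longleftrightarrow>
          regular (zariski_space stable polys) (?pre V \<inter> chart_cover S)
            (f \<circ> ?cls (ray_cone S) \<circ> quot (ray_cone S))"
          unfolding chart[OF S, symmetric] by (rule regular_chart_iff[OF S]) blast
        also have "\<dots> \<longleftrightarrow> regular (zariski_space stable polys) (?pre V \<inter> chart_cover S) (f \<circ> orbit_point \<circ> orbit)"
          by (rule regular_cong) (simp add: cls[OF S])
        finally show ?thesis .
      qed
      then show ?thesis by simp
    qed
    also have "\<dots> \<longleftrightarrow> openin (zariski ?Y) V \<and>
      regular (zariski_space stable polys) (?pre V) (f \<circ> orbit_point \<circ> orbit)"
      using regular_stable_iff[of "?pre V" "f \<circ> orbit_point \<circ> orbit"] by simp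
    finally show ?thesis .
  qed
  have pre: "{x \<in> stable. orbit x \<in> {O' \<in> orbit ` stable. orbit_point O' \<in> V}} = ?pre V" for V by blast
  have openXY: "openin (zariski orbit_space) {O' \<in> orbit ` stable. orbit_point O' \<in> V} \<longleftrightarrow> openin ?T (?pre V)" for V
    unfolding openX pre by blast
  show ?thesis unfolding isomorphic_spaces_def
  proof (intro exI[of _ orbit_point] conjI allI impI)
    show "homeomorphic_map (zariski orbit_space) (zariski ?Y) orbit_point"
      unfolding homeomorphic_map_def quotient_map_def topX
    proof (intro conjI inj_on_orbit_point allI impI)
      show "orbit_point ` orbit ` stable = topspace (zariski ?Y)" unfolding topY by (simp add: image_image)
      fix V assume "V \<subseteq> topspace (zariski ?Y)"
      then show "openin (zariski orbit_space) {x \<in> orbit ` stable. orbit_point x \<in> V} \<longleftrightarrow> openin (zariski ?Y) V"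
        using openXY[of V] openY[of V] by simp
    qed
    fix V f assume V: "openin (zariski ?Y) V"
    then have "openin ?T (?pre V)" using openY by blast
    then show "regular ?Y V f \<longleftrightarrow> regular orbit_space
        {x \<in> topspace (zariski orbit_space). orbit_point x \<in> V} (f \<circ> orbit_point)"
      unfolding regY regX topX openXY pre using V by simp
  qed
qed


section \<open>Compactness in the Euclidean topology\<close>

text \<open>By completeness of the fan, the following compact sets together meet every orbit.\<close>

definition unit_box :: "'c set \<Rightarrow> ('c \<Rightarrow> complex) set" where
  "unit_box S = Pi\<^sub>E UNIV (\<lambda>\<rho>. if \<rho> \<notin> C then {0} else if \<rho> \<in> S then cball 0 1 else sphere 0 1)"

lemma compact_unit_box: "compact (unit_box S)"
proof -
  have "compactin (product_topology (\<lambda>_. euclidean) UNIV) (unit_box S)"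
    unfolding unit_box_def compactin_PiE by auto
  then show ?thesis by (simp add: euclidean_product_topology)
qed

lemma unit_box_stable: "S \<in> A \<Longrightarrow> unit_box S \<subseteq> stable"
proof
  fix x assume S: "S \<in> A" and x: "x \<in> unit_box S"
  have x': "x \<rho> \<in> (if \<rho> \<notin> C then {0} else if \<rho> \<in> S then cball 0 1 else sphere 0 1)" for \<rho>
    using x by (simp add: unit_box_def PiE_def Pi_def)
  have "x \<rho> = 0" if "\<rho> \<notin> C" for \<rho> using x'[of \<rho>] that by simp
  then have "x \<in> aff" by (simp add: aff_def)
  moreover have "zeros x \<subseteq> S"
  proof
    fix \<rho> assume "\<rho> \<in> zeros x"
    then show "\<rho> \<in> S" using x'[of \<rho>] by (auto simp: zeros_def split: if_splits)
  qed
  ultimately show "x \<in> stable" using A_down[OF S] by (simp add: stable_def)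
qed

text \<open>Completeness of the star of the cone of \<open>Z\<close>: the cone containing \<open>y + N \<Sum>\<^sub>Z v\<close> for large \<open>N\<close>
  has \<open>Z\<close> among its rays.\<close>

lemma cover_star:
  assumes Z: "Z \<in> A"
  obtains N c where "\<forall>\<rho>\<in>C. 0 \<le> c \<rho>" "{\<rho> \<in> C. c \<rho> \<noteq> 0} \<in> A" "Z \<subseteq> {\<rho> \<in> C. c \<rho> \<noteq> 0}"
    "(\<Sum>\<rho>\<in>C. c \<rho> *\<^sub>R v \<rho>) = y + real N *\<^sub>R (\<Sum>\<rho>\<in>Z. v \<rho>)"
proof -
  define z where "z = (\<Sum>\<rho>\<in>Z. v \<rho>)"
  have ZC: "Z \<subseteq> C" by (rule A_sub[OF Z])
  have "\<forall>N. \<exists>c. (\<forall>\<rho>\<in>C. 0 \<le> c \<rho>) \<and> {\<rho> \<in> C. c \<rho> \<noteq> 0} \<in> A \<and> (\<Sum>\<rho>\<in>C. c \<rho> *\<^sub>R v \<rho>) = y + real N *\<^sub>R z"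
    using cover by blast
  from choice[OF this] obtain c where c': "\<forall>N. (\<forall>\<rho>\<in>C. 0 \<le> c N \<rho>) \<and> {\<rho> \<in> C. c N \<rho> \<noteq> 0} \<in> A \<and>
    (\<Sum>\<rho>\<in>C. c N \<rho> *\<^sub>R v \<rho>) = y + real N *\<^sub>R z" by (rule exE)
  have c: "\<forall>\<rho>\<in>C. 0 \<le> c N \<rho>" "{\<rho> \<in> C. c N \<rho> \<noteq> 0} \<in> A"
    "(\<Sum>\<rho>\<in>C. c N \<rho> *\<^sub>R v \<rho>) = y + real N *\<^sub>R z" for N using spec[OF c', of N] by simp_all
  define supp where "supp N = {\<rho> \<in> C. c N \<rho> \<noteq> 0}" for N
  \<comment> \<open>Only finitely many supports occur, so one of them serves infinitely many
    \<open>N\<close>.\<close>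
  have "finite (range supp)"
    by (rule finite_subset[of _ "Pow C"]) (use finite_C in \<open>auto simp: supp_def\<close>)
  then obtain N0 where inf: "infinite {N \<in> UNIV. supp N = supp N0}"
    using pigeonhole_infinite[of "UNIV :: nat set" supp] infinite_UNIV_nat by blast
  then obtain r :: "nat \<Rightarrow> nat" where r: "strict_mono r" "\<forall>n. r n \<in> {N \<in> UNIV. supp N = supp N0}"
    using infinite_enumerate by blast
  have S: "supp N0 \<in> A" "supp N0 \<subseteq> C" using c(2)[of N0] by (auto simp: supp_def)
  have mem: "inverse (real (Suc (r n))) *\<^sub>R (y + real (r n) *\<^sub>R z) \<in> ray_cone (supp N0)" for n
  proof -
    have "y + real (r n) *\<^sub>R z \<in> ray_cone (supp N0)"
      unfolding ray_cone_iff[OF S(2)]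
      using c(1)[of "r n"] c(3)[of "r n"] r(2) by (intro exI[of _ "c (r n)"]) (auto simp: supp_def)
    then show ?thesis unfolding ray_cone_def by (intro convex_cone_hull_mul) auto
  qed
  \<comment> \<open>Scaling makes \<open>y\<close> negligible; the limit \<open>z\<close> stays in
    the closed cone of the common support, and its only representation has coefficient 1 on
    \<open>Z\<close>.\<close>
  have lim: "(\<lambda>n. inverse (real (Suc n)) *\<^sub>R (y + real n *\<^sub>R z)) \<longlonglongrightarrow> z"
  proof -
    have "(\<lambda>n. inverse (real (Suc n)) *\<^sub>R (y - z) + z) \<longlonglongrightarrow> 0 *\<^sub>R (y - z) + z"
      by (intro tendsto_intros LIMSEQ_inverse_real_of_nat)
    moreover have "inverse (real (Suc n)) *\<^sub>R (y - z) + z = inverse (real (Suc n)) *\<^sub>R (y + real n *\<^sub>R z)" for n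
    proof -
      have "z = inverse (real (Suc n)) *\<^sub>R (real (Suc n) *\<^sub>R z)" by simp
      then have "inverse (real (Suc n)) *\<^sub>R (y - z) + z
          = inverse (real (Suc n)) *\<^sub>R ((y - z) + real (Suc n) *\<^sub>R z)"
        by (metis scaleR_right_distrib)
      then show ?thesis by (simp add: scaleR_add_left algebra_simps)
    qed
    ultimately show ?thesis by simp
  qed
  have "closed (ray_cone (supp N0))"
    unfolding ray_cone_def using S(2) finite_C finite_subset by (blast intro: closed_convex_cone_hull)
  then have "z \<in> ray_cone (supp N0)"
    using closed_sequentially[of "ray_cone (supp N0)" "\<lambda>n. inverse (real (Suc (r n))) *\<^sub>R (y + real (r n) *\<^sub>R z)" z]
      mem LIMSEQ_subseq_LIMSEQ[OF lim r(1)] by (simp add: o_def)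
  then obtain b where b: "\<forall>\<rho>\<in>C. 0 \<le> b \<rho>" "{\<rho> \<in> C. b \<rho> \<noteq> 0} \<subseteq> supp N0" "z = (\<Sum>\<rho>\<in>C. b \<rho> *\<^sub>R v \<rho>)"
    using ray_coneE[OF _ S(2)] by blast
  have "b \<rho> = (if \<rho> \<in> Z then 1 else 0)" if "\<rho> \<in> C" for \<rho>
  proof (rule unique[OF b(1) A_down[OF S(1) b(2)] _ _ _ that])
    show "{\<rho> \<in> C. (if \<rho> \<in> Z then 1 else 0) \<noteq> (0::real)} \<in> A" by (rule A_down[OF Z]) auto
    have "(\<Sum>\<rho>\<in>C. (if \<rho> \<in> Z then 1 else 0) *\<^sub>R v \<rho>) = z"
      unfolding z_def using ZC finite_C by (intro sum.mono_neutral_cong_right) auto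
    then show "(\<Sum>\<rho>\<in>C. b \<rho> *\<^sub>R v \<rho>) = (\<Sum>\<rho>\<in>C. (if \<rho> \<in> Z then 1 else 0) *\<^sub>R v \<rho>)" using b(3) by simp
  qed auto
  then have "Z \<subseteq> supp N0" using b(2) ZC by fastforce
  then show ?thesis using that[of "c N0" N0] c[of N0] by (simp add: supp_def z_def)
qed

text \<open>Nonzero moduli \<open>exp (- X)\<close> are replaced by \<open>exp (- c)\<close> with
  phases kept. Invariant monomials do not change: the combinations of rays with coefficients
  \<open>X\<close> and \<open>c\<close> differ by a multiple of the sum over \<open>Z\<close>, to
  which the relevant \<open>m\<close> are orthogonal. As \<open>c\<close> is nonnegative the new
  point lies in a box, and vanishing coordinates fall in its disc part because \<open>c\<close> is
  nonzero on \<open>Z\<close>.\<close>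

lemma unit_box_meets_orbit:
  assumes x: "x \<in> stable"
  obtains S x' where "S \<in> A" "x' \<in> unit_box S" "x' \<in> orbit x"
proof -
  define Z where "Z = zeros x"
  have Z: "Z \<in> A" "Z \<subseteq> C" and xa: "x \<in> aff" using x by (auto simp: Z_def zeros_def stable_def)
  define X where "X \<rho> = (if \<rho> \<in> Z then 0 else - ln (cmod (x \<rho>)))" for \<rho>
  obtain N c where c: "\<forall>\<rho>\<in>C. 0 \<le> c \<rho>" "{\<rho> \<in> C. c \<rho> \<noteq> 0} \<in> A" "Z \<subseteq> {\<rho> \<in> C. c \<rho> \<noteq> 0}"
    "(\<Sum>\<rho>\<in>C. c \<rho> *\<^sub>R v \<rho>) = (\<Sum>\<rho>\<in>C. X \<rho> *\<^sub>R v \<rho>) + real N *\<^sub>R (\<Sum>\<rho>\<in>Z. v \<rho>)"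
    by (rule cover_star[OF Z(1)])
  let ?S = "{\<rho> \<in> C. c \<rho> \<noteq> 0}"
  define x' where "x' \<rho> = (if \<rho> \<in> C - Z then x \<rho> * of_real (exp (X \<rho> - c \<rho>)) else 0)" for \<rho>
  have nz: "x \<rho> \<noteq> 0" if "\<rho> \<in> C - Z" for \<rho> using that by (auto simp: Z_def zeros_def)
  have norm_x': "cmod (x' \<rho>) = exp (- c \<rho>)" if "\<rho> \<in> C - Z" for \<rho>
  proof -
    have "exp (X \<rho> - c \<rho>) = exp (- c \<rho>) / cmod (x \<rho>)"
      using that nz[OF that] by (simp add: X_def exp_diff exp_minus field_simps)
    then show ?thesis using that nz[OF that] by (simp add: x'_def norm_mult norm_divide)
  qed
  show ?thesis
  proof (rule that[OF c(2)])
    have "x' \<rho> \<in> (if \<rho> \<notin> C then {0} else if \<rho> \<in> ?S then cball 0 1 else sphere 0 1)" for \<rho>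
    proof (cases "\<rho> \<in> C - Z")
      case True
      then show ?thesis using norm_x'[OF True] c(1) by simp
    next
      case False
      then show ?thesis using c(3) by (auto simp: x'_def)
    qed
    then show "x' \<in> unit_box ?S" by (simp add: unit_box_def PiE_def)
    show "x' \<in> orbit x"
    proof (rule orbit_eqI[OF xa])
      show "x' \<in> aff" by (simp add: aff_def x'_def)
      show "zeros x' = zeros x" using nz Z(2) by (auto simp: zeros_def x'_def Z_def)
      fix m assume m: "m \<in> int_lattice" "\<And>\<rho>. \<rho> \<in> zeros x \<Longrightarrow> m \<bullet> v \<rho> = 0"
      have "mon (expo m) x' = (\<Prod>\<rho>\<in>C. x \<rho> powi expo m \<rho> * of_real (exp ((X \<rho> - c \<rho>) * (m \<bullet> v \<rho>))))"
        unfolding mon_def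
      proof (rule prod.cong)
        fix \<rho> assume r: "\<rho> \<in> C"
        show "x' \<rho> powi expo m \<rho> = x \<rho> powi expo m \<rho> * of_real (exp ((X \<rho> - c \<rho>) * (m \<bullet> v \<rho>)))"
        proof (cases "\<rho> \<in> Z")
          case True
          then have "m \<bullet> v \<rho> = 0" using m(2) by (simp add: Z_def)
          then show ?thesis by (simp add: expo_def)
        next
          case False
          have "exp (X \<rho> - c \<rho>) powi expo m \<rho> = exp ((X \<rho> - c \<rho>) * (m \<bullet> v \<rho>))"
            using of_int_expo[OF m(1) r] by (simp add: exp_power_int mult.commute)
          then show ?thesis using False r
            by (simp add: x'_def power_int_mult_distrib flip: of_real_power_int)
        qed
      qed simp
      also have "\<dots> = mon (expo m) x * of_real (exp (\<Sum>\<rho>\<in>C. (X \<rho> - c \<rho>) * (m \<bullet> v \<rho>)))"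
        by (simp add: prod.distrib mon_def exp_sum finite_C)
      also have "(\<Sum>\<rho>\<in>C. (X \<rho> - c \<rho>) * (m \<bullet> v \<rho>)) = 0"
      proof -
        have "(\<Sum>\<rho>\<in>C. (X \<rho> - c \<rho>) * (m \<bullet> v \<rho>)) = m \<bullet> ((\<Sum>\<rho>\<in>C. X \<rho> *\<^sub>R v \<rho>) - (\<Sum>\<rho>\<in>C. c \<rho> *\<^sub>R v \<rho>))"
          by (simp add: inner_diff_right inner_sum_right left_diff_distrib sum_subtractf)
        also have "\<dots> = - real N * (\<Sum>\<rho>\<in>Z. m \<bullet> v \<rho>)"
          unfolding c(4) by (simp add: inner_sum_right)
        also have "\<dots> = 0" using m(2) by (simp add: Z_def)
        finally show ?thesis .
      qed
      finally show "mon (expo m) x = mon (expo m) x'" by simp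
    qed
  qed
qed

theorem orbit_space_compact:
  "compact_space (final_topology {()} (\<lambda>_. top_of_set stable) (\<lambda>_. orbit))"
proof -
  let ?Q = "final_topology {()} (\<lambda>_. top_of_set stable) (\<lambda>_. orbit)"
  have top: "topspace ?Q = orbit ` stable" by (simp add: topspace_final_topology)
  have cont: "continuous_map (top_of_set stable) ?Q orbit"
    unfolding continuous_map_def top by (auto simp: openin_final_topology)
  have "compactin ?Q (orbit ` unit_box S)" if "S \<in> A" for S
    using compact_unit_box unit_box_stable[OF that]
    by (intro image_compactin[OF _ cont]) (simp add: compactin_subtopology)
  moreover have "finite A"
    by (rule finite_subset[of _ "Pow C"]) (use A_sub finite_C in auto)
  ultimately have "compactin ?Q (\<Union>S\<in>A. orbit ` unit_box S)"
    by (intro compactin_Union) auto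
  moreover have "(\<Union>S\<in>A. orbit ` unit_box S) = topspace ?Q"
  proof (intro subset_antisym subsetI)
    fix O' assume "O' \<in> topspace ?Q"
    then obtain x where x: "x \<in> stable" "O' = orbit x" unfolding top by blast
    obtain S x' where "S \<in> A" "x' \<in> unit_box S" "x' \<in> orbit x" by (rule unit_box_meets_orbit[OF x(1)])
    then show "O' \<in> (\<Union>S\<in>A. orbit ` unit_box S)" using orbit_eq x(2) by blast
  next
    fix O' assume "O' \<in> (\<Union>S\<in>A. orbit ` unit_box S)"
    then show "O' \<in> topspace ?Q" unfolding top using unit_box_stable by blast
  qed
  ultimately show ?thesis by (simp add: compact_space_def)
qed

end

section \<open>A discrete obstacle problem\<close>

text \<open>Laplacian of the path graph with free ends. The ring is arbitrary because it acts on
  integral exponents as well as on real multiplicities.\<close>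

definition path_laplacian :: "nat \<Rightarrow> (nat \<Rightarrow> 'a::comm_ring_1) \<Rightarrow> nat \<Rightarrow> 'a" where
  "path_laplacian d f i =
     (if i = 0 then 0 else f (i - 1) - f i) + (if i < d then f (i + 1) - f i else 0)"

lemma path_laplacian_interior:
  "0 < i \<Longrightarrow> i < d \<Longrightarrow> path_laplacian d f i = f (i - 1) - 2 * f i + f (i + 1)"
  by (simp add: path_laplacian_def)

lemma path_laplacian_add:
  "path_laplacian d (\<lambda>i. f i + g i) i = path_laplacian d f i + path_laplacian d g i"
  by (simp add: path_laplacian_def)

lemma path_laplacian_cong:
  "(\<And>i. i \<le> d \<Longrightarrow> f i = g i) \<Longrightarrow> i \<le> d \<Longrightarrow> path_laplacian d f i = path_laplacian d g i"
  by (simp add: path_laplacian_def)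

lemma path_laplacian_by_parts:
  "(\<Sum>i\<le>d. g i * path_laplacian d f i) = - (\<Sum>i<d. (g (i + 1) - g i) * (f (i + 1) - f i))"
proof -
  have 1: "(\<Sum>i\<le>d. g i * (if i = 0 then 0 else f (i - 1) - f i)) = (\<Sum>i<d. g (i + 1) * (f i - f (i + 1)))"
  proof (cases d)
    case (Suc k)
    show ?thesis unfolding Suc sum.atMost_Suc_shift lessThan_Suc_atMost by simp
  qed simp
  have 2: "(\<Sum>i\<le>d. g i * (if i < d then f (i + 1) - f i else 0)) = (\<Sum>i<d. g i * (f (i + 1) - f i))"
    by (rule sum.mono_neutral_cong_right) auto
  show ?thesis
    unfolding path_laplacian_def distrib_left sum.distrib 1 2
    unfolding sum.distrib[symmetric] sum_negf[symmetric] by (rule sum.cong) (auto simp: algebra_simps)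
qed

text \<open>Summation by parts puts the pairing in symmetric form. This moves the Laplacian from
  kernel vectors to multiplicities.\<close>

lemma path_laplacian_adjoint:
  fixes f g :: "nat \<Rightarrow> 'a::comm_ring_1"
  shows "(\<Sum>i\<le>d. g i * path_laplacian d f i) = (\<Sum>i\<le>d. f i * path_laplacian d g i)"
  unfolding path_laplacian_by_parts by (simp add: mult.commute)

text \<open>The linear complementarity form of the problem, with obstacle 0 and Dirichlet
  ends.\<close>

definition obstacle_solution :: "nat \<Rightarrow> (nat \<Rightarrow> real) \<Rightarrow> (nat \<Rightarrow> real) \<Rightarrow> bool" where
  "obstacle_solution d e a \<longleftrightarrow> a 0 = 0 \<and> a d = 0 \<and> (\<forall>i\<le>d. 0 \<le> a i) \<and>
     (\<forall>i. 0 < i \<and> i < d \<longrightarrow> 0 \<le> e i - path_laplacian d a i \<and> (a i = 0 \<or> e i - path_laplacian d a i = 0))"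

text \<open>The solution is the pointwise infimum of all supersolutions.\<close>

lemma obstacle_solution_exists: "\<exists>a. obstacle_solution d e a"
proof -
  define F where "F = {a. a 0 = 0 \<and> a d = 0 \<and> (\<forall>i\<le>d. 0 \<le> a i) \<and>
    (\<forall>i. 0 < i \<and> i < d \<longrightarrow> 0 \<le> e i - path_laplacian d a i)}"
  define K where "K = (\<Sum>i\<le>d. \<bar>e i\<bar>)"
  have K: "\<bar>e i\<bar> \<le> K" if "i \<le> d" for i
    unfolding K_def using that by (intro member_le_sum) auto
  then have K0: "0 \<le> K" using abs_ge_zero[of "e 0"] K[of 0] by linarith
  \<comment> \<open>A concave parabola whose second difference \<open>- 2 * K\<close> lies below
    every \<open>e i\<close>, hence a supersolution.\<close>
  have "(\<lambda>i. K * (real i * (real d - real i))) \<in> F"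
  proof -
    have "0 \<le> e i - path_laplacian d (\<lambda>i. K * (real i * (real d - real i))) i" if i: "0 < i" "i < d" for i
    proof -
      have "path_laplacian d (\<lambda>i. K * (real i * (real d - real i))) i = - 2 * K"
        unfolding path_laplacian_interior[OF i] using i(1) by (simp add: of_nat_diff algebra_simps)
      then show ?thesis using K[of i] K0 i(2) by (auto simp: abs_le_iff)
    qed
    then show ?thesis unfolding F_def using K0 by auto
  qed
  then have Fne: "F \<noteq> {}" by blast
  define m where "m i = (INF a\<in>F. a i)" for i
  have bdd: "bdd_below ((\<lambda>a. a i) ` F)" if "i \<le> d" for i
    by (rule bdd_belowI[of _ 0]) (use that in \<open>auto simp: F_def\<close>)
  have m_le: "m i \<le> a i" if "a \<in> F" "i \<le> d" for a i
    unfolding m_def using bdd[OF that(2)] that(1) by (rule cINF_lower)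
  have m_ge: "c \<le> m i" if "\<And>a. a \<in> F \<Longrightarrow> c \<le> a i" for c i
    unfolding m_def using Fne that by (rule cINF_greatest)
  have mnn: "0 \<le> m i" if "i \<le> d" for i using that by (intro m_ge) (auto simp: F_def)
  obtain b where b: "b \<in> F" using Fne by blast
  then have "b 0 = 0" "b d = 0" by (simp_all add: F_def)
  then have m0: "m 0 = 0" "m d = 0"
    using m_le[OF b, of 0] m_le[OF b, of d] mnn[of 0] mnn[of d] by simp_all
  have super: "0 \<le> e i - path_laplacian d m i" if i: "0 < i" "i < d" for i
  proof -
    \<comment> \<open>The supersolution inequality solved for the middle value, a form that is
      stable under infima.\<close>
    have "(m (i - 1) + m (i + 1) - e i) / 2 \<le> m i"
    proof (rule m_ge)
      fix a assume a: "a \<in> F"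
      then have "0 \<le> e i - path_laplacian d a i" using i by (simp add: F_def)
      then have "a (i - 1) + a (i + 1) - e i \<le> 2 * a i" unfolding path_laplacian_interior[OF i] by simp
      moreover have "m (i - 1) \<le> a (i - 1)" "m (i + 1) \<le> a (i + 1)" using m_le[OF a] i by auto
      ultimately show "(m (i - 1) + m (i + 1) - e i) / 2 \<le> a i" by simp
    qed
    then show ?thesis unfolding path_laplacian_interior[OF i] by simp
  qed
  have compl: "m i = 0 \<or> e i - path_laplacian d m i = 0" if i: "0 < i" "i < d" for i
  proof (rule ccontr)
    assume neg: "\<not> ?thesis"
    \<comment> \<open>Lowering the middle value by \<open>s\<close> raises the Laplacian there by
      \<open>2 * s\<close> and does not raise it at other interior points, so a positive slack would
      allow a smaller supersolution.\<close>
    define s where "s = min (m i) ((e i - path_laplacian d m i) / 2)"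
    have s: "0 < s" "s \<le> m i" "2 * s \<le> e i - path_laplacian d m i"
      using neg mnn[of i] super[OF i] i by (auto simp: s_def min_def)
    define a where "a = m(i := m i - s)"
    have "a \<in> F"
    proof -
      have "0 \<le> e j - path_laplacian d a j" if j: "0 < j" "j < d" for j
      proof (cases "j = i")
        case True
        then show ?thesis using s(3) i unfolding path_laplacian_interior[OF j] path_laplacian_interior[OF i]
          by (auto simp: a_def)
      next
        case False
        then have "path_laplacian d a j \<le> path_laplacian d m j"
          unfolding path_laplacian_interior[OF j] using s(1) by (simp add: a_def)
        then show ?thesis using super[OF j] by simp
      qed
      then show ?thesis unfolding F_def using m0 mnn s i by (auto simp: a_def)
    qed
    then have "m i \<le> a i" using m_le i by simp
    then show False using s(1) by (simp add: a_def)
  qed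
  show ?thesis unfolding obstacle_solution_def using m0 mnn super compl by (intro exI[of _ m]) blast
qed

text \<open>Uniqueness is the discrete maximum principle.\<close>

lemma obstacle_solution_unique:
  assumes "obstacle_solution d e a" "obstacle_solution d e a'" "i \<le> d"
  shows "a i = a' i"
proof -
  have le: "a i \<le> a' i" if sol: "obstacle_solution d e a" "obstacle_solution d e a'" and i: "i \<le> d" for a a' i
  proof (rule ccontr)
    assume neg: "\<not> a i \<le> a' i"
    define D where "D j = a j - a' j" for j
    define M where "M = Max (D ` {..d})"
    have M: "D j \<le> M" if "j \<le> d" for j unfolding M_def using that by (intro Max_ge) auto
    have Mpos: "0 < M" using M[OF i] neg by (simp add: D_def)
    have "M \<in> D ` {..d}" unfolding M_def by (rule Max_in) auto
    then obtain j0 where j0: "D j0 = M" "j0 \<le> d" by auto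
    \<comment> \<open>At the leftmost positive maximum of the difference, \<open>a\<close> is
      positive, so its slack vanishes and the difference is at most the mean of its neighbours; then
      the left neighbour is a maximum too.\<close>
    define k where "k = (LEAST j. D j = M)"
    have k: "D k = M" unfolding k_def using j0(1) by (rule LeastI)
    have kd: "k \<le> d" using Least_le[of "\<lambda>j. D j = M" j0] j0 unfolding k_def by simp
    have "D 0 = 0" "D d = 0" using sol by (auto simp: obstacle_solution_def D_def)
    then have kk: "0 < k" "k < d" using k Mpos kd by (metis neq0_conv order_less_irrefl, metis le_neq_implies_less order_less_irrefl)
    have "0 \<le> a' k" using sol(2) kd by (simp add: obstacle_solution_def)
    then have "a k \<noteq> 0" using k Mpos by (simp add: D_def)
    then have "e k - path_laplacian d a k = 0" "0 \<le> e k - path_laplacian d a' k"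
      using sol kk by (auto simp: obstacle_solution_def)
    then have "2 * D k \<le> D (k - 1) + D (k + 1)"
      unfolding path_laplacian_interior[OF kk] D_def by simp
    moreover have "D (k - 1) \<le> M" "D (k + 1) \<le> M" using M kk by auto
    ultimately have "D (k - 1) = M" using k by simp
    then have "k \<le> k - 1" unfolding k_def by (rule Least_le)
    then show False using kk by simp
  qed
  show ?thesis using le[OF assms(1,2,3)] le[OF assms(2,1,3)] by simp
qed


section \<open>Monotone couplings\<close>

definition monotone_support :: "nat \<Rightarrow> nat \<Rightarrow> (nat \<Rightarrow> nat \<Rightarrow> real) \<Rightarrow> bool" where
  "monotone_support m n u \<longleftrightarrow>
     (\<forall>i1 i2 j1 j2. i1 < j1 \<and> j1 \<le> m \<and> j2 < i2 \<and> i2 \<le> n \<longrightarrow> u i1 i2 = 0 \<or> u j1 j2 = 0)"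

text \<open>The northwest corner rule: the cumulative distribution function of the monotone coupling is the
  minimum of those of the marginals.\<close>

lemma monotone_coupling_exists:
  fixes U V :: "nat \<Rightarrow> real"
  assumes U: "\<And>i. i \<le> m \<Longrightarrow> 0 \<le> U i" and V: "\<And>j. j \<le> n \<Longrightarrow> 0 \<le> V j"
    and tot: "(\<Sum>i\<le>m. U i) = (\<Sum>j\<le>n. V j)"
  obtains u where "\<And>i j. i \<le> m \<Longrightarrow> j \<le> n \<Longrightarrow> 0 \<le> u i j" "monotone_support m n u"
    "\<And>i. i \<le> m \<Longrightarrow> (\<Sum>j\<le>n. u i j) = U i" "\<And>j. j \<le> n \<Longrightarrow> (\<Sum>i\<le>m. u i j) = V j"
    "u 0 0 = min (U 0) (V 0)" "u m n = min (U m) (V n)"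
proof -
  define F where "F i = (\<Sum>k<i. U k)" for i
  define G where "G j = (\<Sum>k<j. V k)" for j
  define H where "H i j = min (F i) (G j)" for i j
  \<comment> \<open>Mixed second difference of the joint distribution function: the length of
    overlap of the intervals from \<open>F i\<close> to \<open>F (Suc i)\<close> and from
    \<open>G j\<close> to \<open>G (Suc j)\<close>.\<close>
  define u where "u i j = H (Suc i) (Suc j) - H i (Suc j) - (H (Suc i) j - H i j)" for i j
  have F0: "F 0 = 0" "G 0 = 0" by (simp_all add: F_def G_def)
  have FS: "F (Suc i) = F i + U i" "G (Suc j) = G j + V j" for i j by (simp_all add: F_def G_def)
  have FG: "F (Suc m) = G (Suc n)" using tot by (simp add: F_def G_def lessThan_Suc_atMost)
  have Fmono: "F i \<le> F j" if "i \<le> j" "j \<le> Suc m" for i j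
    unfolding F_def using that U by (intro sum_mono2) auto
  have Gmono: "G i \<le> G j" if "i \<le> j" "j \<le> Suc n" for i j
    unfolding G_def using that V by (intro sum_mono2) auto
  have nn: "0 \<le> u i j" if "i \<le> m" "j \<le> n" for i j
    using U[OF that(1)] V[OF that(2)] by (simp add: u_def H_def FS min_def)
  have pos: "G j < F (Suc i) \<and> F i < G (Suc j)" if "u i j \<noteq> 0" "i \<le> m" "j \<le> n" for i j
  proof -
    have "\<not> F (Suc i) \<le> G j"
    proof
      assume "F (Suc i) \<le> G j"
      then have "u i j = 0" using U[OF that(2)] V[OF that(3)] by (simp add: u_def H_def FS min_def)
      then show False using that by simp
    qed
    moreover have "\<not> G (Suc j) \<le> F i"
    proof
      assume "G (Suc j) \<le> F i"
      then have "u i j = 0" using U[OF that(2)] V[OF that(3)] by (simp add: u_def H_def FS min_def)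
      then show False using that by simp
    qed
    ultimately show ?thesis by simp
  qed
  have row: "(\<Sum>j<k. u i j) = H (Suc i) k - H i k - (H (Suc i) 0 - H i 0)" for i k
    by (induction k) (auto simp: u_def)
  have col: "(\<Sum>i<k. u i j) = H k (Suc j) - H k j - (H 0 (Suc j) - H 0 j)" for j k
    by (induction k) (auto simp: u_def)
  show ?thesis
  proof (rule that[of u])
    show "0 \<le> u i j" if "i \<le> m" "j \<le> n" for i j using nn that .
    show "monotone_support m n u" unfolding monotone_support_def
    proof (intro allI impI, rule ccontr)
      fix i1 i2 j1 j2 assume ij: "i1 < j1 \<and> j1 \<le> m \<and> j2 < i2 \<and> i2 \<le> n" and neg: "\<not> (u i1 i2 = 0 \<or> u j1 j2 = 0)"
      then have "G i2 < F (Suc i1)" "F j1 < G (Suc j2)" using pos[of i1 i2] pos[of j1 j2] by auto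
      moreover have "F (Suc i1) \<le> F j1" using ij by (intro Fmono) auto
      moreover have "G (Suc j2) \<le> G i2" using ij by (intro Gmono) auto
      ultimately show False by simp
    qed
    show "(\<Sum>j\<le>n. u i j) = U i" if "i \<le> m" for i
    proof -
      have "F i \<le> F (Suc m)" "F (Suc i) \<le> F (Suc m)" "0 \<le> F i" "0 \<le> F (Suc i)"
        using Fmono[of i "Suc m"] Fmono[of "Suc i" "Suc m"] Fmono[of 0 i] Fmono[of 0 "Suc i"] that F0 by auto
      then show ?thesis unfolding lessThan_Suc_atMost[symmetric] row
        by (simp add: H_def F0 FG FS[of i] min_def)
    qed
    show "(\<Sum>i\<le>m. u i j) = V j" if "j \<le> n" for j
    proof -
      have "G j \<le> G (Suc n)" "G (Suc j) \<le> G (Suc n)" "0 \<le> G j" "0 \<le> G (Suc j)"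
        using Gmono[of j "Suc n"] Gmono[of "Suc j" "Suc n"] Gmono[of 0 j] Gmono[of 0 "Suc j"] that F0 by auto
      then show ?thesis unfolding lessThan_Suc_atMost[symmetric] col
        by (simp add: H_def F0 FG FS(2)[of j] min_def)
    qed
    \<comment> \<open>The corner masses decide whether the coupling avoids the two positions that
      carry no coordinate.\<close>
    show "u 0 0 = min (U 0) (V 0)"
      using U[of 0] V[of 0] by (simp add: u_def H_def FS F0 min_def)
    have "F m + U m = G n + V n" using FG by (simp add: FS)
    then show "u m n = min (U m) (V n)"
      using U[of m] V[of n] by (simp add: u_def H_def FS min_def)
  qed
qed

text \<open>Either the rows before \<open>i\<close> have no mass from column \<open>j\<close> on,
  and their row totals give the answer, or they have some, and monotonicity then leaves the columns
  before \<open>j\<close> no mass from row \<open>i\<close> on.\<close>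

lemma monotone_coupling_cdf:
  fixes u :: "nat \<Rightarrow> nat \<Rightarrow> real"
  assumes nn: "\<And>i j. i \<le> m \<Longrightarrow> j \<le> n \<Longrightarrow> 0 \<le> u i j" and mono: "monotone_support m n u"
    and ij: "i \<le> Suc m" "j \<le> Suc n"
  shows "(\<Sum>k<i. \<Sum>l<j. u k l) = min (\<Sum>k<i. \<Sum>l\<le>n. u k l) (\<Sum>l<j. \<Sum>k\<le>m. u k l)"
proof -
  have le1: "(\<Sum>l<j. u k l) \<le> (\<Sum>l\<le>n. u k l)" if "k < i" for k
    using that ij nn by (intro sum_mono2) auto
  have le2: "(\<Sum>k<i. u k l) \<le> (\<Sum>k\<le>m. u k l)" if "l < j" for l
    using that ij nn by (intro sum_mono2) auto
  have R1: "(\<Sum>k<i. \<Sum>l<j. u k l) \<le> (\<Sum>k<i. \<Sum>l\<le>n. u k l)"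
    using le1 by (intro sum_mono) auto
  have R2: "(\<Sum>k<i. \<Sum>l<j. u k l) \<le> (\<Sum>l<j. \<Sum>k\<le>m. u k l)"
    unfolding sum.swap[of u "{..<j}"] using le2 by (intro sum_mono) auto
  show ?thesis
  proof (cases "\<forall>k<i. \<forall>l\<le>n. j \<le> l \<longrightarrow> u k l = 0")
    case True
    have "(\<Sum>l\<le>n. u k l) = (\<Sum>l<j. u k l)" if "k < i" for k
      using that True ij by (intro sum.mono_neutral_right) auto
    then have "(\<Sum>k<i. \<Sum>l\<le>n. u k l) = (\<Sum>k<i. \<Sum>l<j. u k l)" by simp
    then show ?thesis using R2 by simp
  next
    case False
    then obtain k l where kl: "k < i" "l \<le> n" "j \<le> l" "u k l \<noteq> 0" by blast
    have "u k' l' = 0" if "i \<le> k'" "k' \<le> m" "l' < j" for k' l'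
      using mono[unfolded monotone_support_def, rule_format, of k k' l' l] kl that by auto
    then have "(\<Sum>k\<le>m. u k l) = (\<Sum>k<i. u k l)" if "l < j" for l
      using that ij by (intro sum.mono_neutral_right) auto
    then have "(\<Sum>l<j. \<Sum>k\<le>m. u k l) = (\<Sum>k<i. \<Sum>l<j. u k l)"
      unfolding sum.swap[of u "{..<j}"] by simp
    then show ?thesis using R1 by simp
  qed
qed

text \<open>The marginals determine the distribution function, and the mass of a cell is its mixed
  difference.\<close>

lemma monotone_coupling_unique:
  fixes u u' :: "nat \<Rightarrow> nat \<Rightarrow> real"
  assumes u: "\<And>i j. i \<le> m \<Longrightarrow> j \<le> n \<Longrightarrow> 0 \<le> u i j" "monotone_support m n u"
    and u': "\<And>i j. i \<le> m \<Longrightarrow> j \<le> n \<Longrightarrow> 0 \<le> u' i j" "monotone_support m n u'"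
    and row: "\<And>i. i \<le> m \<Longrightarrow> (\<Sum>j\<le>n. u i j) = (\<Sum>j\<le>n. u' i j)"
    and col: "\<And>j. j \<le> n \<Longrightarrow> (\<Sum>i\<le>m. u i j) = (\<Sum>i\<le>m. u' i j)"
    and ij: "i \<le> m" "j \<le> n"
  shows "u i j = u' i j"
proof -
  have eq: "(\<Sum>k<i. \<Sum>l<j. u k l) = (\<Sum>k<i. \<Sum>l<j. u' k l)" if "i \<le> Suc m" "j \<le> Suc n" for i j
  proof -
    have "(\<Sum>k<i. \<Sum>l\<le>n. u k l) = (\<Sum>k<i. \<Sum>l\<le>n. u' k l)"
      by (rule sum.cong[OF refl], rule row) (use that in auto)
    moreover have "(\<Sum>l<j. \<Sum>k\<le>m. u k l) = (\<Sum>l<j. \<Sum>k\<le>m. u' k l)"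
      by (rule sum.cong[OF refl], rule col) (use that in auto)
    ultimately show ?thesis
      using monotone_coupling_cdf[OF u that] monotone_coupling_cdf[OF u' that] by simp
  qed
  have mixed: "w i j = (\<Sum>k<Suc i. \<Sum>l<Suc j. w k l) - (\<Sum>k<i. \<Sum>l<Suc j. w k l)
      - ((\<Sum>k<Suc i. \<Sum>l<j. w k l) - (\<Sum>k<i. \<Sum>l<j. w k l))" for w :: "nat \<Rightarrow> nat \<Rightarrow> real"
    by simp
  have le: "i \<le> Suc m" "j \<le> Suc n" "Suc i \<le> Suc m" "Suc j \<le> Suc n" using ij by auto
  show ?thesis
    unfolding mixed[of u] mixed[of u'] eq[OF le(3,4)] eq[OF le(1,4)] eq[OF le(3,2)] eq[OF le(1,2)] ..
qed

section \<open>The fan of the moduli space\<close>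

text \<open>Data along one of the two factors: the pairs \<open>(c1 i, c2 i)\<close> are multiplicities of the rays of
  \<open>a\<^sub>i\<^sup>1\<close>, \<open>a\<^sub>i\<^sup>2\<close>, and \<open>U i\<close> is the total multiplicity of the rays of \<open>u\<^sub>(\<^sub>i\<^sub>,\<^sub>j\<^sub>)\<close>. Their common part
  \<open>min (c1 i) (c2 i)\<close> solves an obstacle problem.\<close>

definition line_data :: "nat \<Rightarrow> (nat \<Rightarrow> real) \<Rightarrow> (nat \<Rightarrow> real) \<Rightarrow> (nat \<Rightarrow> real) \<Rightarrow> bool" where
  "line_data d c1 c2 U \<longleftrightarrow> (\<forall>i\<le>d. 0 \<le> c1 i \<and> 0 \<le> c2 i) \<and>
     min (c1 0) (c2 0) = 0 \<and> min (c1 d) (c2 d) = 0 \<and>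
     (\<forall>i. 0 < i \<and> i < d \<longrightarrow> 0 \<le> U i \<and> (min (c1 i) (c2 i) = 0 \<or> U i = 0))"

text \<open>The function \<open>c2\<close> is the common part plus the known
  \<open>max 0 (- \<delta> i)\<close>, so the equation for \<open>U\<close> says that
  \<open>U\<close> is the slack of the obstacle problem for the common part.\<close>

lemma line_data_obstacle:
  assumes "line_data d c1 c2 U" and "\<And>i. i \<le> d \<Longrightarrow> c1 i - c2 i = \<delta> i"
    and "\<And>i. 0 < i \<Longrightarrow> i < d \<Longrightarrow> U i + path_laplacian d c2 i = y i"
  shows "obstacle_solution d (\<lambda>i. y i - path_laplacian d (\<lambda>i. max 0 (- \<delta> i)) i) (\<lambda>i. min (c1 i) (c2 i))"
proof -
  have "y i - path_laplacian d (\<lambda>i. max 0 (- \<delta> i)) i - path_laplacian d (\<lambda>i. min (c1 i) (c2 i)) i = U i"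
    if i: "0 < i" "i < d" for i
  proof -
    have "path_laplacian d c2 i = path_laplacian d (\<lambda>i. max 0 (- \<delta> i) + min (c1 i) (c2 i)) i"
      using i assms(2) by (intro path_laplacian_cong) (auto simp: max_def min_def simp flip: assms(2))
    then show ?thesis using assms(3)[OF i] unfolding path_laplacian_add by simp
  qed
  then show ?thesis using assms(1) unfolding obstacle_solution_def line_data_def by auto
qed

lemma line_data_unique:
  assumes c: "line_data d c1 c2 U" and c': "line_data d c1' c2' U'"
    and diff: "\<And>i. i \<le> d \<Longrightarrow> c1 i - c2 i = c1' i - c2' i"
    and y: "\<And>i. 0 < i \<Longrightarrow> i < d \<Longrightarrow> U i + path_laplacian d c2 i = U' i + path_laplacian d c2' i"
  shows "i \<le> d \<Longrightarrow> c1 i = c1' i" "i \<le> d \<Longrightarrow> c2 i = c2' i" "0 < i \<Longrightarrow> i < d \<Longrightarrow> U i = U' i"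
proof -
  note sol = line_data_obstacle[OF c diff y] line_data_obstacle[OF c' refl refl]
  have m: "min (c1 i) (c2 i) = min (c1' i) (c2' i)" if "i \<le> d" for i
    by (rule obstacle_solution_unique[OF sol that])
  show 1: "c1 i = c1' i" if "i \<le> d" for i using m[OF that] diff[OF that] by (auto simp: min_def split: if_splits)
  show 2: "c2 i = c2' i" if "i \<le> d" for i using 1[OF that] diff[OF that] by simp
  show "U i = U' i" if "0 < i" "i < d"
  proof -
    have "path_laplacian d c2 i = path_laplacian d c2' i" using that by (intro path_laplacian_cong 2) auto
    then show ?thesis using y[OF that] by simp
  qed
qed

lemma line_data_exists:
  obtains c1 c2 U where "line_data d c1 c2 U" "\<And>i. i \<le> d \<Longrightarrow> c1 i - c2 i = \<delta> i"
    "\<And>i. 0 < i \<Longrightarrow> i < d \<Longrightarrow> U i + path_laplacian d c2 i = y i"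
proof -
  define s where "s i = max 0 (- \<delta> i)" for i
  obtain a where a: "obstacle_solution d (\<lambda>i. y i - path_laplacian d s i) a"
    using obstacle_solution_exists by blast
  show ?thesis
  \<comment> \<open>Multiplicities with difference \<open>\<delta>\<close> and minimum
    \<open>a\<close>: \<open>s\<close> is the least second multiplicity that keeps both nonnegative,
    and \<open>U\<close> is the slack.\<close>
  proof (rule that[of "\<lambda>i. s i + a i + \<delta> i" "\<lambda>i. s i + a i" "\<lambda>i. y i - path_laplacian d s i - path_laplacian d a i"])
    have m: "min (s i + a i + \<delta> i) (s i + a i) = a i" for i by (simp add: s_def min_def max_def)
    have "0 \<le> s i" "0 \<le> s i + \<delta> i" for i by (simp_all add: s_def max_def)
    then show "line_data d (\<lambda>i. s i + a i + \<delta> i) (\<lambda>i. s i + a i) (\<lambda>i. y i - path_laplacian d s i - path_laplacian d a i)"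
      using a unfolding line_data_def obstacle_solution_def m by (auto simp: add_nonneg_nonneg add.assoc add.left_commute)
  qed (simp_all add: path_laplacian_add)
qed

text \<open>With the corner empty, mass in both the first row and the first column would violate
  monotonicity; likewise at the opposite corner. So each pair of end marginals is determined by its
  difference.\<close>

lemma min_sums_eq_0:
  assumes nn: "\<And>i j. i \<le> m \<Longrightarrow> j \<le> n \<Longrightarrow> 0 \<le> u i j" and mono: "monotone_support m n u"
    and "u 0 0 = 0" "u m n = 0"
  shows "min (\<Sum>j\<le>n. u 0 j) (\<Sum>i\<le>m. u i 0) = 0" "min (\<Sum>j\<le>n. u m j) (\<Sum>i\<le>m. u i n) = 0"
proof -
  have ge: "0 \<le> (\<Sum>j\<le>n. u i j)" "0 \<le> (\<Sum>i\<le>m. u i j)" if "i \<le> m" "j \<le> n" for i j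
    using that nn by (auto intro!: sum_nonneg)
  have "(\<Sum>j\<le>n. u 0 j) = 0 \<or> (\<Sum>i\<le>m. u i 0) = 0"
  proof (rule ccontr)
    assume "\<not> ?thesis"
    then obtain i j where ij: "j \<le> n" "u 0 j \<noteq> 0" "i \<le> m" "u i 0 \<noteq> 0"
      by (metis atMost_iff sum.neutral)
    then have "0 < i" "0 < j" using assms(3) by (metis neq0_conv)+
    then show False using mono[unfolded monotone_support_def, rule_format, of 0 i 0 j] ij by auto
  qed
  then show "min (\<Sum>j\<le>n. u 0 j) (\<Sum>i\<le>m. u i 0) = 0" using ge(1)[of 0 0] ge(2)[of 0 0] by (auto simp: min_def)
  have "(\<Sum>j\<le>n. u m j) = 0 \<or> (\<Sum>i\<le>m. u i n) = 0"
  proof (rule ccontr)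
    assume "\<not> ?thesis"
    then obtain i j where ij: "j \<le> n" "u m j \<noteq> 0" "i \<le> m" "u i n \<noteq> 0"
      by (metis atMost_iff sum.neutral)
    then have "i < m" "j < n" using assms(4) by (metis le_neq_implies_less)+
    then show False using mono[unfolded monotone_support_def, rule_format, of i m j n] ij by auto
  qed
  then show "min (\<Sum>j\<le>n. u m j) (\<Sum>i\<le>m. u i n) = 0" using ge(1)[of m n] ge(2)[of m n] by (auto simp: min_def)
qed

section \<open>Coordinates on the kernel of the weight matrix\<close>

locale bidegree =
  fixes d1 d2 :: nat
  assumes d1_pos: "0 < d1" and d2_pos: "0 < d2"
begin

text \<open>Elements of the kernel of the weight matrix are given by \<open>u\<^sub>(\<^sub>i\<^sub>,\<^sub>j\<^sub>) = \<alpha>\<^sub>i + \<beta>\<^sub>j\<close> with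
  \<open>\<alpha>\<^sub>0 = \<beta>\<^sub>0 = 0\<close> and \<open>\<alpha>\<^bsub>d1\<^esub> + \<beta>\<^bsub>d2\<^esub> = 0\<close>, by arbitrary \<open>a\<^sub>i\<^sup>1\<close>, \<open>b\<^sub>j\<^sup>1\<close>, and by
  \<open>a\<^sub>i\<^sup>1 + a\<^sub>i\<^sup>2 = (\<Delta>\<alpha>)\<^sub>i\<close>, \<open>b\<^sub>j\<^sup>1 + b\<^sub>j\<^sup>2 = (\<Delta>\<beta>)\<^sub>j\<close>. The labels in \<open>coords\<close> index a basis.\<close>

definition alpha :: "(column \<Rightarrow> 'a::comm_ring_1) \<Rightarrow> nat \<Rightarrow> 'a" where
  "alpha z i = (if i = 0 then 0 else z (Col_u i 0))"

definition beta :: "(column \<Rightarrow> 'a::comm_ring_1) \<Rightarrow> nat \<Rightarrow> 'a" where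
  "beta z j = (if j = 0 then 0 else if j < d2 then z (Col_u 0 j) else - z (Col_u d1 0))"

fun kernel_vector :: "(column \<Rightarrow> 'a::comm_ring_1) \<Rightarrow> column \<Rightarrow> 'a" where
  "kernel_vector z (Col_a1 i) = z (Col_a1 i)"
| "kernel_vector z (Col_a2 i) = path_laplacian d1 (alpha z) i - z (Col_a1 i)"
| "kernel_vector z (Col_b1 j) = z (Col_b1 j)"
| "kernel_vector z (Col_b2 j) = path_laplacian d2 (beta z) j - z (Col_b1 j)"
| "kernel_vector z (Col_u i j) = alpha z i + beta z j"

definition coords :: "column set" where
  "coords = Col_a1 ` {..d1} \<union> Col_b1 ` {..d2} \<union> (\<lambda>i. Col_u i 0) ` {1..d1} \<union> Col_u 0 ` {1..<d2}"

definition unit :: "column \<Rightarrow> column \<Rightarrow> 'a::comm_ring_1" where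
  "unit \<kappa> \<nu> = (if \<nu> = \<kappa> then 1 else 0)"

text \<open>Extension by 0 to the two corners that carry no coordinate, so that sums run over the
  full rectangle.\<close>

definition grid :: "(column \<Rightarrow> 'a::zero) \<Rightarrow> nat \<Rightarrow> nat \<Rightarrow> 'a" where
  "grid c i j = (if (i, j) \<in> index_set d1 d2 then c (Col_u i j) else 0)"

lemma finite_coords: "finite coords"
  by (simp add: coords_def)

text \<open>The dimension: \<open>d1 + 1\<close> and \<open>d2 + 1\<close> from the \<open>a\<close>
  and \<open>b\<close> columns, \<open>d1\<close> from \<alpha>, and \<open>d2 - 1\<close> from
  \<beta>, whose last value is tied to \<alpha>.\<close>

lemma card_coords: "card coords = 2 * d1 + 2 * d2 + 1"
proof -
  have "card coords = card (Col_a1 ` {..d1}) + card (Col_b1 ` {..d2})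
      + card ((\<lambda>i. Col_u i 0) ` {1..d1}) + card (Col_u 0 ` {1..<d2})"
    unfolding coords_def by (subst card_Un_disjoint; auto)+
  then show ?thesis using d2_pos by (simp add: card_image inj_on_def)
qed

lemma coords_sub: "coords \<subseteq> column_labels d1 d2"
  using d1_pos d2_pos by (auto simp: coords_def column_labels_def index_set_def image_iff)

lemma coords_cases:
  assumes "\<kappa> \<in> coords"
  obtains i where "\<kappa> = Col_a1 i" "i \<le> d1" | j where "\<kappa> = Col_b1 j" "j \<le> d2"
    | i where "\<kappa> = Col_u i 0" "0 < i" "i < d1" | "\<kappa> = Col_u d1 0"
    | j where "\<kappa> = Col_u 0 j" "0 < j" "j < d2"
proof -
  from assms consider i where "\<kappa> = Col_a1 i" "i \<le> d1" | j where "\<kappa> = Col_b1 j" "j \<le> d2"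
    | i where "\<kappa> = Col_u i 0" "0 < i" "i \<le> d1" | j where "\<kappa> = Col_u 0 j" "0 < j" "j < d2"
    by (auto simp: coords_def)
  then show ?thesis using that le_neq_implies_less by cases metis+
qed

lemma column_labels_iff:
  "Col_a1 i \<in> column_labels d1 d2 \<longleftrightarrow> i \<le> d1" "Col_a2 i \<in> column_labels d1 d2 \<longleftrightarrow> i \<le> d1"
  "Col_b1 j \<in> column_labels d1 d2 \<longleftrightarrow> j \<le> d2" "Col_b2 j \<in> column_labels d1 d2 \<longleftrightarrow> j \<le> d2"
  "Col_u i j \<in> column_labels d1 d2 \<longleftrightarrow> (i, j) \<in> index_set d1 d2"
  by (auto simp: column_labels_def)

lemma index_set_iff: "(i, j) \<in> index_set d1 d2 \<longleftrightarrow> i \<le> d1 \<and> j \<le> d2 \<and> (i, j) \<noteq> (0, 0) \<and> (i, j) \<noteq> (d1, d2)"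
  by (auto simp: index_set_def)

lemma finite_column_labels: "finite (column_labels d1 d2)"
  by (auto simp: column_labels_def index_set_def)

lemma finite_row_labels: "finite (row_labels d1 d2)"
  by (auto simp: row_labels_def)

lemma sum_columns:
  fixes f :: "column \<Rightarrow> 'a::comm_monoid_add"
  shows "(\<Sum>\<rho>\<in>column_labels d1 d2. f \<rho>) = (\<Sum>i\<le>d1. f (Col_a1 i)) + (\<Sum>i\<le>d1. f (Col_a2 i))
    + (\<Sum>j\<le>d2. f (Col_b1 j)) + (\<Sum>j\<le>d2. f (Col_b2 j)) + (\<Sum>i\<le>d1. \<Sum>j\<le>d2. grid f i j)"
proof -
  have fin: "finite (index_set d1 d2)" by (simp add: index_set_def)
  have "(\<Sum>\<rho>\<in>column_labels d1 d2. f \<rho>) = sum f (Col_a1 ` {0..d1}) + sum f (Col_a2 ` {0..d1})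
    + sum f (Col_b1 ` {0..d2}) + sum f (Col_b2 ` {0..d2}) + sum f ((\<lambda>(i, j). Col_u i j) ` index_set d1 d2)"
    unfolding column_labels_def by (subst sum.union_disjoint; (use fin in auto)?)+
  moreover have "sum f ((\<lambda>(i, j). Col_u i j) ` index_set d1 d2) = (\<Sum>p\<in>index_set d1 d2. f (Col_u (fst p) (snd p)))"
    by (subst sum.reindex) (auto simp: inj_on_def case_prod_beta)
  moreover have "\<dots> = (\<Sum>p\<in>{..d1} \<times> {..d2}. grid f (fst p) (snd p))"
    by (rule sum.mono_neutral_cong_left) (auto simp: grid_def index_set_iff)
  moreover have "\<dots> = (\<Sum>i\<le>d1. \<Sum>j\<le>d2. grid f i j)"
    by (simp add: sum.cartesian_product case_prod_beta)
  ultimately show ?thesis by (simp add: sum.reindex inj_on_def atLeast0AtMost)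
qed

text \<open>The coordinates of the combination of rays with multiplicities \<open>c\<close>, see
  \<open>ray_combination\<close>. The label \<open>Col_u d1 0\<close> mixes both factors because its
  basis vector has \<alpha> equal to 1 at \<open>d1\<close> and \<beta> equal to -1 at
  \<open>d2\<close>.\<close>

definition invariant :: "(column \<Rightarrow> 'a::comm_ring_1) \<Rightarrow> column \<Rightarrow> 'a" where
  "invariant c \<kappa> = (case \<kappa> of Col_a1 i \<Rightarrow> c (Col_a1 i) - c (Col_a2 i)
     | Col_b1 j \<Rightarrow> c (Col_b1 j) - c (Col_b2 j)
     | Col_u i j \<Rightarrow>
         let P = \<lambda>i. (\<Sum>j\<le>d2. grid c i j) + path_laplacian d1 (\<lambda>i. c (Col_a2 i)) i;
             Q = \<lambda>j. (\<Sum>i\<le>d1. grid c i j) + path_laplacian d2 (\<lambda>j. c (Col_b2 j)) j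
         in if i = 0 then Q j else if i = d1 then P d1 - Q d2 else P i
     | _ \<Rightarrow> 0)"

text \<open>Adjointness of the Laplacian collects the coefficient of each parameter of the kernel
  vector.\<close>

lemma kernel_vector_pairing:
  fixes c z :: "column \<Rightarrow> 'a::comm_ring_1"
  shows "(\<Sum>\<rho>\<in>column_labels d1 d2. c \<rho> * kernel_vector z \<rho>) =
    (\<Sum>i\<le>d1. (c (Col_a1 i) - c (Col_a2 i)) * z (Col_a1 i))
    + (\<Sum>j\<le>d2. (c (Col_b1 j) - c (Col_b2 j)) * z (Col_b1 j))
    + (\<Sum>i\<le>d1. alpha z i * ((\<Sum>j\<le>d2. grid c i j) + path_laplacian d1 (\<lambda>i. c (Col_a2 i)) i))
    + (\<Sum>j\<le>d2. beta z j * ((\<Sum>i\<le>d1. grid c i j) + path_laplacian d2 (\<lambda>j. c (Col_b2 j)) j))"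
proof -
  have g: "grid (\<lambda>\<rho>. c \<rho> * kernel_vector z \<rho>) i j = alpha z i * grid c i j + beta z j * grid c i j" for i j
    by (simp add: grid_def algebra_simps)
  have "(\<Sum>i\<le>d1. \<Sum>j\<le>d2. grid (\<lambda>\<rho>. c \<rho> * kernel_vector z \<rho>) i j)
      = (\<Sum>i\<le>d1. alpha z i * (\<Sum>j\<le>d2. grid c i j)) + (\<Sum>i\<le>d1. \<Sum>j\<le>d2. beta z j * grid c i j)"
    unfolding g by (simp add: sum.distrib sum_distrib_left)
  also have "(\<Sum>i\<le>d1. \<Sum>j\<le>d2. beta z j * grid c i j) = (\<Sum>j\<le>d2. beta z j * (\<Sum>i\<le>d1. grid c i j))"
    by (subst sum.swap) (simp add: sum_distrib_left)
  finally have 1: "(\<Sum>i\<le>d1. \<Sum>j\<le>d2. grid (\<lambda>\<rho>. c \<rho> * kernel_vector z \<rho>) i j)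
      = (\<Sum>i\<le>d1. alpha z i * (\<Sum>j\<le>d2. grid c i j)) + (\<Sum>j\<le>d2. beta z j * (\<Sum>i\<le>d1. grid c i j))" .
  have 2: "(\<Sum>i\<le>d1. c (Col_a2 i) * path_laplacian d1 (alpha z) i)
      = (\<Sum>i\<le>d1. alpha z i * path_laplacian d1 (\<lambda>i. c (Col_a2 i)) i)"
    by (rule path_laplacian_adjoint)
  have 3: "(\<Sum>j\<le>d2. c (Col_b2 j) * path_laplacian d2 (beta z) j)
      = (\<Sum>j\<le>d2. beta z j * path_laplacian d2 (\<lambda>j. c (Col_b2 j)) j)"
    by (rule path_laplacian_adjoint)
  show ?thesis
    unfolding sum_columns 1 distrib_left sum.distrib 2[symmetric] 3[symmetric]
    by (simp add: algebra_simps sum_subtractf sum.distrib)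
qed

lemma kernel_vector_unit_pairing:
  fixes c :: "column \<Rightarrow> 'a::comm_ring_1"
  assumes "\<kappa> \<in> coords"
  shows "(\<Sum>\<rho>\<in>column_labels d1 d2. c \<rho> * kernel_vector (unit \<kappa>) \<rho>) = invariant c \<kappa>"
proof -
  have delta: "(\<Sum>i\<le>d. f i * (if i = k then 1 else 0)) = f k" "(\<Sum>i\<le>d. (if i = k then 1 else 0) * f i) = f k"
    if "k \<le> d" for f :: "nat \<Rightarrow> 'a" and k d
    using that by (simp_all add: if_distrib[of "\<lambda>x. _ * x"] if_distrib[of "\<lambda>x. x * _"] cong: if_cong)
  from assms show ?thesis
  proof (cases rule: coords_cases)
    case (1 i)
    have [simp]: "alpha (unit \<kappa> :: column \<Rightarrow> 'a) k = 0" "beta (unit \<kappa> :: column \<Rightarrow> 'a) k = 0" for k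
      by (auto simp: alpha_def beta_def unit_def 1)
    show ?thesis unfolding kernel_vector_pairing using 1(2)
      by (simp add: 1(1) unit_def delta invariant_def) (simp add: delta flip: 1(1))
  next
    case (2 j)
    have [simp]: "alpha (unit \<kappa> :: column \<Rightarrow> 'a) k = 0" "beta (unit \<kappa> :: column \<Rightarrow> 'a) k = 0" for k
      by (auto simp: alpha_def beta_def unit_def 2)
    show ?thesis unfolding kernel_vector_pairing using 2(2)
      by (simp add: 2(1) unit_def delta invariant_def) (simp add: delta flip: 2(1))
  next
    case (3 i)
    have al: "alpha (unit \<kappa> :: column \<Rightarrow> 'a) k = (if k = i then 1 else 0)" "beta (unit \<kappa> :: column \<Rightarrow> 'a) k = 0" for k
      using 3 by (auto simp: alpha_def beta_def unit_def)
    show ?thesis unfolding kernel_vector_pairing al using 3(2,3)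
      by (simp add: 3(1) unit_def delta invariant_def)
  next
    case 4
    have al: "alpha (unit \<kappa> :: column \<Rightarrow> 'a) k = (if k = d1 then 1 else 0)" for k
      using 4 d1_pos by (auto simp: alpha_def unit_def)
    have be: "beta (unit \<kappa> :: column \<Rightarrow> 'a) k = - (if k = d2 then 1 else 0)" if "k \<in> {..d2}" for k
      using 4 d1_pos d2_pos that by (auto simp: beta_def unit_def)
    have be': "(\<Sum>j\<le>d2. beta (unit \<kappa>) j * f j) = - f d2" for f :: "nat \<Rightarrow> 'a"
    proof -
      have "(\<Sum>j\<le>d2. beta (unit \<kappa>) j * f j) = (\<Sum>j\<le>d2. - ((if j = d2 then 1 else 0) * f j))"
        by (rule sum.cong) (simp_all add: be)
      then show ?thesis by (simp add: sum_negf delta)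
    qed
    show ?thesis unfolding kernel_vector_pairing al be' using d1_pos
      by (simp add: 4 unit_def delta invariant_def)
  next
    case (5 j)
    have al: "alpha (unit \<kappa> :: column \<Rightarrow> 'a) k = 0" for k using 5 by (auto simp: alpha_def unit_def)
    have be: "beta (unit \<kappa> :: column \<Rightarrow> 'a) k = (if k = j then 1 else 0)" for k
      using 5 d1_pos by (auto simp: beta_def unit_def)
    show ?thesis unfolding kernel_vector_pairing al be using 5(2,3)
      by (simp add: 5(1) unit_def delta invariant_def)
  qed
qed

section \<open>Nonnegative combinations with allowed support\<close>

definition allowed :: "column set set" where
  "allowed = {S. S \<subseteq> column_labels d1 d2 \<and>
     (\<forall>i\<in>{0, d1}. \<not> (Col_a1 i \<in> S \<and> Col_a2 i \<in> S)) \<and>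
     (\<forall>j\<in>{0, d2}. \<not> (Col_b1 j \<in> S \<and> Col_b2 j \<in> S)) \<and>
     (\<forall>i. 0 < i \<and> i < d1 \<longrightarrow> \<not> (Col_a1 i \<in> S \<and> Col_a2 i \<in> S \<and> (\<exists>j\<le>d2. Col_u i j \<in> S))) \<and>
     (\<forall>j. 0 < j \<and> j < d2 \<longrightarrow> \<not> (Col_b1 j \<in> S \<and> Col_b2 j \<in> S \<and> (\<exists>i\<le>d1. Col_u i j \<in> S))) \<and>
     (\<forall>i1 i2 j1 j2. i1 < j1 \<and> j1 \<le> d1 \<and> j2 < i2 \<and> i2 \<le> d2 \<longrightarrow> \<not> (Col_u i1 i2 \<in> S \<and> Col_u j1 j2 \<in> S))}"

lemma grid_nonneg:
  fixes c :: "column \<Rightarrow> real"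
  shows "\<forall>\<rho>\<in>column_labels d1 d2. 0 \<le> c \<rho> \<Longrightarrow> 0 \<le> grid c i j"
  by (auto simp: grid_def column_labels_iff)

text \<open>For nonnegative numbers a minimum is 0 iff one entry is, and a sum is 0 iff all terms
  are; this turns conditions on supports into the analytic ones.\<close>

lemma support_allowed_iff:
  fixes c :: "column \<Rightarrow> real"
  assumes nn: "\<forall>\<rho>\<in>column_labels d1 d2. 0 \<le> c \<rho>"
  shows "{\<rho> \<in> column_labels d1 d2. c \<rho> \<noteq> 0} \<in> allowed \<longleftrightarrow>
    line_data d1 (\<lambda>i. c (Col_a1 i)) (\<lambda>i. c (Col_a2 i)) (\<lambda>i. \<Sum>j\<le>d2. grid c i j) \<and>
    line_data d2 (\<lambda>j. c (Col_b1 j)) (\<lambda>j. c (Col_b2 j)) (\<lambda>j. \<Sum>i\<le>d1. grid c i j) \<and>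
    monotone_support d1 d2 (grid c)" (is "_ \<longleftrightarrow> ?A \<and> ?B \<and> ?M")
proof -
  define S where "S = {\<rho> \<in> column_labels d1 d2. c \<rho> \<noteq> 0}"
  have nn': "\<And>i. i \<le> d1 \<Longrightarrow> 0 \<le> c (Col_a1 i) \<and> 0 \<le> c (Col_a2 i)"
    "\<And>j. j \<le> d2 \<Longrightarrow> 0 \<le> c (Col_b1 j) \<and> 0 \<le> c (Col_b2 j)"
    using nn by (auto simp: column_labels_iff)
  have g: "Col_u i j \<in> S \<longleftrightarrow> grid c i j \<noteq> 0" for i j by (simp add: S_def grid_def column_labels_iff)
  have min0: "min x y = 0 \<longleftrightarrow> \<not> (x \<noteq> 0 \<and> y \<noteq> 0)" if "0 \<le> x \<and> 0 \<le> y" for x y :: real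
    using that by (auto simp: min_def)
  have row: "(\<Sum>j\<le>d2. grid c i j) = 0 \<longleftrightarrow> \<not> (\<exists>j\<le>d2. grid c i j \<noteq> 0)" for i
    by (subst sum_nonneg_eq_0_iff) (auto simp: grid_nonneg[OF nn])
  have col: "(\<Sum>i\<le>d1. grid c i j) = 0 \<longleftrightarrow> \<not> (\<exists>i\<le>d1. grid c i j \<noteq> 0)" for j
    by (subst sum_nonneg_eq_0_iff) (auto simp: grid_nonneg[OF nn])
  have A: "?A \<longleftrightarrow> (\<forall>i\<in>{0, d1}. \<not> (Col_a1 i \<in> S \<and> Col_a2 i \<in> S)) \<and>
     (\<forall>i. 0 < i \<and> i < d1 \<longrightarrow> \<not> (Col_a1 i \<in> S \<and> Col_a2 i \<in> S \<and> (\<exists>j\<le>d2. Col_u i j \<in> S)))"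
    unfolding line_data_def g using nn'(1)
    by (auto simp: S_def min0 row column_labels_iff sum_nonneg grid_nonneg[OF nn])
  have B: "?B \<longleftrightarrow> (\<forall>j\<in>{0, d2}. \<not> (Col_b1 j \<in> S \<and> Col_b2 j \<in> S)) \<and>
     (\<forall>j. 0 < j \<and> j < d2 \<longrightarrow> \<not> (Col_b1 j \<in> S \<and> Col_b2 j \<in> S \<and> (\<exists>i\<le>d1. Col_u i j \<in> S)))"
    unfolding line_data_def g using nn'(2)
    by (auto simp: S_def min0 col column_labels_iff sum_nonneg grid_nonneg[OF nn])
  have M: "?M \<longleftrightarrow> (\<forall>i1 i2 j1 j2. i1 < j1 \<and> j1 \<le> d1 \<and> j2 < i2 \<and> i2 \<le> d2 \<longrightarrow>
      \<not> (Col_u i1 i2 \<in> S \<and> Col_u j1 j2 \<in> S))"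
    unfolding monotone_support_def g by blast
  have sub: "S \<subseteq> column_labels d1 d2" by (auto simp: S_def)
  show ?thesis unfolding S_def[symmetric] A B M unfolding allowed_def mem_Collect_eq
    by (simp only: sub simp_thms) (rule iffI; elim conjE; intro conjI; assumption)
qed


lemma coords_mem:
  "i \<le> d1 \<Longrightarrow> Col_a1 i \<in> coords" "j \<le> d2 \<Longrightarrow> Col_b1 j \<in> coords"
  "0 < i \<Longrightarrow> i \<le> d1 \<Longrightarrow> Col_u i 0 \<in> coords" "0 < j \<Longrightarrow> j < d2 \<Longrightarrow> Col_u 0 j \<in> coords"
  by (auto simp: coords_def)

lemma invariant_simps:
  "invariant c (Col_a1 i) = c (Col_a1 i) - c (Col_a2 i)"
  "invariant c (Col_b1 j) = c (Col_b1 j) - c (Col_b2 j)"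
  "0 < i \<Longrightarrow> i < d1 \<Longrightarrow>
    invariant c (Col_u i 0) = (\<Sum>j\<le>d2. grid c i j) + path_laplacian d1 (\<lambda>i. c (Col_a2 i)) i"
  "invariant c (Col_u 0 j) = (\<Sum>i\<le>d1. grid c i j) + path_laplacian d2 (\<lambda>j. c (Col_b2 j)) j"
  "invariant c (Col_u d1 0) = ((\<Sum>j\<le>d2. grid c d1 j) + path_laplacian d1 (\<lambda>i. c (Col_a2 i)) d1)
    - ((\<Sum>i\<le>d1. grid c i d2) + path_laplacian d2 (\<lambda>j. c (Col_b2 j)) d2)"
  using d1_pos by (simp_all add: invariant_def)

lemma sum_atMost_head: "(\<Sum>i\<le>n. f i) = f 0 + (\<Sum>i\<in>{0<..n}. f i)" for f :: "nat \<Rightarrow> real"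
proof -
  have "{..n} = insert 0 {0<..n}" by auto
  then show ?thesis by simp
qed

text \<open>The obstacle problem fixes the \<open>a\<close> and \<open>b\<close> multiplicities and
  the interior marginals. Of the last marginals only the difference is known, but one of them is 0;
  equality of total masses then gives the difference of the first ones. Finally the marginals fix
  the coupling.\<close>

lemma representation_unique:
  fixes c c' :: "column \<Rightarrow> real"
  assumes nn: "\<forall>\<rho>\<in>column_labels d1 d2. 0 \<le> c \<rho>" and supp: "{\<rho> \<in> column_labels d1 d2. c \<rho> \<noteq> 0} \<in> allowed"
    and nn': "\<forall>\<rho>\<in>column_labels d1 d2. 0 \<le> c' \<rho>" and supp': "{\<rho> \<in> column_labels d1 d2. c' \<rho> \<noteq> 0} \<in> allowed"
    and eq: "\<And>\<kappa>. \<kappa> \<in> coords \<Longrightarrow> invariant c \<kappa> = invariant c' \<kappa>"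
    and \<rho>: "\<rho> \<in> column_labels d1 d2"
  shows "c \<rho> = c' \<rho>"
proof -
  have s: "line_data d1 (\<lambda>i. c (Col_a1 i)) (\<lambda>i. c (Col_a2 i)) (\<lambda>i. \<Sum>j\<le>d2. grid c i j)"
    "line_data d2 (\<lambda>j. c (Col_b1 j)) (\<lambda>j. c (Col_b2 j)) (\<lambda>j. \<Sum>i\<le>d1. grid c i j)"
    "monotone_support d1 d2 (grid c)"
    using supp unfolding support_allowed_iff[OF nn] by blast+
  have s': "line_data d1 (\<lambda>i. c' (Col_a1 i)) (\<lambda>i. c' (Col_a2 i)) (\<lambda>i. \<Sum>j\<le>d2. grid c' i j)"
    "line_data d2 (\<lambda>j. c' (Col_b1 j)) (\<lambda>j. c' (Col_b2 j)) (\<lambda>j. \<Sum>i\<le>d1. grid c' i j)"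
    "monotone_support d1 d2 (grid c')"
    using supp' unfolding support_allowed_iff[OF nn'] by blast+
  have da: "c (Col_a1 i) - c (Col_a2 i) = c' (Col_a1 i) - c' (Col_a2 i)" if "i \<le> d1" for i
    using eq[OF coords_mem(1)[OF that]] by (simp add: invariant_simps)
  have db: "c (Col_b1 j) - c (Col_b2 j) = c' (Col_b1 j) - c' (Col_b2 j)" if "j \<le> d2" for j
    using eq[OF coords_mem(2)[OF that]] by (simp add: invariant_simps)
  have ua: "(\<Sum>j\<le>d2. grid c i j) + path_laplacian d1 (\<lambda>i. c (Col_a2 i)) i
      = (\<Sum>j\<le>d2. grid c' i j) + path_laplacian d1 (\<lambda>i. c' (Col_a2 i)) i" if "0 < i" "i < d1" for i
    using eq[OF coords_mem(3)[of i]] that by (simp add: invariant_simps)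
  have ub: "(\<Sum>i\<le>d1. grid c i j) + path_laplacian d2 (\<lambda>j. c (Col_b2 j)) j
      = (\<Sum>i\<le>d1. grid c' i j) + path_laplacian d2 (\<lambda>j. c' (Col_b2 j)) j" if "0 < j" "j < d2" for j
    using eq[OF coords_mem(4)[of j]] that by (simp add: invariant_simps)
  note a = line_data_unique[OF s(1) s'(1) da ua]
  note b = line_data_unique[OF s(2) s'(2) db ub]
  define U V U' V' where "U i = (\<Sum>j\<le>d2. grid c i j)" and "V j = (\<Sum>i\<le>d1. grid c i j)"
    and "U' i = (\<Sum>j\<le>d2. grid c' i j)" and "V' j = (\<Sum>i\<le>d1. grid c' i j)" for i j
  note UV = U_def V_def U'_def V'_def
  have corner: "grid c 0 0 = 0" "grid c d1 d2 = 0" "grid c' 0 0 = 0" "grid c' d1 d2 = 0"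
    by (auto simp: grid_def index_set_iff)
  have min: "min (U 0) (V 0) = 0" "min (U d1) (V d2) = 0"
    unfolding UV by (intro min_sums_eq_0 grid_nonneg[OF nn] s(3) corner)+
  have min': "min (U' 0) (V' 0) = 0" "min (U' d1) (V' d2) = 0"
    unfolding UV by (intro min_sums_eq_0 grid_nonneg[OF nn'] s'(3) corner)+
  have "path_laplacian d1 (\<lambda>i. c (Col_a2 i)) d1 = path_laplacian d1 (\<lambda>i. c' (Col_a2 i)) d1"
    by (intro path_laplacian_cong a(2)) auto
  moreover have "path_laplacian d2 (\<lambda>j. c (Col_b2 j)) d2 = path_laplacian d2 (\<lambda>j. c' (Col_b2 j)) d2"
    by (intro path_laplacian_cong b(2)) auto
  ultimately have "U d1 - V d2 = U' d1 - V' d2"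
    using eq[OF coords_mem(3)[of d1]] d1_pos by (simp add: invariant_simps UV)
  then have end': "U d1 = U' d1" "V d2 = V' d2" using min min' by (auto simp: min_def split: if_splits)
  have U: "U i = U' i" if "0 < i" "i \<le> d1" for i
    using a(3)[of i] end'(1) that by (cases "i = d1") (auto simp: UV)
  have V: "V j = V' j" if "0 < j" "j \<le> d2" for j
    using b(3)[of j] end'(2) that by (cases "j = d2") (auto simp: UV)
  have tot: "(\<Sum>i\<le>d1. U i) = (\<Sum>j\<le>d2. V j)" "(\<Sum>i\<le>d1. U' i) = (\<Sum>j\<le>d2. V' j)"
    unfolding UV by (rule sum.swap)+
  have "(\<Sum>i\<in>{0<..d1}. U i) = (\<Sum>i\<in>{0<..d1}. U' i)" using U by (intro sum.cong) auto
  moreover have "(\<Sum>j\<in>{0<..d2}. V j) = (\<Sum>j\<in>{0<..d2}. V' j)" using V by (intro sum.cong) auto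
  ultimately have "U 0 - V 0 = U' 0 - V' 0" using tot unfolding sum_atMost_head by simp
  then have "U 0 = U' 0" "V 0 = V' 0" using min min' by (auto simp: min_def split: if_splits)
  then have row: "(\<Sum>j\<le>d2. grid c i j) = (\<Sum>j\<le>d2. grid c' i j)" if "i \<le> d1" for i
    using U[of i] that by (cases "i = 0") (auto simp: UV)
  have col: "(\<Sum>i\<le>d1. grid c i j) = (\<Sum>i\<le>d1. grid c' i j)" if "j \<le> d2" for j
    using V[of j] \<open>V 0 = V' 0\<close> that by (cases "j = 0") (auto simp: UV)
  have g: "grid c i j = grid c' i j" if "i \<le> d1" "j \<le> d2" for i j
    by (rule monotone_coupling_unique[OF grid_nonneg[OF nn] s(3) grid_nonneg[OF nn'] s'(3) row col that])
  show ?thesis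
  proof (cases \<rho>)
    case (Col_u i j)
    then have ij: "(i, j) \<in> index_set d1 d2" using \<rho> by (simp add: column_labels_iff)
    then have "i \<le> d1" "j \<le> d2" by (auto simp: index_set_iff)
    from g[OF this] show ?thesis using ij Col_u by (simp add: grid_def)
  qed (use \<rho> a(1,2) b(1,2) in \<open>auto simp: column_labels_iff\<close>)
qed

lemma representation_exists:
  fixes y :: "column \<Rightarrow> real"
  obtains c where "\<forall>\<rho>\<in>column_labels d1 d2. 0 \<le> c \<rho>" "{\<rho> \<in> column_labels d1 d2. c \<rho> \<noteq> 0} \<in> allowed"
    "\<And>\<kappa>. \<kappa> \<in> coords \<Longrightarrow> invariant c \<kappa> = y \<kappa>"
proof -
  obtain a1 a2 U where a: "line_data d1 a1 a2 U" "\<And>i. i \<le> d1 \<Longrightarrow> a1 i - a2 i = y (Col_a1 i)"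
    "\<And>i. 0 < i \<Longrightarrow> i < d1 \<Longrightarrow> U i + path_laplacian d1 a2 i = y (Col_u i 0)"
    using line_data_exists[of d1 "\<lambda>i. y (Col_a1 i)" "\<lambda>i. y (Col_u i 0)"] by blast
  obtain b1 b2 V where b: "line_data d2 b1 b2 V" "\<And>j. j \<le> d2 \<Longrightarrow> b1 j - b2 j = y (Col_b1 j)"
    "\<And>j. 0 < j \<Longrightarrow> j < d2 \<Longrightarrow> V j + path_laplacian d2 b2 j = y (Col_u 0 j)"
    using line_data_exists[of d2 "\<lambda>j. y (Col_b1 j)" "\<lambda>j. y (Col_u 0 j)"] by blast
  \<comment> \<open>The difference of the last marginals prescribed by the coordinate at
    \<open>Col_u d1 0\<close>; splitting it into positive and negative part empties the
    corner.\<close>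
  define g where "g = y (Col_u d1 0) - path_laplacian d1 a2 d1 + path_laplacian d2 b2 d2"
  define U1 where "U1 i = (if i = d1 then max 0 g else U i)" for i
  define V1 where "V1 j = (if j = d2 then max 0 (- g) else V j)" for j
  \<comment> \<open>The imbalance of all other marginals, absorbed by the first ones, again with one
    of them 0.\<close>
  define s where "s = (\<Sum>i\<in>{0<..d1}. U1 i) - (\<Sum>j\<in>{0<..d2}. V1 j)"
  define U2 where "U2 i = (if i = 0 then max 0 (- s) else U1 i)" for i
  define V2 where "V2 j = (if j = 0 then max 0 s else V1 j)" for j
  have U2: "0 \<le> U2 i" if "i \<le> d1" for i
    using a(1) that by (auto simp: U2_def U1_def line_data_def)
  have V2: "0 \<le> V2 j" if "j \<le> d2" for j
    using b(1) that by (auto simp: V2_def V1_def line_data_def)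
  have "(\<Sum>i\<in>{0<..d1}. U2 i) = (\<Sum>i\<in>{0<..d1}. U1 i)" "(\<Sum>j\<in>{0<..d2}. V2 j) = (\<Sum>j\<in>{0<..d2}. V1 j)"
    by (auto intro!: sum.cong simp: U2_def V2_def)
  then have tot: "(\<Sum>i\<le>d1. U2 i) = (\<Sum>j\<le>d2. V2 j)"
    unfolding sum_atMost_head by (simp add: U2_def V2_def s_def max_def)
  obtain u where u: "\<And>i j. i \<le> d1 \<Longrightarrow> j \<le> d2 \<Longrightarrow> 0 \<le> u i j" "monotone_support d1 d2 u"
    "\<And>i. i \<le> d1 \<Longrightarrow> (\<Sum>j\<le>d2. u i j) = U2 i" "\<And>j. j \<le> d2 \<Longrightarrow> (\<Sum>i\<le>d1. u i j) = V2 j"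
    "u 0 0 = min (U2 0) (V2 0)" "u d1 d2 = min (U2 d1) (V2 d2)"
    using monotone_coupling_exists[of d1 U2 d2 V2, OF U2 V2 tot] by blast
  have u0: "u 0 0 = 0" "u d1 d2 = 0"
    using u(5,6) d1_pos d2_pos by (auto simp: U2_def V2_def U1_def V1_def min_def max_def)
  define c where "c \<rho> = (case \<rho> of Col_a1 i \<Rightarrow> a1 i | Col_a2 i \<Rightarrow> a2 i | Col_b1 j \<Rightarrow> b1 j | Col_b2 j \<Rightarrow> b2 j
     | Col_u i j \<Rightarrow> u i j)" for \<rho>
  have c: "c (Col_a1 i) = a1 i" "c (Col_a2 i) = a2 i" "c (Col_b1 j) = b1 j" "c (Col_b2 j) = b2 j"
    "c (Col_u i j) = u i j" for i j by (simp_all add: c_def)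
  have gr: "grid c i j = u i j" if "i \<le> d1" "j \<le> d2" for i j
    using that u0 by (auto simp: grid_def index_set_iff c)
  have row: "(\<Sum>j\<le>d2. grid c i j) = U2 i" if "i \<le> d1" for i
    using u(3)[OF that] gr[OF that] by simp
  have col: "(\<Sum>i\<le>d1. grid c i j) = V2 j" if "j \<le> d2" for j
    using u(4)[OF that] gr[OF _ that] by simp
  have nn: "\<forall>\<rho>\<in>column_labels d1 d2. 0 \<le> c \<rho>"
  proof
    fix \<rho> assume "\<rho> \<in> column_labels d1 d2"
    then show "0 \<le> c \<rho>"
      using a(1) b(1) u(1) by (cases \<rho>) (auto simp: column_labels_iff index_set_iff c line_data_def)
  qed
  show ?thesis
  proof (rule that[OF nn])
    have int_a: "(\<Sum>j\<le>d2. grid c i j) = U i" if "0 < i" "i < d1" for i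
      using row[of i] that by (simp add: U2_def U1_def)
    have int_b: "(\<Sum>i\<le>d1. grid c i j) = V j" if "0 < j" "j < d2" for j
      using col[of j] that by (simp add: V2_def V1_def)
    have "line_data d1 (\<lambda>i. c (Col_a1 i)) (\<lambda>i. c (Col_a2 i)) (\<lambda>i. \<Sum>j\<le>d2. grid c i j)"
      using a(1) int_a unfolding line_data_def c by simp
    moreover have "line_data d2 (\<lambda>j. c (Col_b1 j)) (\<lambda>j. c (Col_b2 j)) (\<lambda>j. \<Sum>i\<le>d1. grid c i j)"
      using b(1) int_b unfolding line_data_def c by simp
    moreover have "monotone_support d1 d2 (grid c)"
      using u(2) unfolding monotone_support_def by (simp add: gr)
    ultimately show "{\<rho> \<in> column_labels d1 d2. c \<rho> \<noteq> 0} \<in> allowed"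
      unfolding support_allowed_iff[OF nn] by blast
    fix \<kappa> assume "\<kappa> \<in> coords"
    then show "invariant c \<kappa> = y \<kappa>"
    proof (cases rule: coords_cases)
      case (1 i)
      then show ?thesis using a(2) by (simp add: invariant_simps c)
    next
      case (2 j)
      then show ?thesis using b(2) by (simp add: invariant_simps c)
    next
      case (3 i)
      then show ?thesis using a(3) int_a by (simp add: invariant_simps c)
    next
      case 4
      have "U2 d1 - V2 d2 = g" using d1_pos d2_pos by (simp add: U2_def V2_def U1_def V1_def max_def)
      then show ?thesis unfolding 4 invariant_simps(5) row[OF order_refl] col[OF order_refl] c
        by (simp add: g_def)
    next
      case (5 j)
      then show ?thesis using b(3) int_b by (simp add: invariant_simps c)
    qed
  qed
qed

section \<open>Rows of the weight matrix and its kernel\<close>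

lemma z_part_row:
  assumes "i' \<le> d1" "j' \<le> d2" "i \<le> d1"
  shows "z_part d1 d2 i' j' (Row_z i) =
    (if j' = 0 then (if i' = i \<and> 0 < i \<and> i < d1 then 1 else 0) - (if i' = i + 1 then 1 else 0) else 0) +
    (if j' = d2 then (if i' = i \<and> 0 < i \<and> i < d1 then 1 else 0) - (if i' + 1 = i then 1 else 0) else 0)"
  using assms d1_pos d2_pos unfolding z_part_def basis_entry_def row.inject
  by (cases "j' = 0"; cases "j' = d2"; cases "i' = 0"; cases "i' = d1"; simp; arith?)

lemma w_part_row:
  assumes "i' \<le> d1" "j' \<le> d2" "j \<le> d2"
  shows "w_part d1 d2 i' j' (Row_w j) =
    (if i' = 0 then (if j' = j \<and> 0 < j \<and> j < d2 then 1 else 0) - (if j' = j + 1 then 1 else 0) else 0) +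
    (if i' = d1 then (if j' = j \<and> 0 < j \<and> j < d2 then 1 else 0) - (if j' + 1 = j then 1 else 0) else 0)"
  using assms d1_pos d2_pos unfolding w_part_def basis_entry_def row.inject
  by (cases "i' = 0"; cases "i' = d1"; cases "j' = 0"; cases "j' = d2"; simp; arith?)

lemma weight_parts:
  "z_part d1 d2 i' j' (Row_w j) = 0" "z_part d1 d2 i' j' (Row_f p q) = 0"
  "w_part d1 d2 i' j' (Row_z i) = 0" "w_part d1 d2 i' j' (Row_f p q) = 0"
  "f_part i' j' (Row_z i) = 0" "f_part i' j' (Row_w j) = 0"
  by (auto simp: z_part_def w_part_def f_part_def basis_entry_def)

lemma sum_delta_atMost:
  fixes f :: "nat \<Rightarrow> int"
  shows "(\<Sum>i\<le>n. (if i = k \<and> Q then 1 else 0) * f i) = (if k \<le> n \<and> Q then f k else 0)"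
    "(\<Sum>i\<le>n. (if i = k then 1 else 0) * f i) = (if k \<le> n then f k else 0)"
    "(\<Sum>i\<le>n. (if i + 1 = k then 1 else 0) * f i) = (if 0 < k \<and> k \<le> n + 1 then f (k - 1) else 0)"
proof -
  have *: "(\<Sum>i\<le>n. (if i = k then 1 else 0) * f i) = (if k \<le> n then f k else 0)" for k
    by (simp add: if_distrib[of "\<lambda>x. x * _"] cong: if_cong)
  show "(\<Sum>i\<le>n. (if i = k then 1 else 0) * f i) = (if k \<le> n then f k else 0)" by (rule *)
  show "(\<Sum>i\<le>n. (if i = k \<and> Q then 1 else 0) * f i) = (if k \<le> n \<and> Q then f k else 0)"
    using * by (cases Q) auto
  show "(\<Sum>i\<le>n. (if i + 1 = k then 1 else 0) * f i) = (if 0 < k \<and> k \<le> n + 1 then f (k - 1) else 0)"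
  proof (cases k)
    case (Suc l)
    then show ?thesis using *[of l] by simp
  qed simp
qed

text \<open>\<open>z_part_row\<close> splits the weights into contributions of the edges
  \<open>j' = 0\<close> and \<open>j' = d2\<close>, both 0 at the missing corners, so only sums of
  deltas remain.\<close>

lemma z_row_sum:
  fixes e :: "column \<Rightarrow> int"
  assumes i: "i \<le> d1"
  shows "(\<Sum>\<rho>\<in>column_labels d1 d2. weight d1 d2 (Row_z i) \<rho> * e \<rho>) = e (Col_a1 i) + e (Col_a2 i)
    + (if 0 < i \<and> i < d1 then grid e i 0 + grid e i d2 else 0)
    - (if i < d1 then grid e (i + 1) 0 else 0) - (if 0 < i then grid e (i - 1) d2 else 0)"
proof -
  let ?Q = "0 < i \<and> i < d1"
  have g: "grid (\<lambda>\<rho>. weight d1 d2 (Row_z i) \<rho> * e \<rho>) i' j' =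
      (if j' = 0 then ((if i' = i \<and> ?Q then 1 else 0) - (if i' = i + 1 then 1 else 0)) * grid e i' 0 else 0) +
      (if j' = d2 then ((if i' = i \<and> ?Q then 1 else 0) - (if i' + 1 = i then 1 else 0)) * grid e i' d2 else 0)"
    if "i' \<le> d1" "j' \<le> d2" for i' j'
    using d2_pos by (auto simp: grid_def weight_parts z_part_row[OF that i])
  have 1: "(\<Sum>i'\<le>d1. \<Sum>j'\<le>d2. grid (\<lambda>\<rho>. weight d1 d2 (Row_z i) \<rho> * e \<rho>) i' j') =
     (\<Sum>i'\<le>d1. ((if i' = i \<and> ?Q then 1 else 0) - (if i' = i + 1 then 1 else 0)) * grid e i' 0
       + ((if i' = i \<and> ?Q then 1 else 0) - (if i' + 1 = i then 1 else 0)) * grid e i' d2)"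
  proof (rule sum.cong[OF refl])
    fix i' assume "i' \<in> {..d1}"
    then have "(\<Sum>j'\<le>d2. grid (\<lambda>\<rho>. weight d1 d2 (Row_z i) \<rho> * e \<rho>) i' j') = (\<Sum>j'\<le>d2.
      (if j' = 0 then ((if i' = i \<and> ?Q then 1 else 0) - (if i' = i + 1 then 1 else 0)) * grid e i' 0 else 0) +
      (if j' = d2 then ((if i' = i \<and> ?Q then 1 else 0) - (if i' + 1 = i then 1 else 0)) * grid e i' d2 else 0))"
      by (intro sum.cong[OF refl] g) auto
    then show "(\<Sum>j'\<le>d2. grid (\<lambda>\<rho>. weight d1 d2 (Row_z i) \<rho> * e \<rho>) i' j') =
      ((if i' = i \<and> ?Q then 1 else 0) - (if i' = i + 1 then 1 else 0)) * grid e i' 0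
       + ((if i' = i \<and> ?Q then 1 else 0) - (if i' + 1 = i then 1 else 0)) * grid e i' d2"
      by (simp only: sum.distrib) (simp add: sum.delta)
  qed
  have 2: "(\<Sum>k\<le>d1. basis_entry (Row_z k) (Row_z i) * f k) = f i" for f :: "nat \<Rightarrow> int"
    using i sum_delta_atMost(2)[where n = d1 and k = i and f = f] by (simp add: basis_entry_def eq_commute)
  have 3: "basis_entry (Row_w k) (Row_z i) = 0" for k by (simp add: basis_entry_def)
  show ?thesis
    unfolding sum_columns 1 left_diff_distrib sum.distrib sum_subtractf sum_delta_atMost
    using i by (auto simp: 2 3)
qed

lemma w_row_sum:
  fixes e :: "column \<Rightarrow> int"
  assumes j: "j \<le> d2"
  shows "(\<Sum>\<rho>\<in>column_labels d1 d2. weight d1 d2 (Row_w j) \<rho> * e \<rho>) = e (Col_b1 j) + e (Col_b2 j)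
    + (if 0 < j \<and> j < d2 then grid e 0 j + grid e d1 j else 0)
    - (if j < d2 then grid e 0 (j + 1) else 0) - (if 0 < j then grid e d1 (j - 1) else 0)"
proof -
  let ?Q = "0 < j \<and> j < d2"
  have g: "grid (\<lambda>\<rho>. weight d1 d2 (Row_w j) \<rho> * e \<rho>) i' j' =
      (if i' = 0 then ((if j' = j \<and> ?Q then 1 else 0) - (if j' = j + 1 then 1 else 0)) * grid e 0 j' else 0) +
      (if i' = d1 then ((if j' = j \<and> ?Q then 1 else 0) - (if j' + 1 = j then 1 else 0)) * grid e d1 j' else 0)"
    if "i' \<le> d1" "j' \<le> d2" for i' j'
    using d1_pos by (auto simp: grid_def weight_parts w_part_row[OF that j])
  have 1: "(\<Sum>j'\<le>d2. \<Sum>i'\<le>d1. grid (\<lambda>\<rho>. weight d1 d2 (Row_w j) \<rho> * e \<rho>) i' j') =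
     (\<Sum>j'\<le>d2. ((if j' = j \<and> ?Q then 1 else 0) - (if j' = j + 1 then 1 else 0)) * grid e 0 j'
       + ((if j' = j \<and> ?Q then 1 else 0) - (if j' + 1 = j then 1 else 0)) * grid e d1 j')"
  proof (rule sum.cong[OF refl])
    fix j' assume "j' \<in> {..d2}"
    then have "(\<Sum>i'\<le>d1. grid (\<lambda>\<rho>. weight d1 d2 (Row_w j) \<rho> * e \<rho>) i' j') = (\<Sum>i'\<le>d1.
      (if i' = 0 then ((if j' = j \<and> ?Q then 1 else 0) - (if j' = j + 1 then 1 else 0)) * grid e 0 j' else 0) +
      (if i' = d1 then ((if j' = j \<and> ?Q then 1 else 0) - (if j' + 1 = j then 1 else 0)) * grid e d1 j' else 0))"
      by (intro sum.cong[OF refl] g) auto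
    then show "(\<Sum>i'\<le>d1. grid (\<lambda>\<rho>. weight d1 d2 (Row_w j) \<rho> * e \<rho>) i' j') =
      ((if j' = j \<and> ?Q then 1 else 0) - (if j' = j + 1 then 1 else 0)) * grid e 0 j'
       + ((if j' = j \<and> ?Q then 1 else 0) - (if j' + 1 = j then 1 else 0)) * grid e d1 j'"
      by (simp only: sum.distrib) (simp add: sum.delta)
  qed
  have 2: "(\<Sum>k\<le>d2. basis_entry (Row_w k) (Row_w j) * f k) = f j" for f :: "nat \<Rightarrow> int"
    using j sum_delta_atMost(2)[where n = d2 and k = j and f = f] by (simp add: basis_entry_def eq_commute)
  have 3: "basis_entry (Row_z k) (Row_w j) = 0" for k by (simp add: basis_entry_def)
  have swap: "(\<Sum>i'\<le>d1. \<Sum>j'\<le>d2. grid (\<lambda>\<rho>. weight d1 d2 (Row_w j) \<rho> * e \<rho>) i' j') =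
      (\<Sum>j'\<le>d2. \<Sum>i'\<le>d1. grid (\<lambda>\<rho>. weight d1 d2 (Row_w j) \<rho> * e \<rho>) i' j')" by (rule sum.swap)
  show ?thesis
    unfolding sum_columns swap 1 left_diff_distrib sum.distrib sum_subtractf sum_delta_atMost
    using j by (auto simp: 2 3)
qed

text \<open>Up to sign these rows are the mixed second differences of the grid; the zero extension
  covers the cells at the missing corners.\<close>

lemma f_row_sum:
  fixes e :: "column \<Rightarrow> int"
  assumes p: "p < d1" and q: "q < d2"
  shows "(\<Sum>\<rho>\<in>column_labels d1 d2. weight d1 d2 (Row_f (Suc p) (Suc q)) \<rho> * e \<rho>) =
    grid e p (Suc q) + grid e (Suc p) q - grid e p q - grid e (Suc p) (Suc q)"
proof -
  have g: "grid (\<lambda>\<rho>. weight d1 d2 (Row_f (Suc p) (Suc q)) \<rho> * e \<rho>) i j =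
      (if i = p then (if j = Suc q then grid e p (Suc q) else 0) - (if j = q then grid e p q else 0) else 0) +
      (if i = Suc p then (if j = q then grid e (Suc p) q else 0) - (if j = Suc q then grid e (Suc p) (Suc q) else 0) else 0)" for i j
    by (auto simp: grid_def weight_parts f_part_def)
  have "(\<Sum>j\<le>d2. grid (\<lambda>\<rho>. weight d1 d2 (Row_f (Suc p) (Suc q)) \<rho> * e \<rho>) i j) =
      (if i = p then grid e p (Suc q) - grid e p q else 0) +
      (if i = Suc p then grid e (Suc p) q - grid e (Suc p) (Suc q) else 0)" for i
    unfolding g using q by (auto simp: sum_subtractf sum.delta)
  then have "(\<Sum>i\<le>d1. \<Sum>j\<le>d2. grid (\<lambda>\<rho>. weight d1 d2 (Row_f (Suc p) (Suc q)) \<rho> * e \<rho>) i j) =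
      (grid e p (Suc q) - grid e p q) + (grid e (Suc p) q - grid e (Suc p) (Suc q))"
    using p by (simp add: sum.distrib sum.delta)
  then show ?thesis unfolding sum_columns by (simp add: basis_entry_def)
qed

text \<open>Vanishing mixed differences make the grid a sum of a function of \<open>i\<close> and
  one of \<open>j\<close>; given this, the other rows say that the sums of the \<open>a\<close> and
  \<open>b\<close> pairs are Laplacians.\<close>

lemma kernel_iff:
  fixes e :: "column \<Rightarrow> int"
  shows "(\<forall>\<mu>\<in>row_labels d1 d2. (\<Sum>\<rho>\<in>column_labels d1 d2. weight d1 d2 \<mu> \<rho> * e \<rho>) = 0) \<longleftrightarrow>
    (\<forall>\<rho>\<in>column_labels d1 d2. e \<rho> = kernel_vector e \<rho>)" (is "?L \<longleftrightarrow> ?R")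
proof
  have corner: "grid e 0 0 = 0" "grid e d1 d2 = 0" by (auto simp: grid_def index_set_iff)
  {
    assume ?L
    then have z: "(\<Sum>\<rho>\<in>column_labels d1 d2. weight d1 d2 (Row_z i) \<rho> * e \<rho>) = 0" if "i \<le> d1" for i
      using that by (auto simp: row_labels_def)
    from \<open>?L\<close> have w: "(\<Sum>\<rho>\<in>column_labels d1 d2. weight d1 d2 (Row_w j) \<rho> * e \<rho>) = 0" if "j \<le> d2" for j
      using that by (auto simp: row_labels_def)
    have "Row_f (Suc p) (Suc q) \<in> row_labels d1 d2" if "p < d1" "q < d2" for p q
      using that by (auto simp: row_labels_def image_iff)
    with \<open>?L\<close> have f: "grid e (Suc p) (Suc q) = grid e p (Suc q) + grid e (Suc p) q - grid e p q"
      if "p < d1" "q < d2" for p q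
      using that f_row_sum[OF that, of e] by simp
    have step: "grid e (Suc p) q - grid e p q = grid e (Suc p) 0 - grid e p 0" if "p < d1" "q \<le> d2" for p q
      using that(2)
    proof (induction q)
      case (Suc q)
      then show ?case using f[OF that(1), of q] by simp
    qed simp
    have add: "grid e p q = grid e p 0 + grid e 0 q" if "p \<le> d1" "q \<le> d2" for p q
      using that(1)
    proof (induction p)
      case (Suc p)
      then show ?case using step[of p q] that(2) by simp
    qed (simp add: corner)
    have al: "grid e i 0 = alpha e i" if "i \<le> d1" for i
      using that d2_pos by (auto simp: grid_def alpha_def index_set_iff)
    have be: "grid e 0 j = beta e j" if "j \<le> d2" for j
    proof (cases "j = d2")
      case True
      have "grid e d1 0 + grid e 0 d2 = 0" using add[of d1 d2] corner by simp
      then show ?thesis using True d1_pos d2_pos by (simp add: beta_def grid_def index_set_iff)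
    next
      case False
      then show ?thesis using that d1_pos by (auto simp: grid_def beta_def index_set_iff)
    qed
    have ab: "grid e i j = alpha e i + beta e j" if "i \<le> d1" "j \<le> d2" for i j
      using add[OF that] al[OF that(1)] be[OF that(2)] by simp
    have ends: "alpha e 0 = 0" "beta e 0 = 0" "alpha e d1 + beta e d2 = 0"
      using ab[of d1 d2] corner by (auto simp: alpha_def beta_def)
    show ?R
    proof
      fix \<rho> assume r: "\<rho> \<in> column_labels d1 d2"
      show "e \<rho> = kernel_vector e \<rho>"
      proof (cases \<rho>)
        case (Col_a2 i)
        then have i: "i \<le> d1" using r by (simp add: column_labels_iff)
        \<comment> \<open>The terms \<open>beta e d2\<close> cancel for interior \<open>i\<close>;
          at \<open>i = d1\<close> the one that is left equals \<open>- alpha e d1\<close> and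
          supplies the end term of the Laplacian.\<close>
        have g: "grid e i 0 = alpha e i" "grid e i d2 = alpha e i + beta e d2"
          "i < d1 \<Longrightarrow> grid e (i + 1) 0 = alpha e (i + 1)" "grid e (i - 1) d2 = alpha e (i - 1) + beta e d2"
          using ab[of i 0] ab[of i d2] ab[of "i + 1" 0] ab[of "i - 1" d2] i ends by auto
        have "e (Col_a1 i) + e (Col_a2 i) = path_laplacian d1 (alpha e) i"
          using z[OF i] unfolding z_row_sum[OF i] path_laplacian_def
          using g ends i by (cases "i = d1") (auto simp: eq_neg_iff_add_eq_0)
        then show ?thesis by (simp add: Col_a2)
      next
        case (Col_b2 j)
        then have j: "j \<le> d2" using r by (simp add: column_labels_iff)
        have g: "grid e 0 j = beta e j" "grid e d1 j = alpha e d1 + beta e j"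
          "j < d2 \<Longrightarrow> grid e 0 (j + 1) = beta e (j + 1)" "grid e d1 (j - 1) = alpha e d1 + beta e (j - 1)"
          using ab[of 0 j] ab[of d1 j] ab[of 0 "j + 1"] ab[of d1 "j - 1"] j ends by auto
        have "e (Col_b1 j) + e (Col_b2 j) = path_laplacian d2 (beta e) j"
          using w[OF j] unfolding w_row_sum[OF j] path_laplacian_def
          using g ends j by (cases "j = d2") (auto simp: eq_neg_iff_add_eq_0)
        then show ?thesis by (simp add: Col_b2)
      next
        case (Col_u i j)
        then have "(i, j) \<in> index_set d1 d2" using r by (simp add: column_labels_iff)
        then show ?thesis using ab[of i j] Col_u by (auto simp: grid_def index_set_iff)
      qed simp_all
    qed
  }
  assume R: ?R
  have ends: "alpha e 0 = 0" "beta e 0 = 0" "alpha e d1 + beta e d2 = 0"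
    using d1_pos d2_pos by (auto simp: alpha_def beta_def)
  have ab: "grid e i j = alpha e i + beta e j" if "i \<le> d1" "j \<le> d2" for i j
  proof (cases "(i, j) \<in> index_set d1 d2")
    case True
    then have "e (Col_u i j) = alpha e i + beta e j"
      using bspec[OF R, of "Col_u i j"] by (simp add: column_labels_iff)
    then show ?thesis using True by (simp add: grid_def)
  next
    case False
    then show ?thesis using ends that by (auto simp: grid_def index_set_iff)
  qed
  show ?L
  proof
    fix \<mu> assume "\<mu> \<in> row_labels d1 d2"
    then consider i where "\<mu> = Row_z i" "i \<le> d1" | j where "\<mu> = Row_w j" "j \<le> d2"
      | p q where "\<mu> = Row_f (Suc p) (Suc q)" "p < d1" "q < d2"
      by (auto simp: row_labels_def) (metis Suc_le_D Suc_le_lessD)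
    then show "(\<Sum>\<rho>\<in>column_labels d1 d2. weight d1 d2 \<mu> \<rho> * e \<rho>) = 0"
    proof cases
      case (1 i)
      have e: "e (Col_a1 i) + e (Col_a2 i) = path_laplacian d1 (alpha e) i"
        using bspec[OF R, of "Col_a2 i"] 1(2) by (simp add: column_labels_iff)
      have g: "grid e i 0 = alpha e i" "grid e i d2 = alpha e i + beta e d2"
          "i < d1 \<Longrightarrow> grid e (i + 1) 0 = alpha e (i + 1)" "grid e (i - 1) d2 = alpha e (i - 1) + beta e d2"
          using ab[of i 0] ab[of i d2] ab[of "i + 1" 0] ab[of "i - 1" d2] 1(2) ends by auto
      show ?thesis unfolding 1(1) z_row_sum[OF 1(2)] e path_laplacian_def
        using g ends 1(2) by (cases "i = d1") auto
    next
      case (2 j)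
      have e: "e (Col_b1 j) + e (Col_b2 j) = path_laplacian d2 (beta e) j"
        using bspec[OF R, of "Col_b2 j"] 2(2) by (simp add: column_labels_iff)
      have g: "grid e 0 j = beta e j" "grid e d1 j = alpha e d1 + beta e j"
          "j < d2 \<Longrightarrow> grid e 0 (j + 1) = beta e (j + 1)" "grid e d1 (j - 1) = alpha e d1 + beta e (j - 1)"
          using ab[of 0 j] ab[of d1 j] ab[of 0 "j + 1"] ab[of d1 "j - 1"] 2(2) ends by auto
      show ?thesis unfolding 2(1) w_row_sum[OF 2(2)] e path_laplacian_def
        using g ends 2(2) by (cases "j = d2") auto
    next
      case (3 p q)
      then show ?thesis unfolding 3(1) f_row_sum[OF 3(2,3)]
        using ab[of p q] ab[of "Suc p" q] ab[of p "Suc q"] ab[of "Suc p" "Suc q"] by simp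
    qed
  qed
qed


section \<open>The rays as Gale dual of the weight matrix\<close>

lemma kernel_vector_cong:
  assumes z: "\<And>\<kappa>. \<kappa> \<in> coords \<Longrightarrow> z \<kappa> = z' \<kappa>" and \<rho>: "\<rho> \<in> column_labels d1 d2"
  shows "kernel_vector z \<rho> = kernel_vector z' \<rho>"
proof -
  have al: "alpha z i = alpha z' i" if "i \<le> d1" for i
    using z[OF coords_mem(3)] that by (simp add: alpha_def)
  have be: "beta z j = beta z' j" if "j \<le> d2" for j
    using z[OF coords_mem(4)] z[OF coords_mem(3), of d1] d1_pos that by (simp add: beta_def)
  show ?thesis
  proof (cases \<rho>)
    case (Col_a2 i)
    then have i: "i \<le> d1" using \<rho> by (simp add: column_labels_iff)
    have "path_laplacian d1 (alpha z) i = path_laplacian d1 (alpha z') i"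
      using al i by (rule path_laplacian_cong)
    then show ?thesis using z[OF coords_mem(1)[OF i]] Col_a2 by simp
  next
    case (Col_b2 j)
    then have j: "j \<le> d2" using \<rho> by (simp add: column_labels_iff)
    have "path_laplacian d2 (beta z) j = path_laplacian d2 (beta z') j"
      using be j by (rule path_laplacian_cong)
    then show ?thesis using z[OF coords_mem(2)[OF j]] Col_b2 by simp
  next
    case (Col_u i j)
    then show ?thesis using al[of i] be[of j] \<rho> by (auto simp: column_labels_iff index_set_iff)
  qed (use z coords_mem \<rho> in \<open>auto simp: column_labels_iff\<close>)
qed

lemma kernel_vector_coords: "\<kappa> \<in> coords \<Longrightarrow> kernel_vector z \<kappa> = z \<kappa>"
  using d1_pos by (elim coords_cases) (auto simp: alpha_def beta_def)

lemma kernel_vector_of_int: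
  "kernel_vector (\<lambda>\<kappa>. of_int (e \<kappa>)) \<rho> = (of_int (kernel_vector e \<rho>) :: 'a::comm_ring_1)"
  by (cases \<rho>) (auto simp: alpha_def beta_def path_laplacian_def)

lemma kernel_vector_sum:
  "kernel_vector (\<lambda>\<kappa>. \<Sum>k\<in>K. a k * z k \<kappa>) \<rho> = (\<Sum>k\<in>K. a k * kernel_vector (z k) \<rho>)"
proof -
  have al: "alpha (\<lambda>\<kappa>. \<Sum>k\<in>K. a k * z k \<kappa>) = (\<lambda>i. \<Sum>k\<in>K. a k * alpha (z k) i)"
    by (rule ext) (simp add: alpha_def)
  have be: "beta (\<lambda>\<kappa>. \<Sum>k\<in>K. a k * z k \<kappa>) = (\<lambda>i. \<Sum>k\<in>K. a k * beta (z k) i)"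
    by (rule ext) (simp add: beta_def sum_negf)
  have lap: "path_laplacian d (\<lambda>i. \<Sum>k\<in>K. a k * f k i) i = (\<Sum>k\<in>K. a k * path_laplacian d (f k) i)" for d f i
    by (simp add: path_laplacian_def sum_subtractf[symmetric] sum.distrib[symmetric] algebra_simps)
  show ?thesis
    by (cases \<rho>) (simp_all add: al be lap sum_subtractf sum.distrib algebra_simps)
qed

text \<open>The rays are the columns of the matrix whose rows are the basis vectors of the
  kernel.\<close>

definition ray :: "('n \<Rightarrow> column) \<Rightarrow> column \<Rightarrow> real ^ 'n" where
  "ray \<iota> \<rho> = (\<chi> k. kernel_vector (unit (\<iota> k)) \<rho>)"

lemma ray_combination:
  fixes \<iota> :: "'n::finite \<Rightarrow> column"
  assumes \<iota>: "bij_betw \<iota> UNIV coords"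
  shows "(\<Sum>\<rho>\<in>column_labels d1 d2. c \<rho> *\<^sub>R ray \<iota> \<rho>) $ k = invariant c (\<iota> k)"
proof -
  have "\<iota> k \<in> coords" using \<iota> by (auto simp: bij_betw_def)
  from kernel_vector_unit_pairing[OF this, of c] show ?thesis by (simp add: ray_def)
qed

text \<open>A product vanishes iff some factor does, so the open conditions depend on the zero set
  only; none of them involves a missing corner.\<close>

lemma allowed_stable_points:
  "stable_points d1 d2 = {x \<in> affine_space d1 d2. {\<rho> \<in> column_labels d1 d2. x \<rho> = 0} \<in> allowed}"
proof -
  have "x \<in> stable_points d1 d2 \<longleftrightarrow> {\<rho> \<in> column_labels d1 d2. x \<rho> = 0} \<in> allowed"
    if x: "x \<in> affine_space d1 d2" for x
  proof -
    define Z where "Z = {\<rho> \<in> column_labels d1 d2. x \<rho> = 0}"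
    have Za: "Col_a1 i \<in> Z \<longleftrightarrow> x (Col_a1 i) = 0" "Col_a2 i \<in> Z \<longleftrightarrow> x (Col_a2 i) = 0" if "i \<le> d1" for i
      using that by (auto simp: Z_def column_labels_iff)
    have Zb: "Col_b1 j \<in> Z \<longleftrightarrow> x (Col_b1 j) = 0" "Col_b2 j \<in> Z \<longleftrightarrow> x (Col_b2 j) = 0" if "j \<le> d2" for j
      using that by (auto simp: Z_def column_labels_iff)
    have Zu: "Col_u i j \<in> Z \<longleftrightarrow> x (Col_u i j) = 0" if "i \<le> d1" "j \<le> d2" "(i, j) \<noteq> (0, 0)" "(i, j) \<noteq> (d1, d2)" for i j
      using that by (auto simp: Z_def column_labels_iff index_set_iff)
    have 1: "(x (Col_a1 i), x (Col_a2 i), \<Prod>j=0..d2. x (Col_u i j)) \<noteq> (0, 0, 0) \<longleftrightarrow>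
        \<not> (Col_a1 i \<in> Z \<and> Col_a2 i \<in> Z \<and> (\<exists>j\<le>d2. Col_u i j \<in> Z))" if "0 < i" "i < d1" for i
    proof -
      have "(\<Prod>j=0..d2. x (Col_u i j)) = 0 \<longleftrightarrow> (\<exists>j\<le>d2. Col_u i j \<in> Z)"
        using that by (auto simp: Zu)
      then show ?thesis using Za[of i] that by auto
    qed
    have 2: "(x (Col_b1 j), x (Col_b2 j), \<Prod>i=0..d1. x (Col_u i j)) \<noteq> (0, 0, 0) \<longleftrightarrow>
        \<not> (Col_b1 j \<in> Z \<and> Col_b2 j \<in> Z \<and> (\<exists>i\<le>d1. Col_u i j \<in> Z))" if "0 < j" "j < d2" for j
    proof -
      have "(\<Prod>i=0..d1. x (Col_u i j)) = 0 \<longleftrightarrow> (\<exists>i\<le>d1. Col_u i j \<in> Z)"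
        using that by (auto simp: Zu)
      then show ?thesis using Zb[of j] that by auto
    qed
    have 3: "(x (Col_u i1 i2), x (Col_u j1 j2)) \<noteq> (0, 0) \<longleftrightarrow> \<not> (Col_u i1 i2 \<in> Z \<and> Col_u j1 j2 \<in> Z)"
      if "i1 < j1 \<and> j1 \<le> d1 \<and> j2 < i2 \<and> i2 \<le> d2" for i1 i2 j1 j2
      using that Zu[of i1 i2] Zu[of j1 j2] by auto
    have 4: "(x (Col_a1 i), x (Col_a2 i)) \<noteq> (0, 0) \<longleftrightarrow> \<not> (Col_a1 i \<in> Z \<and> Col_a2 i \<in> Z)" if "i \<le> d1" for i
      using Za[OF that] by auto
    have 5: "(x (Col_b1 j), x (Col_b2 j)) \<noteq> (0, 0) \<longleftrightarrow> \<not> (Col_b1 j \<in> Z \<and> Col_b2 j \<in> Z)" if "j \<le> d2" for j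
      using Zb[OF that] by auto
    have i: "(1 \<le> i \<and> i \<le> d1 - 1) \<longleftrightarrow> 0 < i \<and> i < d1" "(1 \<le> i \<and> i \<le> d2 - 1) \<longleftrightarrow> 0 < i \<and> i < d2" for i
      using d1_pos d2_pos by auto
    have sub: "Z \<subseteq> column_labels d1 d2" by (auto simp: Z_def)
    have lhs: "x \<in> stable_points d1 d2 \<longleftrightarrow>
      (\<not> (Col_a1 0 \<in> Z \<and> Col_a2 0 \<in> Z)) \<and> (\<not> (Col_a1 d1 \<in> Z \<and> Col_a2 d1 \<in> Z)) \<and>
      (\<not> (Col_b1 0 \<in> Z \<and> Col_b2 0 \<in> Z)) \<and> (\<not> (Col_b1 d2 \<in> Z \<and> Col_b2 d2 \<in> Z)) \<and>
      (\<forall>i. 0 < i \<and> i < d1 \<longrightarrow> \<not> (Col_a1 i \<in> Z \<and> Col_a2 i \<in> Z \<and> (\<exists>j\<le>d2. Col_u i j \<in> Z))) \<and>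
      (\<forall>j. 0 < j \<and> j < d2 \<longrightarrow> \<not> (Col_b1 j \<in> Z \<and> Col_b2 j \<in> Z \<and> (\<exists>i\<le>d1. Col_u i j \<in> Z))) \<and>
      (\<forall>i1 i2 j1 j2. i1 < j1 \<and> j1 \<le> d1 \<and> j2 < i2 \<and> i2 \<le> d2 \<longrightarrow> \<not> (Col_u i1 i2 \<in> Z \<and> Col_u j1 j2 \<in> Z))"
      unfolding stable_points_def mem_Collect_eq i using 1 2 3
      by (simp only: x 4[OF le0] 4[OF order_refl] 5[OF le0] 5[OF order_refl] simp_thms cong: imp_cong)
    have rhs: "Z \<in> allowed \<longleftrightarrow>
      (\<not> (Col_a1 0 \<in> Z \<and> Col_a2 0 \<in> Z)) \<and> (\<not> (Col_a1 d1 \<in> Z \<and> Col_a2 d1 \<in> Z)) \<and>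
      (\<not> (Col_b1 0 \<in> Z \<and> Col_b2 0 \<in> Z)) \<and> (\<not> (Col_b1 d2 \<in> Z \<and> Col_b2 d2 \<in> Z)) \<and>
      (\<forall>i. 0 < i \<and> i < d1 \<longrightarrow> \<not> (Col_a1 i \<in> Z \<and> Col_a2 i \<in> Z \<and> (\<exists>j\<le>d2. Col_u i j \<in> Z))) \<and>
      (\<forall>j. 0 < j \<and> j < d2 \<longrightarrow> \<not> (Col_b1 j \<in> Z \<and> Col_b2 j \<in> Z \<and> (\<exists>i\<le>d1. Col_u i j \<in> Z))) \<and>
      (\<forall>i1 i2 j1 j2. i1 < j1 \<and> j1 \<le> d1 \<and> j2 < i2 \<and> i2 \<le> d2 \<longrightarrow> \<not> (Col_u i1 i2 \<in> Z \<and> Col_u j1 j2 \<in> Z))"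
      unfolding allowed_def mem_Collect_eq ball_simps by (simp only: sub simp_thms conj_assoc)
    show ?thesis unfolding lhs Z_def[symmetric] rhs ..
  qed
  moreover have "stable_points d1 d2 \<subseteq> affine_space d1 d2" by (auto simp: stable_points_def)
  ultimately show ?thesis by blast
qed

lemma cox_data_bidegree:
  fixes \<iota> :: "'n::finite \<Rightarrow> column"
  assumes \<iota>: "bij_betw \<iota> UNIV coords"
  shows "cox_data (column_labels d1 d2) (row_labels d1 d2) (weight d1 d2) (ray \<iota>) allowed"
proof
  show "finite (column_labels d1 d2)" "finite (row_labels d1 d2)"
    by (rule finite_column_labels finite_row_labels)+
  have iota: "\<iota> k \<in> coords" for k using \<iota> by (auto simp: bij_betw_def)
  have inj: "\<iota> k = \<iota> l \<longleftrightarrow> k = l" for k l using \<iota> by (auto simp: bij_betw_def inj_on_def)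
  show "ray \<iota> \<rho> \<in> int_lattice" for \<rho>
  proof -
    have "(kernel_vector (unit (\<iota> k)) \<rho> :: real) = of_int (kernel_vector (unit (\<iota> k)) \<rho>)" for k
    proof -
      have "(unit (\<iota> k) :: column \<Rightarrow> real) = (\<lambda>\<kappa>. of_int (unit (\<iota> k) \<kappa>))" by (auto simp: unit_def)
      then show ?thesis by (simp add: kernel_vector_of_int)
    qed
    then show ?thesis unfolding int_lattice_iff ray_def by (metis Ints_of_int vec_lambda_beta)
  qed
  \<comment> \<open>The kernel parameter with coordinates \<open>m\<close>, so that pairing
    \<open>m\<close> with the rays evaluates its kernel vector.\<close>
  define zz where "zz m \<kappa> = (\<Sum>k\<in>UNIV. m $ k * unit (\<iota> k) \<kappa>)" for m :: "real ^ 'n" and \<kappa>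
  have zz: "zz m (\<iota> k) = m $ k" for m k
  proof -
    have "zz m (\<iota> k) = (\<Sum>l\<in>UNIV. if l = k then m $ l else 0)"
      unfolding zz_def by (rule sum.cong) (auto simp: unit_def inj)
    then show ?thesis by simp
  qed
  have inner: "m \<bullet> ray \<iota> \<rho> = kernel_vector (zz m) \<rho>" for m \<rho>
    unfolding zz_def kernel_vector_sum by (simp add: inner_vec_def ray_def)
  fix e :: "column \<Rightarrow> int"
  show "(\<forall>\<mu>\<in>row_labels d1 d2. (\<Sum>\<rho>\<in>column_labels d1 d2. weight d1 d2 \<mu> \<rho> * e \<rho>) = 0) \<longleftrightarrow>
      (\<exists>m\<in>int_lattice. \<forall>\<rho>\<in>column_labels d1 d2. of_int (e \<rho>) = m \<bullet> ray \<iota> \<rho>)"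
    unfolding kernel_iff
  proof
    assume e: "\<forall>\<rho>\<in>column_labels d1 d2. e \<rho> = kernel_vector e \<rho>"
    define m :: "real ^ 'n" where "m = (\<chi> k. of_int (e (\<iota> k)))"
    have "zz m \<kappa> = of_int (e \<kappa>)" if "\<kappa> \<in> coords" for \<kappa>
    proof -
      have "\<kappa> \<in> range \<iota>" unfolding bij_betw_imp_surj_on[OF \<iota>] by (rule that)
      then obtain k where "\<kappa> = \<iota> k" by (rule rangeE)
      then show ?thesis by (simp add: zz m_def)
    qed
    then have "m \<bullet> ray \<iota> \<rho> = of_int (e \<rho>)" if "\<rho> \<in> column_labels d1 d2" for \<rho>
      unfolding inner using kernel_vector_cong[of "zz m" "\<lambda>\<kappa>. of_int (e \<kappa>)"] that e
      by (metis kernel_vector_of_int)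
    moreover have "m \<in> int_lattice" by (simp add: int_lattice_iff m_def)
    ultimately show "\<exists>m\<in>int_lattice. \<forall>\<rho>\<in>column_labels d1 d2. of_int (e \<rho>) = m \<bullet> ray \<iota> \<rho>"
      by (intro bexI[of _ m]) auto
  next
    assume "\<exists>m\<in>int_lattice. \<forall>\<rho>\<in>column_labels d1 d2. of_int (e \<rho>) = m \<bullet> ray \<iota> \<rho>"
    then obtain m where m: "\<forall>\<rho>\<in>column_labels d1 d2. of_int (e \<rho>) = kernel_vector (zz m) \<rho>"
      unfolding inner by blast
    have "zz m \<kappa> = of_int (e \<kappa>)" if "\<kappa> \<in> coords" for \<kappa>
      using m coords_sub kernel_vector_coords[OF that, of "zz m"] that by (metis subsetD)
    then have "kernel_vector (zz m) \<rho> = of_int (kernel_vector e \<rho>)" if "\<rho> \<in> column_labels d1 d2" for \<rho>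
      using kernel_vector_cong[of "zz m" "\<lambda>\<kappa>. of_int (e \<kappa>)"] that by (metis kernel_vector_of_int)
    then show "\<forall>\<rho>\<in>column_labels d1 d2. e \<rho> = kernel_vector e \<rho>"
      using m by (metis of_int_eq_iff)
  qed
next
  show "S \<subseteq> column_labels d1 d2" if "S \<in> allowed" for S using that by (simp add: allowed_def)
  show "S' \<in> allowed" if "S \<in> allowed" "S' \<subseteq> S" for S S'
    using that unfolding allowed_def mem_Collect_eq by (meson subset_iff)
next
  note sum = ray_combination[OF \<iota>]
  fix y :: "real ^ 'n"
  obtain c where c: "\<forall>\<rho>\<in>column_labels d1 d2. 0 \<le> c \<rho>" "{\<rho> \<in> column_labels d1 d2. c \<rho> \<noteq> 0} \<in> allowed"
    "\<And>\<kappa>. \<kappa> \<in> coords \<Longrightarrow> invariant c \<kappa> = y $ inv_into UNIV \<iota> \<kappa>"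
    using representation_exists[of "\<lambda>\<kappa>. y $ inv_into UNIV \<iota> \<kappa>"] by blast
  have "(\<Sum>\<rho>\<in>column_labels d1 d2. c \<rho> *\<^sub>R ray \<iota> \<rho>) = y"
  proof (subst vec_eq_iff, rule allI)
    fix k
    have "\<iota> k \<in> coords" "inv_into UNIV \<iota> (\<iota> k) = k"
      using \<iota> bij_betw_inv_into_left[OF \<iota>] by (auto simp: bij_betw_def)
    then show "(\<Sum>\<rho>\<in>column_labels d1 d2. c \<rho> *\<^sub>R ray \<iota> \<rho>) $ k = y $ k" unfolding sum using c(3) by simp
  qed
  then show "\<exists>c. (\<forall>\<rho>\<in>column_labels d1 d2. 0 \<le> c \<rho>) \<and> {\<rho> \<in> column_labels d1 d2. c \<rho> \<noteq> 0} \<in> allowed \<and>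
      (\<Sum>\<rho>\<in>column_labels d1 d2. c \<rho> *\<^sub>R ray \<iota> \<rho>) = y"
    using c(1,2) by (intro exI[of _ c] conjI)
next
  note sum = ray_combination[OF \<iota>]
  fix c c' :: "column \<Rightarrow> real" and \<rho>
  assume c: "\<forall>\<rho>\<in>column_labels d1 d2. 0 \<le> c \<rho>" "{\<rho> \<in> column_labels d1 d2. c \<rho> \<noteq> 0} \<in> allowed"
    "\<forall>\<rho>\<in>column_labels d1 d2. 0 \<le> c' \<rho>" "{\<rho> \<in> column_labels d1 d2. c' \<rho> \<noteq> 0} \<in> allowed"
    and eq: "(\<Sum>\<rho>\<in>column_labels d1 d2. c \<rho> *\<^sub>R ray \<iota> \<rho>) = (\<Sum>\<rho>\<in>column_labels d1 d2. c' \<rho> *\<^sub>R ray \<iota> \<rho>)"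
    and \<rho>: "\<rho> \<in> column_labels d1 d2"
  have "invariant c \<kappa> = invariant c' \<kappa>" if "\<kappa> \<in> coords" for \<kappa>
  proof -
    have "\<kappa> \<in> range \<iota>" unfolding bij_betw_imp_surj_on[OF \<iota>] by (rule that)
    then obtain k where "\<kappa> = \<iota> k" by (rule rangeE)
    then show ?thesis using sum[of c k] sum[of c' k] eq by simp
  qed
  then show "c \<rho> = c' \<rho>" by (rule representation_unique[OF c _ \<rho>])
qed

end

theorem theorem6:
  fixes d1 d2 :: nat
  assumes "d1 \<ge> d2" and "d2 > 0"
    and "CARD('n::finite) = 2 * d1 + 2 * d2 + 1"
  shows "(\<exists>\<Delta> :: (real ^ 'n) set set.
            complete_fan \<Delta> \<and> simplicial_fan \<Delta> \<and>
            isomorphic_spaces (moduli_space d1 d2) (toric_variety \<Delta>)) \<and>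
         compact_space (moduli_space_classical d1 d2)"
proof -
  interpret bidegree d1 d2 using assms by unfold_locales auto
  have "card (UNIV :: 'n set) = card coords" using assms(3) card_coords by simp
  \<comment> \<open>The lattice has an arbitrary index type of the right size; any bijection with
    the kernel coordinates will do.\<close>
  then obtain \<iota> :: "'n \<Rightarrow> column" where \<iota>: "bij_betw \<iota> UNIV coords"
    using finite_same_card_bij[OF finite finite_coords] by blast
  interpret cox: cox_data "column_labels d1 d2" "row_labels d1 d2" "weight d1 d2" "ray \<iota>" allowed
    by (rule cox_data_bidegree[OF \<iota>])
  have aff: "cox.aff = affine_space d1 d2"
    by (simp add: cox.aff_def affine_space_def)
  have stable: "cox.stable = stable_points d1 d2"
    unfolding cox.stable_def cox.zeros_def aff allowed_stable_points ..
  have polys: "cox.polys = polynomial_functions d1 d2"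
    by (simp add: cox.polys_def polynomial_functions_def)
  have orbit: "cox.orbit = torus_orbit d1 d2"
  proof (rule ext)
    have "cox.act = torus_action d1 d2"
      by (intro ext) (simp add: cox.act_def torus_action_def)
    then show "cox.orbit x = torus_orbit d1 d2 x" for x
      by (simp add: cox.orbit_def torus_orbit_def cox.tor_def torus_def)
  qed
  have "moduli_space d1 d2 = cox.orbit_space"
    by (simp add: moduli_space_def cox.orbit_space_def stable polys orbit)
  moreover have "moduli_space_classical d1 d2 =
      final_topology {()} (\<lambda>_. top_of_set cox.stable) (\<lambda>_. cox.orbit)"
    by (simp add: moduli_space_classical_def stable orbit)
  ultimately show ?thesis
    using cox.complete_fan_cones cox.simplicial_fan_cones cox.orbit_space_isomorphic
      cox.orbit_space_compact by auto
qed

end
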